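(* Let $q\in\mathbb{C}^\times$ be not a root of unity and $Q\in\mathbb{C}^\times$. The assignment $\varphi\mapsto L(\mathbf{u}^{\langle Q\rangle}(\varphi))$ gives a bijection between $\mathbb{C}[x]^{\langle Q\rangle}$ and the set of isomorphism classes of finite dimensional simple $U_q(\mathfrak{sl}_2^{\langle Q\rangle}[x])$-modules.
   Context: $[k]=(q^k-q^{-k})/(q-q^{-1})$, $[x,y]=xy-yx$. $U_q(\mathfrak{sl}_2^{\langle Q\rangle}[x])$ is the $\mathbb{C}$-algebra with generators $X^\pm_t,J_t$ ($t\ge0$), $K^\pm$ and relations: $K^+$ and all $J_t$ pairwise commute; $K^+K^-=1=K^-K^+$; $(K^-)^2=1-(q-q^{-1})J_0$; $X^\pm_{t+1}X^\pm_s-q^{\pm2}X^\pm_sX^\pm_{t+1}=q^{\pm2}X^\pm_tX^\pm_{s+1}-X^\pm_{s+1}X^\pm_t$; $K^+X^\pm_tK^-=q^{\pm2}X^\pm_t$; $q^{\pm2}J_0X^\pm_t-q^{\mp2}X^\pm_tJ_0=\pm[2]X^\pm_t$; $[J_{s+1},X^\pm_t]=q^{\pm2}J_sX^\pm_{t+1}-q^{\mp2}X^\pm_{t+1}J_s$; $[X^+_t,X^-_s]=K^+(J_{s+t}-QJ_{s+t+1})$. For $\mathbf{u}=(\lambda,(u_t)_{t>0})\in\mathbb{C}^\times\times\prod_{t>0}\mathbb{C}$, $L(\mathbf{u})$ is the simple module generated by a vector $v_0$ with $X^+_tv_0=0$ ($t\ge0$), $K^+v_0=\lambda v_0$, $J_tv_0=u_tv_0$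 ($t>0$) (unique simple quotient of the corresponding Verma module). For $t,k>0$: $p_t(q)(x_1,\dots,x_k)=\sum_{\lambda\vdash t,\ell(\lambda)\le k}q^{-\ell(\lambda)}(q-q^{-1})^{\ell(\lambda)-1}m_\lambda(x_1,\dots,x_k)$ ($m_\lambda$ monomial symmetric polynomial). For $\beta\in\mathbb{C}^\times$, $\tilde\beta=(q-q^{-1})^{-1}(1-\beta^{-2})$, and $p^{\langle Q\rangle}_t(q;\beta)=p_t(q)+\tilde\beta Q^{-t}+(q-q^{-1})\sum_{z=1}^{t-1}\tilde\beta Q^{-t+z}p_z(q)$ (same variables). For nonzero $\varphi=\beta_\varphi(x-\gamma_1)\cdots(x-\gamma_k)$, $\mathbf{u}^{\langle Q\rangle}(\varphi)=(\beta_\varphi,(\tilde\beta_\varphi Q^{-t})_{t>0})$ if $k=0$ and $(\beta_\varphi q^k,(p^{\langle Q\rangle}_t(q;\beta_\varphi)(\gamma_1,\dots,\gamma_k))_{t>0})$ if $k>0$, where $\tilde\beta_\varphi=(q-q^{-1})^{-1}(1-\beta_\varphi^{-2})$. $\mathbb{C}[x]^{\langle Q\rangle}=\{\varphi\ne0:\beta_\varphi^{-2}Q^{-1}\text{ is not a root of }\varphi\}$. *)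

theory Defs
  imports "Jordan_Normal_Form.Matrix" "HOL-Computational_Algebra.Fundamental_Theorem_Algebra"
    "HOL-Library.Multiset"
begin

definition qint :: "complex \<Rightarrow> nat \<Rightarrow> complex" where
  "qint q k = (q ^ k - inverse q ^ k) / (q - inverse q)"

definition root_of_unity :: "complex \<Rightarrow> bool" where
  "root_of_unity q \<longleftrightarrow> (\<exists>n::nat. n > 0 \<and> q ^ n = 1)"

text \<open>A finite dimensional module of dimension n is given (after choosing a basis)
 by n x n complex matrices for the generators X+_t, X-_t, J_t (t \<ge> 0), K+, K-.\<close>

record umod =
  dim :: nat
  Xp :: "nat \<Rightarrow> complex mat"
  Xm :: "nat \<Rightarrow> complex mat"
  J  :: "nat \<Rightarrow> complex mat"
  Kp :: "complex mat"
  Km :: "complex mat"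

definition comm :: "complex mat \<Rightarrow> complex mat \<Rightarrow> complex mat" where
  "comm A B = A * B - B * A"

definition is_umod :: "complex \<Rightarrow> complex \<Rightarrow> umod \<Rightarrow> bool" where
  "is_umod q Q M \<longleftrightarrow> (let n = dim M; Id = 1\<^sub>m n; c = q - inverse q in
     (\<forall>t. Xp M t \<in> carrier_mat n n \<and> Xm M t \<in> carrier_mat n n \<and> J M t \<in> carrier_mat n n) \<and>
     Kp M \<in> carrier_mat n n \<and> Km M \<in> carrier_mat n n \<and>
     (\<forall>t. Kp M * J M t = J M t * Kp M) \<and>
     (\<forall>s t. J M s * J M t = J M t * J M s) \<and>
     Kp M * Km M = Id \<and> Km M * Kp M = Id \<and>
     Km M * Km M = Id - c \<cdot>\<^sub>m J M 0 \<and>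
     (\<forall>t s. Xp M (t+1) * Xp M s - (q^2) \<cdot>\<^sub>m (Xp M s * Xp M (t+1))
            = (q^2) \<cdot>\<^sub>m (Xp M t * Xp M (s+1)) - Xp M (s+1) * Xp M t) \<and>
     (\<forall>t s. Xm M (t+1) * Xm M s - (inverse q^2) \<cdot>\<^sub>m (Xm M s * Xm M (t+1))
            = (inverse q^2) \<cdot>\<^sub>m (Xm M t * Xm M (s+1)) - Xm M (s+1) * Xm M t) \<and>
     (\<forall>t. Kp M * Xp M t * Km M = (q^2) \<cdot>\<^sub>m Xp M t) \<and>
     (\<forall>t. Kp M * Xm M t * Km M = (inverse q^2) \<cdot>\<^sub>m Xm M t) \<and>
     (\<forall>t. (q^2) \<cdot>\<^sub>m (J M 0 * Xp M t) - (inverse q^2) \<cdot>\<^sub>m (Xp M t * J M 0)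
            = qint q 2 \<cdot>\<^sub>m Xp M t) \<and>
     (\<forall>t. (inverse q^2) \<cdot>\<^sub>m (J M 0 * Xm M t) - (q^2) \<cdot>\<^sub>m (Xm M t * J M 0)
            = (- qint q 2) \<cdot>\<^sub>m Xm M t) \<and>
     (\<forall>s t. comm (J M (s+1)) (Xp M t)
            = (q^2) \<cdot>\<^sub>m (J M s * Xp M (t+1)) - (inverse q^2) \<cdot>\<^sub>m (Xp M (t+1) * J M s)) \<and>
     (\<forall>s t. comm (J M (s+1)) (Xm M t)
            = (inverse q^2) \<cdot>\<^sub>m (J M s * Xm M (t+1)) - (q^2) \<cdot>\<^sub>m (Xm M (t+1) * J M s)) \<and>
     (\<forall>s t. comm (Xp M t) (Xm M s) = Kp M * (J M (s+t) - Q \<cdot>\<^sub>m J M (s+t+1))))"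

definition submodule :: "umod \<Rightarrow> complex vec set \<Rightarrow> bool" where
  "submodule M W \<longleftrightarrow> W \<subseteq> carrier_vec (dim M) \<and> 0\<^sub>v (dim M) \<in> W \<and>
     (\<forall>v\<in>W. \<forall>w\<in>W. v + w \<in> W) \<and> (\<forall>a. \<forall>v\<in>W. a \<cdot>\<^sub>v v \<in> W) \<and>
     (\<forall>v\<in>W. (\<forall>t. Xp M t *\<^sub>v v \<in> W \<and> Xm M t *\<^sub>v v \<in> W \<and> J M t *\<^sub>v v \<in> W) \<and>
              Kp M *\<^sub>v v \<in> W \<and> Km M *\<^sub>v v \<in> W)"

definition simple_umod :: "umod \<Rightarrow> bool" where
  "simple_umod M \<longleftrightarrow> dim M > 0 \<and>
     (\<forall>W. submodule M W \<longrightarrow> W = {0\<^sub>v (dim M)} \<or> W = carrier_vec (dim M))"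

definition iso_umod :: "umod \<Rightarrow> umod \<Rightarrow> bool" where
  "iso_umod M N \<longleftrightarrow> dim M = dim N \<and>
     (\<exists>P Pi. P \<in> carrier_mat (dim N) (dim M) \<and> Pi \<in> carrier_mat (dim M) (dim N) \<and>
        P * Pi = 1\<^sub>m (dim N) \<and> Pi * P = 1\<^sub>m (dim M) \<and>
        (\<forall>t. P * Xp M t = Xp N t * P \<and> P * Xm M t = Xm N t * P \<and> P * J M t = J N t * P) \<and>
        P * Kp M = Kp N * P \<and> P * Km M = Km N * P)"

text \<open>Highest weight data u = (lambda, (u_t)_{t>0}); the value at t = 0 is unused.\<close>

definition generated_by :: "umod \<Rightarrow> complex vec \<Rightarrow> bool" where
  "generated_by M v \<longleftrightarrow> (\<forall>W. submodule M W \<and> v \<in> W \<longrightarrow> W = carrier_vec (dim M))"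

definition hw_vector :: "umod \<Rightarrow> complex \<times> (nat \<Rightarrow> complex) \<Rightarrow> complex vec \<Rightarrow> bool" where
  "hw_vector M u v \<longleftrightarrow> v \<in> carrier_vec (dim M) \<and> v \<noteq> 0\<^sub>v (dim M) \<and>
     (\<forall>t. Xp M t *\<^sub>v v = 0\<^sub>v (dim M)) \<and> Kp M *\<^sub>v v = fst u \<cdot>\<^sub>v v \<and>
     (\<forall>t>0. J M t *\<^sub>v v = snd u t \<cdot>\<^sub>v v)"

definition is_L :: "complex \<Rightarrow> complex \<Rightarrow> umod \<Rightarrow> complex \<times> (nat \<Rightarrow> complex) \<Rightarrow> bool" where
  "is_L q Q M u \<longleftrightarrow> is_umod q Q M \<and> simple_umod M \<and> (\<exists>v. hw_vector M u v \<and> generated_by M v)"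

definition partitions :: "nat \<Rightarrow> nat \<Rightarrow> nat multiset set" where
  "partitions t k = {lam. (\<forall>x\<in>#lam. x > 0) \<and> sum_mset lam = t \<and> size lam \<le> k}"

definition msym :: "nat multiset \<Rightarrow> complex list \<Rightarrow> complex" where
  "msym lam xs = (\<Sum>\<alpha>\<in>{\<alpha>::nat\<Rightarrow>nat. (\<forall>i\<ge>length xs. \<alpha> i = 0) \<and>
        image_mset \<alpha> (filter_mset (\<lambda>i. \<alpha> i \<noteq> 0) (mset [0..<length xs])) = lam}.
      \<Prod>i<length xs. (xs ! i) ^ \<alpha> i)"

definition pq :: "complex \<Rightarrow> nat \<Rightarrow> complex list \<Rightarrow> complex" where
  "pq q t xs = (\<Sum>lam\<in>partitions t (length xs).
      inverse q ^ size lam * (q - inverse q) ^ (size lam - 1) * msym lam xs)"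

definition btilde :: "complex \<Rightarrow> complex \<Rightarrow> complex" where
  "btilde q b = (1 - inverse b ^ 2) / (q - inverse q)"

definition pQ :: "complex \<Rightarrow> complex \<Rightarrow> complex \<Rightarrow> nat \<Rightarrow> complex list \<Rightarrow> complex" where
  "pQ q Q b t xs = pq q t xs + btilde q b * inverse Q ^ t
     + (q - inverse q) * (\<Sum>z\<in>{1..<t}. btilde q b * inverse Q ^ (t - z) * pq q z xs)"

definition root_list :: "complex poly \<Rightarrow> complex list" where
  "root_list phi = (SOME xs. mset xs = proots phi)"

definition uQ :: "complex \<Rightarrow> complex \<Rightarrow> complex poly \<Rightarrow> complex \<times> (nat \<Rightarrow> complex)" where
  "uQ q Q phi = (if degree phi = 0
     then (lead_coeff phi, \<lambda>t. btilde q (lead_coeff phi) * inverse Q ^ t)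
     else (lead_coeff phi * q ^ degree phi,
           \<lambda>t. pQ q Q (lead_coeff phi) t (root_list phi)))"

definition polysQ :: "complex \<Rightarrow> complex poly set" where
  "polysQ Q = {phi. phi \<noteq> 0 \<and> poly phi (inverse (lead_coeff phi) ^ 2 * inverse Q) \<noteq> 0}"

end

theory Submission
  imports Defs "HOL-Computational_Algebra.Formal_Power_Series" "HOL-Computational_Algebra.Polynomial_FPS"
begin

text \<open>A highest weight module is encoded by its vacuum functional: the linear functional on words in
  the generators that reads off the coefficient of the highest weight vector in \<open>w v\<^sub>0\<close>. It is
  determined by the highest weight \<open>(\<mu>, u)\<close>, and the simple module is finite dimensional
  exactly when the functional has finite rank.

  For distinct nonzero \<open>\<gamma>\<^sub>1, \<dots>, \<gamma>\<^sub>k\<close> there is an explicit module on functions of subsets of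
  \<open>{1, \<dots>, k}\<close>, in which \<open>X\<^sup>+\<close> and \<open>X\<^sup>-\<close> move single elements in and out of the subset and
  the generating series of the \<open>J\<^sub>t\<close> acts diagonally; the relation for \<open>[X\<^sup>+, X\<^sup>-]\<close> is a
  partial fraction identity. The value of the functional on a fixed word depends continuously on
  finitely many of the \<open>u\<^sub>t\<close>, and the bound \<open>2 ^ k\<close> on the rank survives limits, so arbitrary
  \<open>\<gamma>\<close> are reached by perturbation.

  Conversely, let \<open>\<eta> = \<mu>\<^sup>-\<^sup>2 Q\<^sup>-\<^sup>1\<close>, and let \<open>P\<close> be the power series with constant term \<open>1\<close> solving
  \<open>(1 - z/Q) \<Psi>(z) P(z) = (1 - \<eta> z) P(q\<^sup>-\<^sup>2 z)\<close>, where \<open>\<Psi>(z) = 1 + (q - q\<^sup>-\<^sup>1) \<Sum> u\<^sub>t z\<^sup>t\<close>;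
  multiplying \<open>P\<close> by \<open>1 - q\<^sup>2 \<eta> z\<close> replaces \<open>\<eta>\<close> by \<open>q\<^sup>2 \<eta>\<close>. The expectation of
  \<open>(X\<^sup>+\<^sub>0)\<^sup>k (X\<^sup>-\<^sub>0)\<^sup>k\<close> is a nonzero multiple of a value of such a solution truncated at degree \<open>k\<close>.
  It vanishes for large \<open>k\<close> in a finite dimensional module, which forces a solution to be a
  polynomial. Cancelling the roots \<open>\<beta>\<^sup>-\<^sup>2 Q\<^sup>-\<^sup>1\<close> one at a time leads into \<open>\<complex>[x]\<^sup>\<langle>\<^sup>Q\<^sup>\<rangle>\<close>, and
  uniqueness of the solution gives injectivity.\<close>

section \<open>Words and vacuum functionals\<close>

text \<open>Functionals take the place of a triangular decomposition: the relations reduce every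
  word to lowering monomials, which determines the functional, and explicit models show that it
  exists. The models dictate the equation for P. A root \<gamma> contributes (1 - q^-2 \<gamma>
  z)/(1 - \<gamma> z) to \<Psi>, and \<beta> contributes (1 - \<beta>^-2 z/Q)/(1 - z/Q); for P the
  product of the 1 - \<gamma> z this is the equation with \<eta> = \<beta>^-2 Q^-1. Since \<mu> =
  \<beta> q^k with an unknown number k of roots, a highest weight leaves a sequence of candidates
  \<eta> = q^(2k) \<mu>^-2 Q^-1, and changing \<eta> to q^2 \<eta> means allowing one more root. In
  a model with k roots the expectation is ([k]!)^2 times the product of the \<beta>^-1 - \<beta> Q
  \<gamma>. Each factor is \<beta>^-1 (1 - \<gamma>/\<eta>), so the product is \<beta>^-k times the
  reversed polynomial at 1/\<eta>; this is how a value of a truncation enters. A root equal to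
  \<beta>^-2 Q^-1 is invisible in the highest weight: its denominator cancels the numerator of the
  factor of \<beta>, and the result is the factor of \<beta> q. Hence these roots must be excluded
  for the polynomial to be unique.\<close>

text \<open>\<open>GL\<close> stands for \<open>K\<^sup>-\<close>; a relation is a list of coefficients and words whose sum vanishes.\<close>

datatype gen = GP nat | GM nat | GJ nat | GK | GL

inductive defrel :: "complex \<Rightarrow> complex \<Rightarrow> (complex \<times> gen list) list \<Rightarrow> bool" for q Q where
  KJ: "defrel q Q [(1, [GK, GJ t]), (-1, [GJ t, GK])]"
| JJ: "defrel q Q [(1, [GJ s, GJ t]), (-1, [GJ t, GJ s])]"
| KL: "defrel q Q [(1, [GK, GL]), (-1, [])]"
| LK: "defrel q Q [(1, [GL, GK]), (-1, [])]"
| LL: "defrel q Q [(1, [GL, GL]), (-1, []), (q - inverse q, [GJ 0])]"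
| PP: "defrel q Q [(1, [GP (t+1), GP s]), (-(q^2), [GP s, GP (t+1)]),
        (-(q^2), [GP t, GP (s+1)]), (1, [GP (s+1), GP t])]"
| MM: "defrel q Q [(1, [GM (t+1), GM s]), (-(inverse q^2), [GM s, GM (t+1)]),
        (-(inverse q^2), [GM t, GM (s+1)]), (1, [GM (s+1), GM t])]"
| KP: "defrel q Q [(1, [GK, GP t, GL]), (-(q^2), [GP t])]"
| KM: "defrel q Q [(1, [GK, GM t, GL]), (-(inverse q^2), [GM t])]"
| J0P: "defrel q Q [(q^2, [GJ 0, GP t]), (-(inverse q^2), [GP t, GJ 0]), (- qint q 2, [GP t])]"
| J0M: "defrel q Q [(inverse q^2, [GJ 0, GM t]), (-(q^2), [GM t, GJ 0]), (qint q 2, [GM t])]"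
| JP: "defrel q Q [(1, [GJ (s+1), GP t]), (-1, [GP t, GJ (s+1)]),
        (-(q^2), [GJ s, GP (t+1)]), (inverse q^2, [GP (t+1), GJ s])]"
| JM: "defrel q Q [(1, [GJ (s+1), GM t]), (-1, [GM t, GJ (s+1)]),
        (-(inverse q^2), [GJ s, GM (t+1)]), (q^2, [GM (t+1), GJ s])]"
| PM: "defrel q Q [(1, [GP t, GM s]), (-1, [GM s, GP t]),
        (-1, [GK, GJ (s+t)]), (Q, [GK, GJ (s+t+1)])]"

definition word_sum :: "(gen list \<Rightarrow> complex) \<Rightarrow> (complex \<times> gen list) list \<Rightarrow> complex" where
  "word_sum \<omega> r = (\<Sum>(c, w)\<leftarrow>r. c * \<omega> w)"

lemma word_sum_simps [simp]:
  "word_sum \<omega> [] = 0" "word_sum \<omega> ((c, w) # r) = c * \<omega> w + word_sum \<omega> r"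
  by (simp_all add: word_sum_def)

text \<open>Relations are imposed between arbitrary left and right contexts, the highest weight
  conditions only at the right end, where a letter meets the highest weight vector. There is no
  normalisation, so that every coordinate of a word applied to a highest weight vector qualifies as
  well. The eigenvalue of \<open>GJ 0\<close> follows from that of \<open>GK\<close>.\<close>

definition hw_functional ::
  "complex \<Rightarrow> complex \<Rightarrow> complex \<Rightarrow> (nat \<Rightarrow> complex) \<Rightarrow> (gen list \<Rightarrow> complex) \<Rightarrow> bool" where
  "hw_functional q Q \<mu> u \<omega> \<longleftrightarrow>
     (\<forall>r a b. defrel q Q r \<longrightarrow> word_sum (\<lambda>w. \<omega> (a @ w @ b)) r = 0) \<and>
     (\<forall>a t. \<omega> (a @ [GP t]) = 0) \<and>
     (\<forall>a. \<omega> (a @ [GK]) = \<mu> * \<omega> a) \<and>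
     (\<forall>a t. t > 0 \<longrightarrow> \<omega> (a @ [GJ t]) = u t * \<omega> a)"

text \<open>Killing every word that begins with a lowering letter makes the functional the
  projection to the highest weight line along the image of the lowering operators.\<close>

definition vacuum_functional ::
  "complex \<Rightarrow> complex \<Rightarrow> complex \<Rightarrow> (nat \<Rightarrow> complex) \<Rightarrow> (gen list \<Rightarrow> complex) \<Rightarrow> bool" where
  "vacuum_functional q Q \<mu> u \<omega> \<longleftrightarrow>
     hw_functional q Q \<mu> u \<omega> \<and> \<omega> [] = 1 \<and> (\<forall>t b. \<omega> (GM t # b) = 0)"

text \<open>Bounds the index of the largest \<open>GJ t\<close>, hence of the largest
  \<open>u t\<close>, that normal ordering can produce. \<open>GP t\<close> counts t + 1 because its
  commutator with \<open>GM s\<close> contains \<open>GJ (s + t + 1)\<close>.\<close>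

fun weight :: "gen list \<Rightarrow> nat" where
  "weight [] = 0"
| "weight (GP t # w) = t + 1 + weight w"
| "weight (GM t # w) = t + weight w"
| "weight (GJ t # w) = t + weight w"
| "weight (GK # w) = weight w"
| "weight (GL # w) = weight w"

lemma hw_functional_relD:
  assumes "hw_functional q Q \<mu> u \<omega>" "defrel q Q r"
  shows "word_sum (\<lambda>w. \<omega> (a @ w @ b)) r = 0"
  using assms unfolding hw_functional_def by blast

section \<open>Commutation rules seen through a functional\<close>

context
  fixes q Q \<mu> u \<omega>
  assumes hw: "hw_functional q Q \<mu> u \<omega>" and q0: "q \<noteq> 0" and l0: "\<mu> \<noteq> 0"
begin

lemma hw_functional_end:
  "\<omega> (a @ [GP t]) = 0" "\<omega> (a @ [GK]) = \<mu> * \<omega> a" "t > 0 \<Longrightarrow> \<omega> (a @ [GJ t]) = u t * \<omega> a"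
  using hw unfolding hw_functional_def by blast+

lemma hw_functional_LK: "\<omega> (a @ GL # GK # b) = \<omega> (a @ b)"
  using hw_functional_relD[OF hw LK, of a b] by simp

lemma hw_functional_LL: "(q - inverse q) * \<omega> (a @ GJ 0 # b) = \<omega> (a @ b) - \<omega> (a @ GL # GL # b)"
  using hw_functional_relD[OF hw LL, of a b] by (simp add: algebra_simps)

lemma hw_functional_KM: "\<omega> (a @ GK # GM t # b) = inverse q^2 * \<omega> (a @ GM t # GK # b)"
  using hw_functional_relD[OF hw KM[of q Q t], of a "GK # b"] hw_functional_LK[of "a @ [GK, GM t]" b]
  by simp

lemma hw_functional_JM:
  "\<omega> (a @ GJ (Suc s) # GM t # b) = \<omega> (a @ GM t # GJ (Suc s) # b)
     + inverse q^2 * \<omega> (a @ GJ s # GM (Suc t) # b) - q^2 * \<omega> (a @ GM (Suc t) # GJ s # b)"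
  using hw_functional_relD[OF hw JM[of q Q s t], of a b] by (simp add: algebra_simps)

lemma hw_functional_PM:
  "\<omega> (a @ GP t # GM s # b) = \<omega> (a @ GM s # GP t # b)
     + \<omega> (a @ GK # GJ (s+t) # b) - Q * \<omega> (a @ GK # GJ (s+t+1) # b)"
  using hw_functional_relD[OF hw PM[of q Q t s], of a b] by (simp add: algebra_simps)

lemma hw_functional_K_monomial:
  "\<omega> (a @ GK # map GM ts) = \<mu> * (inverse q^2) ^ length ts * \<omega> (a @ map GM ts)"
proof (induction ts arbitrary: a)
  case Nil
  then show ?case by (simp add: hw_functional_end)
next
  case (Cons t ts)
  then show ?case using hw_functional_KM[of a t "map GM ts"] Cons.IH[of "a @ [GM t]"] by simp
qed

lemma hw_functional_L_monomial:
  "\<omega> (a @ GL # map GM ts) = inverse \<mu> * (q^2) ^ length ts * \<omega> (a @ map GM ts)"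
  using hw_functional_K_monomial[of "a @ [GL]" ts] hw_functional_LK[of a "map GM ts"] q0 l0
  by (simp add: field_simps power_mult_distrib flip: power_mult)

end

text \<open>The index \<open>n\<close> runs through a family of functionals, so that the closure of \<open>R\<close> under sums and
  products yields statements about all of them at once: that two of them agree, or that a sequence of
  them converges.\<close>

inductive monomial_comb :: "(('n \<Rightarrow> complex) set) \<Rightarrow> ('n \<Rightarrow> gen list \<Rightarrow> complex) \<Rightarrow> nat \<Rightarrow>
    ('n \<Rightarrow> gen list \<Rightarrow> complex) \<Rightarrow> bool" for R \<omega> where
  zero: "monomial_comb R \<omega> d (\<lambda>n a. 0)"
| monomial: "sum_list ts \<le> d \<Longrightarrow> monomial_comb R \<omega> d (\<lambda>n a. \<omega> n (a @ map GM ts))"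
| add: "monomial_comb R \<omega> d f \<Longrightarrow> monomial_comb R \<omega> d g \<Longrightarrow> monomial_comb R \<omega> d (\<lambda>n a. f n a + g n a)"
| scale: "r \<in> R \<Longrightarrow> monomial_comb R \<omega> d f \<Longrightarrow> monomial_comb R \<omega> d (\<lambda>n a. r n * f n a)"

text \<open>\<open>R\<close> is a ring of functions of the family index that contains the constants,
  \<mu>, its inverse and the values \<open>u t\<close> for t from 1 to \<open>N\<close>. The cutoff
  \<open>N\<close> is what later confines a word to finitely many \<open>u t\<close>.\<close>

locale hw_family =
  fixes q Q :: complex and \<omega> :: "'n \<Rightarrow> gen list \<Rightarrow> complex" and \<mu> :: "'n \<Rightarrow> complex"
    and u :: "'n \<Rightarrow> nat \<Rightarrow> complex" and R :: "('n \<Rightarrow> complex) set" and N :: nat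
  assumes q0: "q \<noteq> 0" and qq: "q - inverse q \<noteq> 0"
    and hw: "\<And>n. hw_functional q Q (\<mu> n) (u n) (\<omega> n)" and l0: "\<And>n. \<mu> n \<noteq> 0"
    and R_const: "\<And>c. (\<lambda>n. c) \<in> R"
    and R_add: "\<And>f g. f \<in> R \<Longrightarrow> g \<in> R \<Longrightarrow> (\<lambda>n. f n + g n) \<in> R"
    and R_mult: "\<And>f g. f \<in> R \<Longrightarrow> g \<in> R \<Longrightarrow> (\<lambda>n. f n * g n) \<in> R"
    and R_l: "\<mu> \<in> R" and R_il: "(\<lambda>n. inverse (\<mu> n)) \<in> R"
    and R_u: "\<And>t. 0 < t \<Longrightarrow> t \<le> N \<Longrightarrow> (\<lambda>n. u n t) \<in> R"
begin

abbreviation "mc \<equiv> monomial_comb R \<omega>"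

lemma mc_mono: "mc d f \<Longrightarrow> d \<le> e \<Longrightarrow> mc e f"
proof (induction rule: monomial_comb.induct)
  case (monomial ts d)
  then show ?case by (intro monomial_comb.monomial) simp
next
  case zero
  show ?case by (rule monomial_comb.zero)
next
  case (add d f g)
  show ?case by (rule monomial_comb.add) (use add in blast)+
next
  case (scale r d f)
  show ?case by (rule monomial_comb.scale[OF scale(1)]) (use scale in blast)
qed

lemma mc_scale_const: "mc d f \<Longrightarrow> mc d (\<lambda>n a. c * f n a)"
  using monomial_comb.scale[of "\<lambda>n. c" R \<omega> d f] R_const by simp

lemma mc_diff: "mc d f \<Longrightarrow> mc d g \<Longrightarrow> mc d (\<lambda>n a. f n a - g n a)"
  using monomial_comb.add[of R \<omega> d f "\<lambda>n a. (-1) * g n a"] mc_scale_const[of d g "-1"] by simp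

text \<open>A member \<open>f\<close> of \<open>mc d\<close> stands for a combination of lowering
  monomials applied to the highest weight vector, tested by left words \<open>a\<close>. Appending
  \<open>g\<close> to \<open>a\<close> is therefore the action of \<open>g\<close> on that vector,
  and it suffices to know it on monomials.\<close>

lemma mc_lift:
  assumes "mc d f" and "\<And>ts. sum_list ts \<le> d \<Longrightarrow> mc e (\<lambda>n a. \<omega> n (a @ g # map GM ts))"
  shows "mc e (\<lambda>n a. f n (a @ [g]))"
  using assms
proof (induction rule: monomial_comb.induct)
  case (scale r d f)
  show ?case by (rule monomial_comb.scale[OF scale(1) scale(3)[OF scale(4)]])
next
  case (add d f g)
  show ?case by (rule monomial_comb.add[OF add(3)[OF add(5)] add(4)[OF add(5)]])
next
  case (monomial ts d)
  show ?case using monomial(2)[OF monomial(1)] by simp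
qed (rule monomial_comb.zero)

lemma mc_M: assumes "mc d f" shows "mc (d + t) (\<lambda>n a. f n (a @ [GM t]))"
proof (rule mc_lift[OF assms])
  fix ts assume "sum_list ts \<le> d"
  then show "mc (d + t) (\<lambda>n a. \<omega> n (a @ GM t # map GM ts))"
    using monomial_comb.monomial[of "t # ts" "d + t" R \<omega>] by simp
qed

lemma mc_K: assumes "mc d f" shows "mc d (\<lambda>n a. f n (a @ [GK]))"
proof (rule mc_lift[OF assms])
  fix ts assume "sum_list ts \<le> d"
  then show "mc d (\<lambda>n a. \<omega> n (a @ GK # map GM ts))"
    unfolding hw_functional_K_monomial[OF hw q0 l0]
    by (intro monomial_comb.scale[where r="\<lambda>n. \<mu> n * (inverse q ^ 2) ^ length ts"] R_mult R_l R_const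
        monomial_comb.monomial)
qed

lemma mc_L: assumes "mc d f" shows "mc d (\<lambda>n a. f n (a @ [GL]))"
proof (rule mc_lift[OF assms])
  fix ts assume "sum_list ts \<le> d"
  then show "mc d (\<lambda>n a. \<omega> n (a @ GL # map GM ts))"
    unfolding hw_functional_L_monomial[OF hw q0 l0]
    by (intro monomial_comb.scale[where r="\<lambda>n. inverse (\<mu> n) * (q ^ 2) ^ length ts"] R_mult R_il R_const
        monomial_comb.monomial)
qed

text \<open>The relation between \<open>J\<close> and the lowering letters trades
  \<open>GJ (s+1)\<close> next to \<open>GM t\<close> for \<open>GJ s\<close> next to
  \<open>GM (t+1)\<close>. The outer induction lowers the index of \<open>J\<close>, the inner one
  moves \<open>J\<close> through the monomial, and the degree bound counts the total of all
  indices.\<close>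

lemma mc_J_monomial:
  "s \<le> N \<Longrightarrow> sum_list ts \<le> d \<Longrightarrow> mc (d + s) (\<lambda>n a. \<omega> n (a @ GJ s # map GM ts))"
proof (induction s arbitrary: ts d)
  case 0
  \<comment> \<open>The base case writes \<open>J 0\<close> as (1 - L^2)/(q - q^-1), with L the
    action of \<open>GL\<close>.\<close>
  have "mc d (\<lambda>n a. inverse (q - inverse q) * (\<omega> n (a @ map GM ts) - \<omega> n (a @ GL # GL # map GM ts)))"
    using mc_L[OF mc_L[OF monomial_comb.monomial[OF 0(2)]]]
    by (intro mc_scale_const mc_diff) (auto intro: monomial_comb.monomial 0)
  moreover have "\<omega> n (a @ GJ 0 # map GM ts) =
      inverse (q - inverse q) * (\<omega> n (a @ map GM ts) - \<omega> n (a @ GL # GL # map GM ts))" for n a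
    using hw_functional_LL[OF hw q0 l0, of n a "map GM ts"] qq by (simp add: field_simps)
  ultimately show ?case by simp
next
  case (Suc s)
  show ?case using Suc.prems
  proof (induction ts arbitrary: d)
    case Nil
    have "mc (d + Suc s) (\<lambda>n a. u n (Suc s) * \<omega> n (a @ map GM []))"
      by (intro monomial_comb.scale[where r="\<lambda>n. u n (Suc s)"] R_u monomial_comb.monomial)
        (use Nil in auto)
    then show ?case by (simp add: hw_functional_end[OF hw q0 l0])
  next
    case (Cons t ts)
    let ?d = "d - t"
    have d: "sum_list ts \<le> ?d" "t \<le> d" using Cons.prems by auto
    have 1: "mc (d + Suc s) (\<lambda>n a. \<omega> n (a @ GM t # GJ (Suc s) # map GM ts))"
      using mc_M[OF Cons.IH[OF _ d(1)], of t] Cons.prems d(2) by simp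
    have 2: "mc (d + Suc s) (\<lambda>n a. \<omega> n (a @ GJ s # GM (Suc t) # map GM ts))"
      using Suc.IH[of "Suc t # ts" "Suc d"] Cons.prems by simp
    have 3: "mc (d + Suc s) (\<lambda>n a. \<omega> n (a @ GM (Suc t) # GJ s # map GM ts))"
      using mc_M[OF Suc.IH[OF _ d(1)], of "Suc t"] Cons.prems d(2) by simp
    show ?case
      unfolding list.map hw_functional_JM[OF hw q0 l0]
      by (intro mc_diff monomial_comb.add mc_scale_const 1 2 3)
  qed
qed

lemma mc_J: assumes "mc d f" "s \<le> N" shows "mc (d + s) (\<lambda>n a. f n (a @ [GJ s]))"
  by (rule mc_lift[OF assms(1)]) (rule mc_J_monomial[OF assms(2)])

text \<open>Commuting \<open>GP t\<close> past \<open>GM s\<close> leaves \<open>GK\<close> times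
  \<open>GJ (s+t)\<close> and \<open>GJ (s+t+1)\<close>; the second index accounts for the extra 1
  in the degree and for the bound by \<open>N\<close>.\<close>

lemma mc_P_monomial:
  "d + t + 1 \<le> N \<Longrightarrow> sum_list ts \<le> d \<Longrightarrow> mc (d + t + 1) (\<lambda>n a. \<omega> n (a @ GP t # map GM ts))"
proof (induction ts arbitrary: d)
  case Nil
  then show ?case by (simp add: hw_functional_end[OF hw q0 l0] monomial_comb.zero)
next
  case (Cons s ts)
  let ?d = "d - s"
  have d: "sum_list ts \<le> ?d" "s \<le> d" "?d + t + 1 \<le> N" using Cons.prems by auto
  have 1: "mc (d + t + 1) (\<lambda>n a. \<omega> n (a @ GM s # GP t # map GM ts))"
    using mc_M[OF Cons.IH[OF d(3) d(1)], of s] d(2) by simp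
  have 2: "mc (d + t + 1) (\<lambda>n a. \<omega> n (a @ GK # GJ (s + t) # map GM ts))"
    using mc_mono[OF mc_K[OF mc_J_monomial[OF _ d(1), of "s + t"]], of "d + t + 1"] d Cons.prems by simp
  have 3: "mc (d + t + 1) (\<lambda>n a. \<omega> n (a @ GK # GJ (s + t + 1) # map GM ts))"
    using mc_mono[OF mc_K[OF mc_J_monomial[OF _ d(1), of "s + t + 1"]], of "d + t + 1"] d Cons.prems by simp
  show ?case
    unfolding list.map hw_functional_PM[OF hw q0 l0]
    by (intro mc_diff monomial_comb.add mc_scale_const 1 2 3)
qed

lemma mc_P: assumes "mc d f" "d + t + 1 \<le> N" shows "mc (d + t + 1) (\<lambda>n a. f n (a @ [GP t]))"
  by (rule mc_lift[OF assms(1)]) (rule mc_P_monomial[OF assms(2)])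

text \<open>Normal ordering: every word acts on the highest weight vector as an
  \<open>R\<close>-combination of lowering monomials, its letters being absorbed from the
  right.\<close>

lemma mc_word: "weight w \<le> N \<Longrightarrow> mc (weight w) (\<lambda>n a. \<omega> n (a @ w))"
proof (induction w)
  case Nil
  then show ?case using monomial_comb.monomial[of "[]" 0 R \<omega>] by simp
next
  case (Cons g w)
  have IH: "mc (weight w) (\<lambda>n a. \<omega> n (a @ w))"
    using Cons by (cases g) auto
  show ?case
  proof (cases g)
    case (GP t)
    then show ?thesis using mc_P[OF IH, of t] Cons.prems by (simp add: ac_simps)
  next
    case (GM t)
    then show ?thesis using mc_M[OF IH, of t] Cons.prems by (simp add: ac_simps)
  next
    case (GJ t)
    then show ?thesis using mc_J[OF IH, of t] Cons.prems by (simp add: ac_simps)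
  next
    case GK
    then show ?thesis using mc_K[OF IH] by simp
  next
    case GL
    then show ?thesis using mc_L[OF IH] by simp
  qed
qed

text \<open>With the empty left word every nonempty monomial begins with a \<open>GM\<close> and is
  killed, so only the coefficient of the empty monomial survives, and it lies in
  \<open>R\<close>.\<close>

lemma mc_vacuum:
  assumes "mc d f" and "\<And>n. vacuum_functional q Q (\<mu> n) (u n) (\<omega> n)"
  shows "(\<lambda>n. f n []) \<in> R"
  using assms(1)
proof (induction rule: monomial_comb.induct)
  case (monomial ts d)
  then show ?case
    using assms(2) R_const[of "if ts = [] then 1 else 0"]
    by (cases ts) (auto simp: vacuum_functional_def)
qed (auto intro: R_const R_add R_mult)

lemma vacuum_word_in_R:
  assumes "\<And>n. vacuum_functional q Q (\<mu> n) (u n) (\<omega> n)" "weight w \<le> N"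
  shows "(\<lambda>n. \<omega> n w) \<in> R"
  using mc_vacuum[OF mc_word[OF assms(2)] assms(1)] by simp

end

text \<open>The index is \<open>bool\<close>, and \<open>R\<close> consists of the functions taking
  equal values at both points; the conclusion is that the value at \<open>w\<close> belongs to
  \<open>R\<close>.\<close>

lemma vacuum_functional_agree:
  assumes q: "q \<noteq> 0" "q - inverse q \<noteq> 0" "\<mu> \<noteq> 0"
    and \<omega>: "vacuum_functional q Q \<mu> u \<omega>" "vacuum_functional q Q \<mu> u' \<omega>'"
    and agree: "\<And>t. 0 < t \<Longrightarrow> t \<le> weight w \<Longrightarrow> u t = u' t"
  shows "\<omega> w = \<omega>' w"
proof -
  have vac: "vacuum_functional q Q \<mu> (if n then u else u') (if n then \<omega> else \<omega>')" for n
    using \<omega> by auto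
  then have hw: "hw_functional q Q \<mu> (if n then u else u') (if n then \<omega> else \<omega>')" for n
    unfolding vacuum_functional_def by blast
  interpret hw_family q Q "\<lambda>n. if n then \<omega> else \<omega>'" "\<lambda>n. \<mu>" "\<lambda>n. if n then u else u'"
    "{f. f True = f False}" "weight w"
    using q hw agree by unfold_locales auto
  show ?thesis using vacuum_word_in_R[OF vac, of w] by auto
qed

text \<open>Here \<open>R\<close> is the ring of convergent sequences, so the values at every word
  converge. The defining equations are linear with fixed or convergent coefficients and pass to the
  limit.\<close>

lemma vacuum_functional_limit:
  assumes q: "q \<noteq> 0" "q - inverse q \<noteq> 0" "\<mu> \<noteq> 0"
    and \<omega>: "\<And>n. vacuum_functional q Q \<mu> (u n) (\<omega> n)"
    and u: "\<And>t. 0 < t \<Longrightarrow> (\<lambda>n. u n t) \<longlonglongrightarrow> v t"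
  obtains \<chi> where "vacuum_functional q Q \<mu> v \<chi>" "\<And>w. (\<lambda>n. \<omega> n w) \<longlonglongrightarrow> \<chi> w"
proof -
  have hw: "hw_functional q Q \<mu> (u n) (\<omega> n)" for n
    using \<omega> unfolding vacuum_functional_def by blast
  have conv: "convergent (\<lambda>n. \<omega> n w)" for w
  proof -
    interpret hw_family q Q \<omega> "\<lambda>n. \<mu>" u "{f. convergent f}" "weight w"
    proof unfold_locales
      show "(\<lambda>n. u n t) \<in> {f. convergent f}" if "0 < t" for t
        using convergentI[OF u[OF that]] by simp
      show "(\<lambda>n. f n * g n) \<in> {f. convergent f}"
        if "f \<in> {f. convergent f}" "g \<in> {f. convergent f}" for f g :: "nat \<Rightarrow> complex"
        using convergent_mult[of f g] that by simp
      show "(\<lambda>n. f n + g n) \<in> {f. convergent f}"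
        if "f \<in> {f. convergent f}" "g \<in> {f. convergent f}" for f g :: "nat \<Rightarrow> complex"
        using convergent_add[of f g] that by simp
    qed (use q hw in \<open>simp_all add: convergent_const\<close>)
    show ?thesis using vacuum_word_in_R[OF \<omega>, of w] by simp
  qed
  define \<chi> where "\<chi> w = lim (\<lambda>n. \<omega> n w)" for w
  have lim: "(\<lambda>n. \<omega> n w) \<longlonglongrightarrow> \<chi> w" for w
    using conv unfolding \<chi>_def convergent_LIMSEQ_iff .
  have sum_lim: "(\<lambda>n. word_sum (\<lambda>w. \<omega> n (a @ w @ b)) r) \<longlonglongrightarrow> word_sum (\<lambda>w. \<chi> (a @ w @ b)) r" for a b r
    by (induction r) (auto intro!: tendsto_intros lim)
  have "word_sum (\<lambda>w. \<chi> (a @ w @ b)) r = 0" if "defrel q Q r" for a b r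
    using sum_lim[of a b r] hw_functional_relD[OF hw that]
    by (simp add: LIMSEQ_const_iff)
  moreover have "\<chi> (a @ [GP t]) = 0" for a t
    using lim[of "a @ [GP t]"] hw_functional_end(1)[OF hw q(1,3)] by (simp add: LIMSEQ_const_iff)
  moreover have "\<chi> (a @ [GK]) = \<mu> * \<chi> a" for a
    using LIMSEQ_unique[OF lim[of "a @ [GK]"] ] tendsto_mult[OF tendsto_const lim[of a], of \<mu>]
      hw_functional_end(2)[OF hw q(1,3)] by simp
  moreover have "\<chi> (a @ [GJ t]) = v t * \<chi> a" if "t > 0" for a t
    using LIMSEQ_unique[OF lim[of "a @ [GJ t]"]] tendsto_mult[OF u[OF that] lim[of a]]
      hw_functional_end(3)[OF hw q(1,3) that] by simp
  moreover have "\<chi> [] = 1"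
    using lim[of "[]"] \<omega> by (simp add: LIMSEQ_const_iff vacuum_functional_def)
  moreover have "\<chi> (GM t # b) = 0" for t b
    using lim[of "GM t # b"] \<omega> by (simp add: LIMSEQ_const_iff vacuum_functional_def)
  ultimately have "vacuum_functional q Q \<mu> v \<chi>"
    unfolding vacuum_functional_def hw_functional_def by simp
  then show thesis using that lim by simp
qed

section \<open>Partial fraction identities\<close>

text \<open>The expansion of (1 - e g z)/(1 - g z): the factor contributed to the generating series
  of the \<open>J t\<close> by a single root, and with g = 1/Q by \<beta>.\<close>

definition fac :: "complex \<Rightarrow> complex \<Rightarrow> complex fps" where
  "fac e g = Abs_fps (\<lambda>t. if t = 0 then 1 else (1 - e) * g ^ t)"

lemma fac_nth: "fps_nth (fac e g) t = (if t = 0 then 1 else (1 - e) * g ^ t)"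
  by (simp add: fac_def)

lemma fac_mult: "fac e g * (1 - fps_const g * fps_X) = 1 - fps_const (e * g) * fps_X"
proof (rule fps_ext)
  fix n
  show "fps_nth (fac e g * (1 - fps_const g * fps_X)) n = fps_nth (1 - fps_const (e * g) * fps_X) n"
  proof (cases n)
    case (Suc m)
    have "fps_nth (fac e g * (1 - fps_const g * fps_X)) (Suc m) = fps_nth (fac e g) (Suc m) - g * fps_nth (fac e g) m"
      by (simp add: ring_distribs mult.commute[of "fps_const g"] flip: mult.assoc)
    then show ?thesis using Suc by (cases m) (simp_all add: fac_nth algebra_simps)
  qed (simp add: fac_nth)
qed

lemma fps_prod_nth_0: "fps_nth (\<Prod>i\<in>I. f i) 0 = (\<Prod>i\<in>I. fps_nth (f i) 0)"
  by (induction I rule: infinite_finite_induct) auto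

lemma linear_prod_coeff:
  fixes c :: "'i \<Rightarrow> complex"
  assumes "finite I"
  shows "degree (\<Prod>i\<in>I. [:1, c i:]) \<le> card I \<and> coeff (\<Prod>i\<in>I. [:1, c i:]) (card I) = (\<Prod>i\<in>I. c i)"
  using assms
proof (induction I rule: finite_induct)
  case (insert i I)
  let ?p = "\<Prod>i\<in>I. [:1, c i:]"
  have "degree ([:1, c i:] * ?p) \<le> 1 + degree ?p"
    by (rule order_trans[OF degree_mult_le]) simp
  moreover have "coeff ?p (Suc (card I)) = 0"
    by (rule coeff_eq_0) (use insert in simp)
  ultimately show ?case using insert by simp
qed simp

text \<open>After division by the product of the linear factors this is a partial fraction expansion
  with simple poles at the inverses of the \<open>\<gamma> i\<close>. Both sides have degree at most
  \<open>card I\<close>, and they agree at 0 and at these \<open>card I\<close> points. The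
  parameters \<open>\<theta> i\<close> stay arbitrary because in the model they are q or its inverse
  according to membership in a subset.\<close>

lemma residue_identity:
  fixes \<gamma> \<theta> :: "'i \<Rightarrow> complex" and \<beta> Q :: complex
  assumes fin: "finite I" and inj: "inj_on \<gamma> I" and g0: "\<And>i. i \<in> I \<Longrightarrow> \<gamma> i \<noteq> 0"
    and t0: "\<And>i. i \<in> I \<Longrightarrow> \<theta> i \<noteq> 0" and b0: "\<beta> \<noteq> 0"
  defines "\<mu> \<equiv> \<beta> * (\<Prod>i\<in>I. \<theta> i)"
  defines "w \<equiv> \<lambda>i. (\<theta> i - inverse (\<theta> i)) * (inverse \<beta> - \<beta> * Q * \<gamma> i) *
    (\<Prod>j\<in>I-{i}. (\<theta> j * \<gamma> i - \<gamma> j / \<theta> j) / (\<gamma> i - \<gamma> j))"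
  shows "pCons 0 (\<Sum>i\<in>I. smult (w i) (\<Prod>j\<in>I-{i}. [:1, -\<gamma> j:])) =
    smult \<mu> ([:Q, -(inverse \<mu>^2):] * (\<Prod>i\<in>I. [:1, -\<gamma> i:])
           - [:Q, -(inverse \<beta>^2):] * (\<Prod>i\<in>I. [:1, -(\<gamma> i / \<theta> i ^ 2):]))" (is "?L = ?R")
proof -
  let ?k = "card I"
  let ?A = "\<Prod>i\<in>I. [:1, -\<gamma> i:]" and ?B = "\<Prod>i\<in>I. [:1, -(\<gamma> i / \<theta> i ^ 2):]"
  let ?C = "\<lambda>i. \<Prod>j\<in>I-{i}. [:1, -\<gamma> j:]"
  note A = linear_prod_coeff[OF fin, of "\<lambda>i. -\<gamma> i"]
  note B = linear_prod_coeff[OF fin, of "\<lambda>i. -(\<gamma> i / \<theta> i ^ 2)"]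
  have m0: "\<mu> \<noteq> 0" using b0 t0 fin by (simp add: \<mu>_def)
  have prodB: "(\<Prod>i\<in>I. -(\<gamma> i / \<theta> i ^ 2)) = (\<Prod>i\<in>I. -\<gamma> i) / (\<Prod>i\<in>I. \<theta> i)^2"
    unfolding minus_divide_left prod_dividef prod_power_distrib ..
  have C: "coeff (?C i) n = 0" if "i \<in> I" "?k \<le> n" for i n
  proof (rule coeff_eq_0)
    have "degree (?C i) \<le> card (I - {i})" using linear_prod_coeff[of "I-{i}" "\<lambda>i. -\<gamma> i"] fin by simp
    also have "\<dots> < n" using card_Diff1_less[OF fin that(1)] that(2) by simp
    finally show "degree (?C i) < n" .
  qed
  have "degree ?L \<le> ?k"
    by (rule degree_le) (auto simp: coeff_pCons coeff_sum C split: nat.split)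
  then have L: "degree ?L < card (insert 0 ((\<lambda>i. inverse (\<gamma> i)) ` I))"
    using fin inj g0 by (subst card_insert_disjoint) (auto simp: card_image inj_on_def)
  have cR: "coeff ?R n = 0" if kn: "?k < n" for n
  proof -
    obtain m where m: "n = Suc m" using kn by (cases n) auto
    have "coeff ?A n = 0" "coeff ?B n = 0"
      using A B kn by (auto intro!: coeff_eq_0)
    moreover have "coeff ?A m = 0 \<and> coeff ?B m = 0" if "m \<noteq> ?k"
      using A B \<open>?k < n\<close> that m by (auto intro!: coeff_eq_0)
    \<comment> \<open>The definition of \<mu> is exactly what cancels the coefficient of degree
      \<open>card I + 1\<close>.\<close>
    moreover have "inverse \<mu>^2 * coeff ?A m = inverse \<beta>^2 * coeff ?B m" if "m = ?k"
      using A B b0 unfolding that prodB by (simp add: \<mu>_def field_simps)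
    ultimately show ?thesis using m by (cases "m = ?k") (simp_all add: mult.commute)
  qed
  have "degree ?R \<le> ?k" by (intro degree_le allI impI cR)
  then have R: "degree ?R < card (insert 0 ((\<lambda>i. inverse (\<gamma> i)) ` I))"
    using fin inj g0 by (subst card_insert_disjoint) (auto simp: card_image inj_on_def)
  have "poly ?L x = poly ?R x" if x: "x \<in> insert 0 ((\<lambda>i. inverse (\<gamma> i)) ` I)" for x
  proof (cases "x = 0")
    case True
    then show ?thesis by (simp add: poly_prod)
  next
    case False
    then obtain i where i: "i \<in> I" "x = inverse (\<gamma> i)" using x False by auto
    have Cl: "poly (?C l) x = 0" if "l \<in> I - {i}" for l
      unfolding poly_prod using that i g0 fin by (intro prod_zero bexI[of _ i]) auto
    have "poly ?L x = x * (\<Sum>l\<in>I. w l * poly (?C l) x)"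
      by (simp add: poly_sum)
    also have "(\<Sum>l\<in>I. w l * poly (?C l) x) = w i * poly (?C i) x"
      using fin i Cl by (subst sum.remove[of _ i]) auto
    also have "poly (?C i) x = (\<Prod>j\<in>I-{i}. (\<gamma> i - \<gamma> j) / \<gamma> i)"
      using i g0 by (auto simp: poly_prod field_simps intro!: prod.cong)
    also have "w i * \<dots> = (\<theta> i - inverse (\<theta> i)) * (inverse \<beta> - \<beta> * Q * \<gamma> i) *
      (\<Prod>j\<in>I-{i}. (\<theta> j * \<gamma> i - \<gamma> j / \<theta> j) / \<gamma> i)"
      unfolding w_def mult.assoc prod.distrib[symmetric]
      using i inj by (intro arg_cong2[of _ _ _ _ "(*)"] prod.cong refl) (auto simp: inj_on_def)
    finally have 1: "poly ?L x = x * ((\<theta> i - inverse (\<theta> i)) * (inverse \<beta> - \<beta> * Q * \<gamma> i) *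
      (\<Prod>j\<in>I-{i}. (\<theta> j * \<gamma> i - \<gamma> j / \<theta> j) / \<gamma> i))" .
    have "poly ?A x = 0"
      unfolding poly_prod using i g0 fin by (intro prod_zero bexI[of _ i]) auto
    then have "poly ?R x = - \<mu> * (Q - inverse \<beta>^2 * x) * (\<Prod>j\<in>I. 1 - \<gamma> j / \<theta> j ^ 2 * x)"
      by (simp add: poly_prod algebra_simps)
    also have "(\<Prod>j\<in>I. 1 - \<gamma> j / \<theta> j ^ 2 * x) =
       (1 - inverse (\<theta> i)^2) * (\<Prod>j\<in>I-{i}. 1 - \<gamma> j / \<theta> j ^ 2 * x)"
      using fin i g0 by (subst prod.remove[of _ i]) (auto simp: field_simps)
    also have "- \<mu> * (Q - inverse \<beta>^2 * x) * \<dots> = - \<beta> * (Q - inverse \<beta>^2 * x) * \<theta> i * (1 - inverse (\<theta> i)^2) *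
        ((\<Prod>j\<in>I-{i}. \<theta> j) * (\<Prod>j\<in>I-{i}. 1 - \<gamma> j / \<theta> j ^ 2 * x))"
      unfolding \<mu>_def using fin i by (subst prod.remove[of _ i]) (auto simp: algebra_simps)
    also have "(\<Prod>j\<in>I-{i}. \<theta> j) * (\<Prod>j\<in>I-{i}. 1 - \<gamma> j / \<theta> j ^ 2 * x) =
       (\<Prod>j\<in>I-{i}. (\<theta> j * \<gamma> i - \<gamma> j / \<theta> j) / \<gamma> i)"
      unfolding prod.distrib[symmetric] using t0 i g0
      by (intro prod.cong) (auto simp: field_simps power2_eq_square)
    also have "- \<beta> * (Q - inverse \<beta>^2 * x) * \<theta> i * (1 - inverse (\<theta> i)^2) =
       x * ((\<theta> i - inverse (\<theta> i)) * (inverse \<beta> - \<beta> * Q * \<gamma> i))"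
      using i b0 g0 t0 by (simp add: field_simps power2_eq_square)
    finally show ?thesis unfolding 1 by (simp only: mult.assoc)
  qed
  then show ?thesis by (rule poly_eqI_degree[OF _ L R])
qed

text \<open>The linear coefficient of \<open>residue_identity\<close> for constant \<theta>, with
  \<beta> = 1 and Q = 0.\<close>

lemma symmetrisation_identity:
  fixes \<gamma> :: "'i \<Rightarrow> complex"
  assumes fin: "finite I" and inj: "inj_on \<gamma> I" and g0: "\<And>i. i \<in> I \<Longrightarrow> \<gamma> i \<noteq> 0"
    and t0: "\<theta> \<noteq> 0" "\<theta> \<noteq> inverse \<theta>"
  shows "(\<Sum>i\<in>I. \<Prod>j\<in>I-{i}. (\<theta> * \<gamma> i - \<gamma> j / \<theta>) / (\<gamma> i - \<gamma> j)) = qint \<theta> (card I)"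
proof -
  let ?S = "\<Sum>i\<in>I. \<Prod>j\<in>I-{i}. (\<theta> * \<gamma> i - \<gamma> j / \<theta>) / (\<gamma> i - \<gamma> j)"
  let ?m = "\<theta> ^ card I"
  have c: "coeff (\<Prod>j\<in>A. [:1, f j:]) 0 = 1" for A and f :: "'i \<Rightarrow> complex"
    by (simp add: poly_prod flip: poly_0_coeff_0)
  have "coeff ([:0, b:] * p) (Suc 0) = b * coeff p 0" for b :: complex and p
    by simp
  note cc = this
  have m0: "?m \<noteq> 0" using t0 by simp
  have "(\<theta> - inverse \<theta>) * ?S = ?m * (- (inverse ?m ^ 2) + 1)"
    using arg_cong[OF residue_identity[OF fin inj g0, of "\<lambda>_. \<theta>" 1 0], of "\<lambda>p. coeff p 1"] t0
    by (simp add: coeff_sum c sum_distrib_left[symmetric] del: mult_pCons_left mult_pCons_right)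
      (simp only: cc c, simp)
  also have "\<dots> = ?m - inverse ?m" using m0 by (simp add: field_simps power2_eq_square)
  finally show ?thesis using t0 unfolding qint_def power_inverse by (simp add: eq_divide_eq mult.commute)
qed

text \<open>The coefficient of z^(n+1) in \<open>residue_identity\<close> after division by the
  product of the linear factors. Up to the factor q - q^-1, the right-hand side is the eigenvalue
  prescribed for a commutator of \<open>GP t\<close> and \<open>GM s\<close> with s + t = n, and the
  left-hand side will be the diagonal part of that commutator in the model.\<close>

lemma residue_identity_nth:
  fixes \<gamma> \<theta> :: "'i \<Rightarrow> complex" and \<beta> Q :: complex
  assumes fin: "finite I" and inj: "inj_on \<gamma> I" and g0: "\<And>i. i \<in> I \<Longrightarrow> \<gamma> i \<noteq> 0"
    and t0: "\<And>i. i \<in> I \<Longrightarrow> \<theta> i \<noteq> 0" and b0: "\<beta> \<noteq> 0" and Q0: "Q \<noteq> 0"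
    and \<mu>_def: "\<mu> = \<beta> * (\<Prod>i\<in>I. \<theta> i)"
    and w_def: "\<And>i. w i = (\<theta> i - inverse (\<theta> i)) * (inverse \<beta> - \<beta> * Q * \<gamma> i) *
      (\<Prod>j\<in>I-{i}. (\<theta> j * \<gamma> i - \<gamma> j / \<theta> j) / (\<gamma> i - \<gamma> j))"
    and \<Psi>_def: "\<Psi> = fac (inverse \<beta>^2) (inverse Q) * (\<Prod>i\<in>I. fac (inverse (\<theta> i)^2) (\<gamma> i))"
  shows "(\<Sum>i\<in>I. \<gamma> i ^ n * w i) =
    \<mu> * ((if n = 0 then 1 - inverse \<mu>^2 else fps_nth \<Psi> n) - Q * fps_nth \<Psi> (Suc n))"
proof -
  let ?lin = "\<lambda>g. 1 - fps_const g * fps_X :: complex fps"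
  let ?D = "\<Prod>i\<in>I. ?lin (\<gamma> i)"
  let ?G = "\<Sum>i\<in>I. fps_const (w i) * Abs_fps (\<lambda>n. \<gamma> i ^ n)"
  have lin: "fps_of_poly [:1, -g:] = ?lin g" for g :: complex
    by (simp add: fps_of_poly_pCons algebra_simps)
  have lin2: "fps_of_poly [:a, -b:] = fps_const a - fps_const b * fps_X" for a b :: complex
    by (simp add: fps_of_poly_pCons mult.commute flip: fps_const_neg)
  have nth: "fps_nth (fps_const m * (fps_const Q - fps_const b * fps_X - (fps_const Q - fps_X) * P)) (Suc n) =
      m * (- (if n = 0 then b else 0) - (Q * fps_nth P (Suc n) - fps_nth P n))" for m b :: complex and P n
    unfolding left_diff_distrib[of _ _ P] by simp
  have X: "fps_of_poly (pCons 0 p) = fps_X * fps_of_poly p" for p :: "complex poly"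
    by (simp add: fps_of_poly_pCons)
  have R: "pCons 0 (\<Sum>i\<in>I. smult (w i) (\<Prod>j\<in>I-{i}. [:1, -\<gamma> j:])) =
    smult \<mu> ([:Q, -(inverse \<mu>^2):] * (\<Prod>i\<in>I. [:1, -\<gamma> i:])
           - [:Q, -(inverse \<beta>^2):] * (\<Prod>i\<in>I. [:1, -(\<gamma> i / \<theta> i ^ 2):]))"
    unfolding w_def \<mu>_def by (rule residue_identity[OF fin inj g0 t0 b0])
  have geo: "Abs_fps (\<lambda>n. g ^ n) * ?lin g = 1" for g :: complex
  proof (rule fps_ext)
    fix n show "fps_nth (Abs_fps (\<lambda>n. g ^ n) * ?lin g) n = fps_nth (1 :: complex fps) n"
      by (cases n) (simp_all add: ring_distribs mult.commute[of "fps_const g"] flip: mult.assoc)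
  qed
  have Q: "(fps_const Q - fps_X) = fps_const Q * ?lin (inverse Q)"
    using Q0 by (simp add: algebra_simps flip: mult.assoc)
  have "(fps_const Q - fps_X) * fac (inverse \<beta>^2) (inverse Q) =
      fps_const Q * (fac (inverse \<beta>^2) (inverse Q) * ?lin (inverse Q))"
    unfolding Q by (simp add: ac_simps)
  also have "\<dots> = fps_const Q - fps_const (inverse \<beta>^2) * fps_X"
    unfolding fac_mult using Q0 by (simp add: algebra_simps flip: mult.assoc)
  finally have pre: "(fps_const Q - fps_X) * fac (inverse \<beta>^2) (inverse Q) =
      fps_const Q - fps_const (inverse \<beta>^2) * fps_X" .
  have "(fps_const Q - fps_X) * \<Psi> * ?D = (fps_const Q - fps_const (inverse \<beta>^2) * fps_X) *
      ((\<Prod>i\<in>I. fac (inverse (\<theta> i)^2) (\<gamma> i)) * ?D)"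
    unfolding \<Psi>_def pre[symmetric] by (simp add: ac_simps)
  also have "(\<Prod>i\<in>I. fac (inverse (\<theta> i)^2) (\<gamma> i)) * ?D = (\<Prod>i\<in>I. ?lin (\<gamma> i / \<theta> i ^ 2))"
    unfolding prod.distrib[symmetric] fac_mult by (simp add: field_simps)
  finally have PsiD: "(fps_const Q - fps_X) * \<Psi> * ?D =
      (fps_const Q - fps_const (inverse \<beta>^2) * fps_X) * (\<Prod>i\<in>I. ?lin (\<gamma> i / \<theta> i ^ 2))" .
  have "?G * ?D = (\<Sum>i\<in>I. fps_const (w i) * (\<Prod>j\<in>I-{i}. ?lin (\<gamma> j)))"
    unfolding sum_distrib_right
  proof (rule sum.cong[OF refl])
    fix i assume i: "i \<in> I"
    have "fps_const (w i) * Abs_fps (\<lambda>n. \<gamma> i ^ n) * ?D =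
        fps_const (w i) * (Abs_fps (\<lambda>n. \<gamma> i ^ n) * ?lin (\<gamma> i)) * (\<Prod>j\<in>I-{i}. ?lin (\<gamma> j))"
      using fin i by (subst prod.remove[of _ i]) (auto simp: ac_simps)
    then show "fps_const (w i) * Abs_fps (\<lambda>n. \<gamma> i ^ n) * ?D =
        fps_const (w i) * (\<Prod>j\<in>I-{i}. ?lin (\<gamma> j))" unfolding geo by simp
  qed
  then have "fps_X * ?G * ?D = fps_of_poly (pCons 0 (\<Sum>i\<in>I. smult (w i) (\<Prod>j\<in>I-{i}. [:1, -\<gamma> j:])))"
    by (simp only: X fps_of_poly_sum fps_of_poly_smult fps_of_poly_prod lin mult.assoc)
  also have "\<dots> = fps_const \<mu> * ((fps_const Q - fps_const (inverse \<mu>^2) * fps_X) * ?D -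
      (fps_const Q - fps_const (inverse \<beta>^2) * fps_X) * (\<Prod>i\<in>I. ?lin (\<gamma> i / \<theta> i ^ 2)))"
    by (simp only: R fps_of_poly_smult fps_of_poly_diff fps_of_poly_mult fps_of_poly_prod lin2 fps_const_1_eq_1)
  also have "\<dots> = fps_const \<mu> * (fps_const Q - fps_const (inverse \<mu>^2) * fps_X - (fps_const Q - fps_X) * \<Psi>) * ?D"
    unfolding PsiD[symmetric] by (simp add: algebra_simps del: fps_const_mult)
  finally have h: "fps_X * ?G * ?D =
    fps_const \<mu> * (fps_const Q - fps_const (inverse \<mu>^2) * fps_X - (fps_const Q - fps_X) * \<Psi>) * ?D" .
  have lin0: "?lin g \<noteq> 0" for g
  proof -
    have "fps_nth (?lin g) 0 = 1" by simp
    then show ?thesis unfolding fps_nonzero_nth by (intro exI[of _ 0]) simp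
  qed
  have D0: "?D \<noteq> 0"
  proof
    assume "?D = 0"
    then obtain i where "?lin (\<gamma> i) = 0" unfolding prod_zero_iff[OF fin] by (rule bexE)
    with lin0[of "\<gamma> i"] show False by (rule notE)
  qed
  have eq: "fps_X * ?G = fps_const \<mu> *
      (fps_const Q - fps_const (inverse \<mu>^2) * fps_X - (fps_const Q - fps_X) * \<Psi>)"
    by (rule mult_right_cancel[OF D0, THEN iffD1, OF h])
  have "fps_nth \<Psi> 0 = 1" unfolding \<Psi>_def fps_mult_nth_0 fps_prod_nth_0 fac_nth by simp
  then have A: "fps_nth (fps_const \<mu> *
      (fps_const Q - fps_const (inverse \<mu>^2) * fps_X - (fps_const Q - fps_X) * \<Psi>)) (Suc n) =
      \<mu> * ((if n = 0 then 1 - inverse \<mu>^2 else fps_nth \<Psi> n) - Q * fps_nth \<Psi> (Suc n))"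
    unfolding nth by (cases n) (simp_all add: algebra_simps)
  have B: "fps_nth (fps_X * ?G) (Suc n) = (\<Sum>i\<in>I. \<gamma> i ^ n * w i)"
    by (simp add: fps_sum_nth mult.commute)
  show ?thesis unfolding B[symmetric] eq by (rule A)
qed

text \<open>The eigenvalue of \<open>J t\<close> where \<open>GK\<close> acts by \<mu>. Index 0 is
  separate: the relation for the square of \<open>GL\<close> forces it, whereas the constant term of
  \<Psi> is normalised to 1.\<close>

definition lattice_eigenvalue :: "complex \<Rightarrow> complex \<Rightarrow> complex fps \<Rightarrow> nat \<Rightarrow> complex" where
  "lattice_eigenvalue q \<mu> \<Psi> t = (if t = 0 then 1 - inverse \<mu>^2 else fps_nth \<Psi> t) / (q - inverse q)"

lemma sum_offdiag_swap:
  assumes "finite S"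
  shows "(\<Sum>i\<in>S. \<Sum>j\<in>S-{i}. f i j) = (\<Sum>i\<in>S. \<Sum>j\<in>S-{i}. f j i)"
proof -
  have "(\<Sum>i\<in>S. \<Sum>j\<in>S-{i}. f i j) = (\<Sum>i\<in>S. \<Sum>j | j \<in> S \<and> i \<noteq> j. f i j)" for f :: "'a \<Rightarrow> 'a \<Rightarrow> 'b"
    by (intro sum.cong) auto
  moreover have "(\<Sum>i\<in>S. \<Sum>j | j \<in> S \<and> i \<noteq> j. f i j) = (\<Sum>j\<in>S. \<Sum>i | i \<in> S \<and> i \<noteq> j. f i j)"
    using assms by (rule sum.swap_restrict) (rule assms)
  moreover have "(\<Sum>j\<in>S. \<Sum>i | i \<in> S \<and> i \<noteq> j. f i j) = (\<Sum>j\<in>S. \<Sum>i\<in>S-{j}. f i j)"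
    by (intro sum.cong) auto
  ultimately show ?thesis by simp
qed

text \<open>\<open>H\<close> sees only the unordered pair, so two of the four double sums may be
  read with \<open>i\<close> and \<open>j\<close> exchanged; the combination then vanishes pair by
  pair by \<open>W\<close>.\<close>

lemma quadratic_exchange:
  fixes \<gamma> :: "'i \<Rightarrow> complex"
  assumes fin: "finite T"
    and W: "\<And>i j. i \<in> T \<Longrightarrow> j \<in> T \<Longrightarrow> i \<noteq> j \<Longrightarrow> (\<gamma> i - e * \<gamma> j) * W i j + (\<gamma> j - e * \<gamma> i) * W j i = 0"
    and E: "\<And>a b. E a b = (\<Sum>i\<in>T. \<Sum>j\<in>T-{i}. \<gamma> i ^ a * \<gamma> j ^ b * W i j * H {i, j})"
  shows "E (Suc t) s - e * E s (Suc t) - e * E t (Suc s) + E (Suc s) t = 0"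
proof -
  have sw: "E a b = (\<Sum>i\<in>T. \<Sum>j\<in>T-{i}. \<gamma> j ^ a * \<gamma> i ^ b * W j i * H {i, j})" for a b
    unfolding E by (subst sum_offdiag_swap[OF fin]) (simp add: insert_commute)
  have "E (Suc t) s - e * E s (Suc t) - e * E t (Suc s) + E (Suc s) t =
    (\<Sum>i\<in>T. \<Sum>j\<in>T-{i}. \<gamma> i ^ t * \<gamma> j ^ s * H {i, j} *
      ((\<gamma> i - e * \<gamma> j) * W i j + (\<gamma> j - e * \<gamma> i) * W j i))"
    unfolding E[of "Suc t" s] sw[of s "Suc t"] E[of t "Suc s"] sw[of "Suc s" t]
      sum_distrib_left sum_subtractf[symmetric] sum.distrib[symmetric]
    by (intro sum.cong refl) (simp add: algebra_simps)
  also have "\<dots> = 0"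
    by (intro sum.neutral ballI) (use W in auto)
  finally show ?thesis .
qed

section \<open>The subset model\<close>

locale subset_model =
  fixes q Q \<beta> :: complex and \<gamma> :: "nat \<Rightarrow> complex" and k :: nat
  assumes q0: "q \<noteq> 0" and qq: "q - inverse q \<noteq> 0" and Q0: "Q \<noteq> 0" and b0: "\<beta> \<noteq> 0"
    and inj: "inj_on \<gamma> {..<k}" and g0: "\<And>i. i < k \<Longrightarrow> \<gamma> i \<noteq> 0"
begin

text \<open>The exchange factor of two roots. Its pole at equal roots is the reason why the model
  asks for distinct roots.\<close>

definition fr :: "nat \<Rightarrow> nat \<Rightarrow> complex" where
  "fr i j = (q * \<gamma> i - \<gamma> j / q) / (\<gamma> i - \<gamma> j)"

text \<open>Vanishes exactly when \<open>\<gamma> i\<close> equals \<beta>^-2 Q^-1, the value that a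
  polynomial in \<open>polysQ\<close> with leading coefficient \<beta> may not have as a
  root.\<close>

definition rr :: "nat \<Rightarrow> complex" where
  "rr i = inverse \<beta> - \<beta> * Q * \<gamma> i"

text \<open>An element of \<open>S\<close> has been lowered: its factor of the eigenvalue of
  \<open>GK\<close> changes from q to q^-1, so the empty set is the highest weight position.\<close>

definition th :: "nat set \<Rightarrow> nat \<Rightarrow> complex" where
  "th S i = (if i \<in> S then inverse q else q)"

definition kv :: "nat set \<Rightarrow> complex" where
  "kv S = \<beta> * (\<Prod>i<k. th S i)"

definition psi :: "nat set \<Rightarrow> complex fps" where
  "psi S = fac (inverse \<beta>^2) (inverse Q) * (\<Prod>i<k. fac (inverse (th S i)^2) (\<gamma> i))"

definition jv :: "nat set \<Rightarrow> nat \<Rightarrow> complex" where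
  "jv S t = lattice_eigenvalue q (kv S) (psi S) t"

text \<open>The action on functions of subsets is the transpose of the action on subsets: \<open>X\<^sup>+\<close> removes an
  element from the subset and \<open>X\<^sup>-\<close> adds one.\<close>

fun act :: "gen \<Rightarrow> (nat set \<Rightarrow> complex) \<Rightarrow> nat set \<Rightarrow> complex" where
  "act (GP t) F S = (\<Sum>i\<in>{..<k}-S. \<gamma> i ^ t * (rr i * (\<Prod>j\<in>{..<k}-S-{i}. fr i j)) * F (insert i S))"
| "act (GM t) F S = (\<Sum>i\<in>S. \<gamma> i ^ t * (\<Prod>j\<in>S-{i}. fr j i) * F (S-{i}))"
| "act (GJ t) F S = jv S t * F S"
| "act GK F S = kv S * F S"
| "act GL F S = inverse (kv S) * F S"

definition run :: "gen list \<Rightarrow> (nat set \<Rightarrow> complex) \<Rightarrow> nat set \<Rightarrow> complex" where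
  "run w F = foldr act w F"

lemma run_simps [simp]: "run [] F = F" "run (g # w) F = act g (run w F)" "run (a @ b) F = run a (run b F)"
  by (simp_all add: run_def)

definition vac :: "nat set \<Rightarrow> complex" where
  "vac S = (if S = {} then 1 else 0)"

definition expect :: "gen list \<Rightarrow> complex" where
  "expect w = run w vac {}"

lemma act_cong:
  assumes "\<And>S. S \<subseteq> {..<k} \<Longrightarrow> F S = G S" "S \<subseteq> {..<k}"
  shows "act g F S = act g G S"
proof (cases g)
  case (GP t)
  show ?thesis unfolding GP act.simps
    using assms by (intro sum.cong refl arg_cong2[of _ _ _ _ "(*)"]) auto
next
  case (GM t)
  have "F (S - {i}) = G (S - {i})" for i using assms by blast
  then show ?thesis unfolding GM act.simps by simp
qed (use assms in auto)

lemma run_cong: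
  assumes "\<And>S. S \<subseteq> {..<k} \<Longrightarrow> F S = G S" "S \<subseteq> {..<k}"
  shows "run w F S = run w G S"
  using assms(2)
proof (induction w arbitrary: S)
  case (Cons g w)
  then show ?case unfolding run_simps by (intro act_cong) auto
qed (use assms in auto)

lemma act_linear: "act g (\<lambda>S. c * F S + G S) S = c * act g F S + act g G S"
proof (cases g)
  case (GP t)
  show ?thesis unfolding GP act.simps sum_distrib_left sum.distrib[symmetric]
    by (intro sum.cong refl) (simp add: algebra_simps)
next
  case (GM t)
  show ?thesis unfolding GM act.simps sum_distrib_left sum.distrib[symmetric]
    by (intro sum.cong refl) (simp add: algebra_simps)
qed (simp_all add: algebra_simps)

lemma run_linear: "run w (\<lambda>S. c * F S + G S) = (\<lambda>S. c * run w F S + run w G S)"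
proof (induction w)
  case (Cons g w)
  show ?case by (rule ext) (simp only: run_simps Cons act_linear)
qed simp

lemma run_zero: "run w (\<lambda>S. 0) = (\<lambda>S. 0)"
  using run_linear[of w "-1" "\<lambda>S. 0" "\<lambda>S. 0"] by simp

lemma run_sum: "run w (\<lambda>S. \<Sum>i\<in>A. c i * F i S) = (\<lambda>S. \<Sum>i\<in>A. c i * run w (F i) S)"
  by (induction A rule: infinite_finite_induct) (simp_all add: run_zero run_linear)

lemma word_sum_run:
  "word_sum (\<lambda>w. run a (run w F) S) r = run a (\<lambda>S. word_sum (\<lambda>w. run w F S) r) S"
  by (induction r) (auto simp: run_zero run_linear)

lemma th0: "th S i \<noteq> 0" using q0 by (simp add: th_def)

lemma kv0: "kv S \<noteq> 0" using b0 th0 by (simp add: kv_def)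

lemma kv_insert:
  assumes "i < k" "i \<notin> S"
  shows "q^2 * kv (insert i S) = kv S"
proof -
  have "(\<Prod>j\<in>{..<k}-{i}. th (insert i S) j) = (\<Prod>j\<in>{..<k}-{i}. th S j)"
    by (intro prod.cong) (auto simp: th_def)
  moreover have "th (insert i S) i = inverse q" "th S i = q" using assms by (auto simp: th_def)
  ultimately show ?thesis unfolding kv_def using assms q0
    by (subst (1 2) prod.remove[of _ i]) (auto simp: power2_eq_square)
qed

text \<open>Inserting \<open>i\<close> replaces a factor with numerator 1 - q^-2
  \<open>\<gamma> i\<close> z by one with numerator 1 - q^2 \<open>\<gamma> i\<close> z over the
  same denominator; the identity is cross-multiplied.\<close>

lemma psi_insert:
  assumes "i < k" "i \<notin> S"
  shows "psi (insert i S) * (1 - fps_const (inverse q^2 * \<gamma> i) * fps_X) = psi S * (1 - fps_const (q^2 * \<gamma> i) * fps_X)"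
proof -
  let ?P = "fac (inverse \<beta>^2) (inverse Q) * (\<Prod>j\<in>{..<k}-{i}. fac (inverse (th S j)^2) (\<gamma> j))"
  have eq: "(\<Prod>j\<in>{..<k}-{i}. fac (inverse (th (insert i S) j)^2) (\<gamma> j)) =
      (\<Prod>j\<in>{..<k}-{i}. fac (inverse (th S j)^2) (\<gamma> j))"
    by (intro prod.cong) (auto simp: th_def)
  have th: "th (insert i S) i = inverse q" "th S i = q" using assms by (auto simp: th_def)
  have 1: "psi (insert i S) = ?P * fac (q^2) (\<gamma> i)"
    unfolding psi_def using assms eq th by (subst prod.remove[of _ i]) (auto simp: ac_simps)
  have 2: "psi S = ?P * fac (inverse q^2) (\<gamma> i)"
    unfolding psi_def using assms th by (subst prod.remove[of _ i]) (auto simp: ac_simps)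
  let ?lin = "\<lambda>g. 1 - fps_const g * fps_X :: complex fps"
  have "fac (q^2) (\<gamma> i) * ?lin (inverse q^2 * \<gamma> i) = fac (q^2) (\<gamma> i) * (fac (inverse q^2) (\<gamma> i) * ?lin (\<gamma> i))"
    by (simp only: fac_mult)
  also have "\<dots> = fac (inverse q^2) (\<gamma> i) * (fac (q^2) (\<gamma> i) * ?lin (\<gamma> i))"
    by (simp only: ac_simps)
  also have "\<dots> = fac (inverse q^2) (\<gamma> i) * ?lin (q^2 * \<gamma> i)"
    by (simp only: fac_mult)
  finally show ?thesis unfolding 1 2 by (simp only: mult.assoc)
qed

lemma psi_0: "fps_nth (psi S) 0 = 1"
  unfolding psi_def fps_mult_nth_0 fps_prod_nth_0 fac_nth by simp

lemma jv_0: "(q - inverse q) * jv S 0 = 1 - inverse (kv S)^2"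
  using qq by (simp add: jv_def lattice_eigenvalue_def)

text \<open>Coefficient t + 1 of \<open>psi_insert\<close>, in the shape demanded by the relations
  between \<open>J\<close> and \<open>X\<close>.\<close>

lemma jv_insert:
  assumes "i < k" "i \<notin> S"
  shows "jv (insert i S) (Suc t) - jv S (Suc t) = \<gamma> i * (inverse q^2 * jv (insert i S) t - q^2 * jv S t)"
proof -
  have nth: "fps_nth (f * (1 - fps_const g * fps_X)) (Suc t) = fps_nth f (Suc t) - g * fps_nth f t"
    for f :: "complex fps" and g t
    by (simp add: right_diff_distrib mult.left_commute[of f])
  have e: "fps_nth (psi (insert i S)) (Suc t) - fps_nth (psi S) (Suc t) =
      \<gamma> i * (inverse q^2 * fps_nth (psi (insert i S)) t - q^2 * fps_nth (psi S) t)"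
    using arg_cong[OF psi_insert[OF assms], of "\<lambda>f. fps_nth f (Suc t)"] unfolding nth
    by (simp add: algebra_simps)
  have kv: "inverse (kv (insert i S))^2 = q^4 * inverse (kv S)^2"
    unfolding kv_insert[OF assms, symmetric] using kv0[of "insert i S"] q0
    by (simp add: power_mult_distrib power_inverse field_simps flip: power_mult)
  \<comment> \<open>At index 0 the parts depending on \<open>kv\<close> cancel, so the exceptional
    value of \<open>jv\<close> enters the recurrence just as the constant term 1 of
    \<open>psi\<close> does.\<close>
  have z: "inverse q^2 * (1 - inverse (kv (insert i S))^2) - q^2 * (1 - inverse (kv S)^2) = inverse q^2 - q^2"
    unfolding kv using q0 by (simp add: field_simps)
  have "(q - inverse q) * (jv (insert i S) (Suc t) - jv S (Suc t)) =
     (q - inverse q) * (\<gamma> i * (inverse q^2 * jv (insert i S) t - q^2 * jv S t))"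
  proof (cases "t = 0")
    case True
    have m1: "(q - inverse q) * (\<gamma> i * (inverse q^2 * jv (insert i S) t - q^2 * jv S t)) =
      \<gamma> i * (inverse q^2 * (1 - inverse (kv (insert i S))^2) - q^2 * (1 - inverse (kv S)^2))"
      unfolding True jv_0[symmetric] by (simp add: algebra_simps)
    have m2: "(q - inverse q) * (jv (insert i S) (Suc t) - jv S (Suc t)) =
      fps_nth (psi (insert i S)) (Suc t) - fps_nth (psi S) (Suc t)"
      using qq by (simp add: jv_def lattice_eigenvalue_def flip: diff_divide_distrib)
    show ?thesis unfolding m1 m2 z using e True psi_0 by simp
  next
    case False
    have j: "(q - inverse q) * jv S t = fps_nth (psi S) t" if "t \<noteq> 0" for S t
      using that qq by (simp add: jv_def lattice_eigenvalue_def)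
    have "(q - inverse q) * (jv (insert i S) (Suc t) - jv S (Suc t)) =
      (q - inverse q) * jv (insert i S) (Suc t) - (q - inverse q) * jv S (Suc t)"
      by (rule right_diff_distrib)
    also have "\<dots> = \<gamma> i * (inverse q^2 * ((q - inverse q) * jv (insert i S) t) - q^2 * ((q - inverse q) * jv S t))"
      using e False by (simp add: j)
    finally show ?thesis by (simp add: algebra_simps)
  qed
  then show ?thesis using qq by simp
qed

text \<open>In each sum the numerators of the two terms factor into the same linear forms, while
  their denominators \<open>\<gamma> i - \<gamma> j\<close> and
  \<open>\<gamma> j - \<gamma> i\<close> are opposite.\<close>

lemma fr_exchange:
  assumes "i < k" "j < k" "i \<noteq> j"
  shows "(\<gamma> i - inverse q^2 * \<gamma> j) * fr j i + (\<gamma> j - inverse q^2 * \<gamma> i) * fr i j = 0"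
    and "(\<gamma> i - q^2 * \<gamma> j) * fr i j + (\<gamma> j - q^2 * \<gamma> i) * fr j i = 0"
proof -
  have d: "\<gamma> i - \<gamma> j \<noteq> 0" using inj assms by (auto simp: inj_on_def)
  have f: "fr j i = - ((q * \<gamma> j - \<gamma> i / q) / (\<gamma> i - \<gamma> j))"
    unfolding fr_def by (simp add: minus_divide_right)
  show "(\<gamma> i - inverse q^2 * \<gamma> j) * fr j i + (\<gamma> j - inverse q^2 * \<gamma> i) * fr i j = 0"
    unfolding f unfolding fr_def using d q0
    by (simp add: divide_simps) (simp add: algebra_simps power2_eq_square)
  show "(\<gamma> i - q^2 * \<gamma> j) * fr i j + (\<gamma> j - q^2 * \<gamma> i) * fr j i = 0"
    unfolding f unfolding fr_def using d q0
    by (simp add: divide_simps) (simp add: algebra_simps power2_eq_square)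
qed

text \<open>Apart from the powers of \<gamma>, a single factor \<open>fr j i\<close> is not
  symmetric in the two removed elements. Isolating it gives the form that
  \<open>quadratic_exchange\<close> consumes.\<close>

lemma act_GM_GM:
  assumes "S \<subseteq> {..<k}"
  shows "act (GM a) (act (GM b) F) S = (\<Sum>i\<in>S. \<Sum>j\<in>S-{i}. \<gamma> i ^ a * \<gamma> j ^ b *
    (fr j i * ((\<Prod>l\<in>S-{i,j}. fr l i) * (\<Prod>l\<in>S-{i,j}. fr l j))) * F (S-{i,j}))"
proof -
  have fin: "finite S" using assms by (rule finite_subset) simp
  have "\<gamma> i ^ a * (\<Prod>l\<in>S-{i}. fr l i) * act (GM b) F (S-{i}) = (\<Sum>j\<in>S-{i}. \<gamma> i ^ a * \<gamma> j ^ b *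
    (fr j i * ((\<Prod>l\<in>S-{i,j}. fr l i) * (\<Prod>l\<in>S-{i,j}. fr l j))) * F (S-{i,j}))" if i: "i \<in> S" for i
    unfolding act.simps sum_distrib_left
  proof (rule sum.cong[OF refl])
    fix j assume j: "j \<in> S - {i}"
    have s: "S - {i} - {j} = S - {i,j}" by auto
    have "(\<Prod>l\<in>S-{i}. fr l i) = fr j i * (\<Prod>l\<in>S-{i,j}. fr l i)"
      using fin j by (subst prod.remove[of _ j]) (auto simp: s)
    then show "\<gamma> i ^ a * (\<Prod>l\<in>S-{i}. fr l i) * (\<gamma> j ^ b * (\<Prod>l\<in>S-{i}-{j}. fr l j) * F (S-{i}-{j})) =
      \<gamma> i ^ a * \<gamma> j ^ b * (fr j i * ((\<Prod>l\<in>S-{i,j}. fr l i) * (\<Prod>l\<in>S-{i,j}. fr l j))) * F (S-{i,j})"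
      unfolding s by (simp only: ac_simps)
  qed
  then show ?thesis unfolding act.simps(2)[of a] by (intro sum.cong refl)
qed

lemma act_GP_GP:
  assumes "S \<subseteq> {..<k}"
  shows "act (GP a) (act (GP b) F) S = (\<Sum>i\<in>{..<k}-S. \<Sum>j\<in>{..<k}-S-{i}. \<gamma> i ^ a * \<gamma> j ^ b *
    (fr i j * (rr i * rr j * (\<Prod>l\<in>{..<k}-S-{i,j}. fr i l) * (\<Prod>l\<in>{..<k}-S-{i,j}. fr j l))) * F (S \<union> {i,j}))"
proof -
  have "\<gamma> i ^ a * (rr i * (\<Prod>l\<in>{..<k}-S-{i}. fr i l)) * act (GP b) F (insert i S) =
    (\<Sum>j\<in>{..<k}-S-{i}. \<gamma> i ^ a * \<gamma> j ^ b *
    (fr i j * (rr i * rr j * (\<Prod>l\<in>{..<k}-S-{i,j}. fr i l) * (\<Prod>l\<in>{..<k}-S-{i,j}. fr j l))) * F (S \<union> {i,j}))"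
    if i: "i \<in> {..<k}-S" for i
  proof -
    have t: "{..<k} - insert i S = {..<k} - S - {i}" by auto
    show ?thesis unfolding act.simps sum_distrib_left t
    proof (rule sum.cong[OF refl])
      fix j assume j: "j \<in> {..<k}-S-{i}"
      have s: "{..<k}-S-{i}-{j} = {..<k}-S-{i,j}" by auto
      have u: "insert j (insert i S) = S \<union> {i,j}" by auto
      have "(\<Prod>l\<in>{..<k}-S-{i}. fr i l) = fr i j * (\<Prod>l\<in>{..<k}-S-{i,j}. fr i l)"
        using j by (subst prod.remove[of _ j]) (auto simp: s)
      then show "\<gamma> i ^ a * (rr i * (\<Prod>l\<in>{..<k}-S-{i}. fr i l)) *
          (\<gamma> j ^ b * (rr j * (\<Prod>l\<in>{..<k}-S-{i}-{j}. fr j l)) * F (insert j (insert i S))) =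
        \<gamma> i ^ a * \<gamma> j ^ b *
        (fr i j * (rr i * rr j * (\<Prod>l\<in>{..<k}-S-{i,j}. fr i l) * (\<Prod>l\<in>{..<k}-S-{i,j}. fr j l))) * F (S \<union> {i,j})"
        unfolding s u by (simp only: ac_simps)
    qed
  qed
  then show ?thesis unfolding act.simps(1)[of a] by (intro sum.cong refl)
qed

text \<open>The coefficient with which a function returns to \<open>S\<close> when the element
  \<open>i\<close> is moved across the boundary of \<open>S\<close> and back.\<close>

definition cross :: "nat set \<Rightarrow> nat \<Rightarrow> complex" where
  "cross S i = rr i * (\<Prod>j\<in>{..<k}-S-{i}. fr i j) * (\<Prod>j\<in>S-{i}. fr j i)"

text \<open>The terms that put one element in and take another out, \<open>?O i j\<close>, agree in
  both orders of application; only the diagonal ones, where the same element moves both ways,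
  remain.\<close>

lemma act_GP_GM:
  assumes S: "S \<subseteq> {..<k}"
  shows "act (GP t) (act (GM s) F) S - act (GM s) (act (GP t) F) S =
    ((\<Sum>i\<in>{..<k}-S. \<gamma> i ^ (s + t) * cross S i) - (\<Sum>i\<in>S. \<gamma> i ^ (s + t) * cross S i)) * F S"
proof -
  have fin: "finite S" using S by (rule finite_subset) simp
  let ?O = "\<lambda>i j. \<gamma> i ^ t * \<gamma> j ^ s * (rr i * fr i j * (\<Prod>l\<in>{..<k}-S-{i}. fr i l) * (\<Prod>l\<in>S-{j}. fr l j)) *
     F (insert i (S-{j}))"
  have "\<gamma> i ^ t * (rr i * (\<Prod>j\<in>{..<k}-S-{i}. fr i j)) * act (GM s) F (insert i S) =
     \<gamma> i ^ (s + t) * cross S i * F S + (\<Sum>j\<in>S. ?O i j)" if i: "i \<in> {..<k}-S" for i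
  proof -
    have ins: "insert i S - {i} = S" "S - {i} = S" using i by auto
    have o: "\<gamma> i ^ t * (rr i * (\<Prod>l\<in>{..<k}-S-{i}. fr i l)) *
        (\<gamma> j ^ s * (\<Prod>l\<in>insert i S - {j}. fr l j) * F (insert i S - {j})) = ?O i j" if j: "j \<in> S" for j
    proof -
      have "insert i S - {j} = insert i (S - {j})" using i j by auto
      moreover have "(\<Prod>l\<in>insert i (S - {j}). fr l j) = fr i j * (\<Prod>l\<in>S-{j}. fr l j)"
        using fin i by (subst prod.insert) auto
      ultimately show ?thesis by (simp only: ac_simps)
    qed
    have "act (GM s) F (insert i S) = \<gamma> i ^ s * (\<Prod>l\<in>S. fr l i) * F S +
        (\<Sum>j\<in>S. \<gamma> j ^ s * (\<Prod>l\<in>insert i S - {j}. fr l j) * F (insert i S - {j}))"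
      unfolding act.simps using fin i by (subst sum.insert) (auto simp: ins)
    then show ?thesis
      unfolding cross_def ins by (simp only: distrib_left sum_distrib_left o cong: sum.cong)
        (simp add: power_add ac_simps)
  qed
  then have 1: "act (GP t) (act (GM s) F) S = (\<Sum>i\<in>{..<k}-S. \<gamma> i ^ (s + t) * cross S i) * F S +
     (\<Sum>i\<in>{..<k}-S. \<Sum>j\<in>S. ?O i j)"
    unfolding act.simps(1)[of t] sum_distrib_right sum.distrib[symmetric] by (intro sum.cong refl)
  have "\<gamma> j ^ s * (\<Prod>l\<in>S-{j}. fr l j) * act (GP t) F (S-{j}) =
     \<gamma> j ^ (s + t) * cross S j * F S + (\<Sum>i\<in>{..<k}-S. ?O i j)" if j: "j \<in> S" for j
  proof -
    have ins: "{..<k} - (S - {j}) = insert j ({..<k} - S)" "{..<k} - S - {j} = {..<k} - S"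
      "insert j ({..<k} - S) - {j} = {..<k} - S" "insert j (S - {j}) = S"
      using j S by auto
    have o: "\<gamma> j ^ s * (\<Prod>l\<in>S-{j}. fr l j) * (\<gamma> i ^ t * (rr i * (\<Prod>l\<in>insert j ({..<k} - S) - {i}. fr i l)) *
       F (insert i (S-{j}))) = ?O i j" if i: "i \<in> {..<k}-S" for i
    proof -
      have "insert j ({..<k} - S) - {i} = insert j ({..<k} - S - {i})" using i j by auto
      moreover have "(\<Prod>l\<in>insert j ({..<k} - S - {i}). fr i l) = fr i j * (\<Prod>l\<in>{..<k} - S - {i}. fr i l)"
        using j by (subst prod.insert) auto
      ultimately show ?thesis by (simp only: ac_simps)
    qed
    let ?G = "\<lambda>i. \<gamma> i ^ t * (rr i * (\<Prod>l\<in>insert j ({..<k} - S) - {i}. fr i l)) * F (insert i (S-{j}))"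
    have "act (GP t) F (S-{j}) = (\<Sum>i\<in>insert j ({..<k} - S). ?G i)"
      unfolding act.simps ins(1) ..
    also have "\<dots> = ?G j + (\<Sum>i\<in>{..<k}-S. ?G i)"
      by (rule sum.insert) (use j in auto)
    also have "?G j = \<gamma> j ^ t * (rr j * (\<Prod>l\<in>{..<k}-S. fr j l)) * F S"
      by (simp only: ins(3,4))
    finally have "act (GP t) F (S-{j}) = \<gamma> j ^ t * (rr j * (\<Prod>l\<in>{..<k}-S. fr j l)) * F S +
        (\<Sum>i\<in>{..<k}-S. ?G i)" .
    then show ?thesis
      unfolding cross_def ins by (simp only: distrib_left sum_distrib_left o cong: sum.cong)
        (simp add: power_add ac_simps)
  qed
  then have "act (GM s) (act (GP t) F) S = (\<Sum>i\<in>S. \<gamma> i ^ (s + t) * cross S i) * F S +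
     (\<Sum>j\<in>S. \<Sum>i\<in>{..<k}-S. ?O i j)"
    unfolding act.simps(2)[of s] sum_distrib_right sum.distrib[symmetric] by (intro sum.cong refl)
  then have 2: "act (GM s) (act (GP t) F) S = (\<Sum>i\<in>S. \<gamma> i ^ (s + t) * cross S i) * F S +
     (\<Sum>i\<in>{..<k}-S. \<Sum>j\<in>S. ?O i j)"
    by (subst (asm) sum.swap)
  show ?thesis unfolding 1 2 by (simp add: algebra_simps)
qed

text \<open>This is \<open>residue_identity_nth\<close> for \<theta> = \<open>th S\<close>: the
  difference of \<open>th S i\<close> and its inverse is q - q^-1 off \<open>S\<close> and the
  negative of this on \<open>S\<close>, which yields the difference of the two sums.\<close>

lemma cross_sum:
  assumes S: "S \<subseteq> {..<k}"
  shows "(\<Sum>i\<in>{..<k}-S. \<gamma> i ^ n * cross S i) - (\<Sum>i\<in>S. \<gamma> i ^ n * cross S i) =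
    kv S * (jv S n - Q * jv S (Suc n))"
proof -
  let ?c = "q - inverse q"
  define w where "w i = (th S i - inverse (th S i)) * (inverse \<beta> - \<beta> * Q * \<gamma> i) *
      (\<Prod>j\<in>{..<k}-{i}. (th S j * \<gamma> i - \<gamma> j / th S j) / (\<gamma> i - \<gamma> j))" for i
  have c: "w i = (th S i - inverse (th S i)) * cross S i" if i: "i < k" for i
  proof -
    have f: "(th S j * \<gamma> i - \<gamma> j / th S j) / (\<gamma> i - \<gamma> j) = (if j \<in> S then fr j i else fr i j)" for j
    proof -
      have "(\<gamma> i / q - q * \<gamma> j) / (\<gamma> i - \<gamma> j) = (q * \<gamma> j - \<gamma> i / q) / (\<gamma> j - \<gamma> i)"
        using minus_divide_divide[of "q * \<gamma> j - \<gamma> i / q" "\<gamma> j - \<gamma> i"] by simp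
      moreover have "inverse q * \<gamma> i - \<gamma> j / inverse q = \<gamma> i / q - q * \<gamma> j"
        by (simp add: divide_inverse mult.commute)
      ultimately show ?thesis unfolding th_def fr_def by simp
    qed
    have un: "{..<k} - {i} = ({..<k} - S - {i}) \<union> (S - {i})" using S by auto
    have "(\<Prod>j\<in>{..<k}-{i}. if j \<in> S then fr j i else fr i j) =
        (\<Prod>j\<in>{..<k}-S-{i}. if j \<in> S then fr j i else fr i j) * (\<Prod>j\<in>S-{i}. if j \<in> S then fr j i else fr i j)"
      unfolding un by (rule prod.union_disjoint) (use finite_subset[OF S] in auto)
    also have "\<dots> = (\<Prod>j\<in>{..<k}-S-{i}. fr i j) * (\<Prod>j\<in>S-{i}. fr j i)"
      by (intro arg_cong2[of _ _ _ _ "(*)"] prod.cong) auto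
    finally show ?thesis unfolding w_def f cross_def rr_def by (simp only: mult.assoc)
  qed
  have "(\<Sum>i<k. \<gamma> i ^ n * w i) = (\<Sum>i\<in>{..<k}-S. \<gamma> i ^ n * w i) + (\<Sum>i\<in>S. \<gamma> i ^ n * w i)"
    using S by (rule sum.subset_diff) simp
  also have "(\<Sum>i\<in>{..<k}-S. \<gamma> i ^ n * w i) = ?c * (\<Sum>i\<in>{..<k}-S. \<gamma> i ^ n * cross S i)"
    unfolding sum_distrib_left by (intro sum.cong) (auto simp: c th_def)
  also have "(\<Sum>i\<in>S. \<gamma> i ^ n * w i) = ?c * - (\<Sum>i\<in>S. \<gamma> i ^ n * cross S i)"
    unfolding sum_distrib_left sum_negf[symmetric] using S
    by (intro sum.cong) (auto simp: c th_def algebra_simps subset_iff)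
  finally have "?c * ((\<Sum>i\<in>{..<k}-S. \<gamma> i ^ n * cross S i) - (\<Sum>i\<in>S. \<gamma> i ^ n * cross S i)) =
     (\<Sum>i<k. \<gamma> i ^ n * w i)"
    by (simp add: algebra_simps)
  also have "\<dots> = kv S * ((if n = 0 then 1 - inverse (kv S)^2 else fps_nth (psi S) n) - Q * fps_nth (psi S) (Suc n))"
    by (rule residue_identity_nth[where \<theta> = "th S" and \<beta> = \<beta>])
      (use inj g0 th0 b0 Q0 in \<open>auto simp: w_def kv_def psi_def\<close>)
  also have "\<dots> = ?c * (kv S * (jv S n - Q * jv S (Suc n)))"
    using qq unfolding jv_def lattice_eigenvalue_def by (simp add: divide_simps)
  finally show ?thesis using qq by simp
qed

end

section \<open>Quantum factorials and linear dependence\<close>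

definition qfac :: "complex \<Rightarrow> nat \<Rightarrow> complex" where
  "qfac q m = (\<Prod>l<m. qint q (Suc l))"

definition hw_series :: "complex \<Rightarrow> complex \<Rightarrow> complex \<Rightarrow> (nat \<Rightarrow> complex) \<Rightarrow> nat \<Rightarrow> complex fps" where
  "hw_series q Q \<beta> \<gamma> k = fac (inverse \<beta>^2) (inverse Q) * (\<Prod>i<k. fac (inverse q^2) (\<gamma> i))"

lemma qint_inverse: "qint (inverse q) m = qint q m"
proof -
  have "(inverse q ^ m - q ^ m) / (inverse q - q) = (-(q ^ m - inverse q ^ m)) / (-(q - inverse q))" by simp
  also have "\<dots> = (q ^ m - inverse q ^ m) / (q - inverse q)" by (rule minus_divide_divide)
  finally show ?thesis by (simp add: qint_def)
qed

text \<open>Gaussian elimination: if some \<open>f p a\<close> is nonzero, subtracting multiples of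
  \<open>f p\<close> clears coordinate \<open>a\<close> from the others, and the induction continues
  without \<open>p\<close> and \<open>a\<close>.\<close>

lemma linear_dependence:
  fixes f :: "'i \<Rightarrow> 'a \<Rightarrow> complex"
  assumes "finite A" "finite I" "card A < card I"
  shows "\<exists>c. (\<exists>i\<in>I. c i \<noteq> 0) \<and> (\<forall>a\<in>A. (\<Sum>i\<in>I. c i * f i a) = 0)"
  using assms
proof (induction A arbitrary: I f rule: finite_induct)
  case empty
  then obtain i where "i \<in> I" by fastforce
  then show ?case by (intro exI[of _ "\<lambda>_. 1"]) auto
next
  case (insert a A)
  show ?case
  proof (cases "\<forall>i\<in>I. f i a = 0")
    case True
    have "card A < card I" using insert by simp
    from insert.IH[OF insert.prems(1) this, of f] obtain c
      where "\<exists>i\<in>I. c i \<noteq> 0" "\<forall>a\<in>A. (\<Sum>i\<in>I. c i * f i a) = 0" by blast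
    then show ?thesis using True by (intro exI[of _ c]) simp
  next
    case False
    then obtain p where p: "p \<in> I" "f p a \<noteq> 0" by blast
    let ?I = "I - {p}"
    have I: "finite ?I" "card A < card ?I" using insert p by auto
    from insert.IH[OF I, of "\<lambda>i x. f i x - f i a / f p a * f p x"] obtain c
      where c: "\<exists>i\<in>?I. c i \<noteq> 0"
        "\<And>x. x \<in> A \<Longrightarrow> (\<Sum>i\<in>?I. c i * (f i x - f i a / f p a * f p x)) = 0" by blast
    \<comment> \<open>The coefficient of the pivot is solved for from coordinate
      \<open>a\<close>.\<close>
    define d where "d i = (if i = p then - (\<Sum>i\<in>?I. c i * f i a) / f p a else c i)" for i
    have "(\<Sum>i\<in>I. d i * f i x) = d p * f p x + (\<Sum>i\<in>?I. c i * f i x)" for x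
      using insert.prems(1) p(1) by (subst sum.remove[of _ p]) (auto simp: d_def intro!: sum.cong)
    then have d: "(\<Sum>i\<in>I. d i * f i x) = (\<Sum>i\<in>?I. c i * (f i x - f i a / f p a * f p x))" for x
      by (simp add: d_def right_diff_distrib sum_subtractf sum_distrib_right sum_divide_distrib mult.assoc)
    have "\<forall>x\<in>insert a A. (\<Sum>i\<in>I. d i * f i x) = 0"
      unfolding d using c(2) p(2) by simp
    moreover obtain j where "j \<in> ?I" "c j \<noteq> 0" using c(1) by blast
    then have "j \<in> I \<and> d j \<noteq> 0" by (simp add: d_def)
    ultimately show ?thesis by blast
  qed
qed

section \<open>Relations and expectations in the subset model\<close>

context subset_model
begin

lemma jv0_insert:
  assumes "i < k" "i \<notin> S"
  shows "q^2 * jv S 0 - inverse q^2 * jv (insert i S) 0 = qint q 2"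
proof -
  have kv: "inverse (kv (insert i S))^2 = q^4 * inverse (kv S)^2"
    unfolding kv_insert[OF assms, symmetric] using kv0[of "insert i S"] q0
    by (simp add: power_mult_distrib power_inverse field_simps flip: power_mult)
  have "(q - inverse q) * (q^2 * jv S 0 - inverse q^2 * jv (insert i S) 0) =
      q^2 * ((q - inverse q) * jv S 0) - inverse q^2 * ((q - inverse q) * jv (insert i S) 0)"
    by (simp add: algebra_simps)
  also have "\<dots> = q^2 - inverse q^2"
    unfolding jv_0 kv using q0 by (simp add: field_simps)
  finally show ?thesis using qq unfolding qint_def by (simp add: eq_divide_eq mult.commute)
qed

text \<open>The relations of \<open>K\<close> and \<open>J\<close> with \<open>X\<close> hold
  summand by summand, by the behaviour of \<open>kv\<close> and \<open>jv\<close> under insertion of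
  one element. The quadratic relations come from \<open>quadratic_exchange\<close>, the commutator
  from \<open>cross_sum\<close>.\<close>

lemma run_defrel:
  assumes "defrel q Q r" and S: "S \<subseteq> {..<k}"
  shows "word_sum (\<lambda>w. run w F S) r = 0"
  using assms(1)
proof cases
  case LL
  have "inverse (kv S) * (inverse (kv S) * F S) - F S + (q - inverse q) * jv S 0 * F S = 0"
    unfolding jv_0 by (simp add: algebra_simps power2_eq_square)
  then show ?thesis by (simp add: LL algebra_simps)
next
  case (PP t s)
  let ?T = "{..<k} - S"
  let ?W = "\<lambda>i j. fr i j * (rr i * rr j * (\<Prod>l\<in>?T-{i,j}. fr i l) * (\<Prod>l\<in>?T-{i,j}. fr j l))"
  have W: "(\<gamma> i - q^2 * \<gamma> j) * ?W i j + (\<gamma> j - q^2 * \<gamma> i) * ?W j i = 0"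
    if "i \<in> ?T" "j \<in> ?T" "i \<noteq> j" for i j
  proof -
    have "(\<gamma> i - q^2 * \<gamma> j) * ?W i j + (\<gamma> j - q^2 * \<gamma> i) * ?W j i =
      ((\<gamma> i - q^2 * \<gamma> j) * fr i j + (\<gamma> j - q^2 * \<gamma> i) * fr j i) *
      (rr i * rr j * (\<Prod>l\<in>?T-{i,j}. fr i l) * (\<Prod>l\<in>?T-{i,j}. fr j l))"
      by (simp add: insert_commute[of j i] algebra_simps)
    then show ?thesis using fr_exchange(2)[of i j] that by simp
  qed
  have "finite ?T" by simp
  from quadratic_exchange[OF this W, where E = "\<lambda>a b. act (GP a) (act (GP b) F) S"
      and H = "\<lambda>X. F (S \<union> X)" and t = t and s = s] act_GP_GP[OF S, of _ _ F]
  show ?thesis by (simp add: PP algebra_simps)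
next
  case (MM t s)
  let ?W = "\<lambda>i j. fr j i * ((\<Prod>l\<in>S-{i,j}. fr l i) * (\<Prod>l\<in>S-{i,j}. fr l j))"
  have W: "(\<gamma> i - inverse q^2 * \<gamma> j) * ?W i j + (\<gamma> j - inverse q^2 * \<gamma> i) * ?W j i = 0"
    if "i \<in> S" "j \<in> S" "i \<noteq> j" for i j
  proof -
    have "(\<gamma> i - inverse q^2 * \<gamma> j) * ?W i j + (\<gamma> j - inverse q^2 * \<gamma> i) * ?W j i =
      ((\<gamma> i - inverse q^2 * \<gamma> j) * fr j i + (\<gamma> j - inverse q^2 * \<gamma> i) * fr i j) *
      ((\<Prod>l\<in>S-{i,j}. fr l i) * (\<Prod>l\<in>S-{i,j}. fr l j))"
      by (simp add: insert_commute[of j i] algebra_simps)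
    then show ?thesis using fr_exchange(1)[of i j] that S by (simp add: subset_iff)
  qed
  have "finite S" using S by (rule finite_subset) simp
  from quadratic_exchange[OF this W, where E = "\<lambda>a b. act (GM a) (act (GM b) F) S"
      and H = "\<lambda>X. F (S - X)" and t = t and s = s] act_GM_GM[OF S, of _ _ F]
  show ?thesis by (simp add: MM algebra_simps)
next
  case (KP t)
  have "kv S * act (GP t) (act GL F) S = q^2 * act (GP t) F S"
    unfolding act.simps sum_distrib_left
  proof (rule sum.cong[OF refl])
    fix i assume "i \<in> {..<k} - S"
    then have "q^2 * kv (insert i S) = kv S" using kv_insert by simp
    then have h: "kv S * inverse (kv (insert i S)) = q^2" using kv0[of "insert i S"] by (auto simp: field_simps)
    show "kv S * (\<gamma> i ^ t * (rr i * (\<Prod>j\<in>{..<k}-S-{i}. fr i j)) * (inverse (kv (insert i S)) * F (insert i S))) =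
      q^2 * (\<gamma> i ^ t * (rr i * (\<Prod>j\<in>{..<k}-S-{i}. fr i j)) * F (insert i S))"
      unfolding h[symmetric] by (simp only: ac_simps)
  qed
  then show ?thesis by (simp add: KP del: act.simps(1)) 
next
  case (KM t)
  have "kv S * act (GM t) (act GL F) S = inverse q^2 * act (GM t) F S"
    unfolding act.simps sum_distrib_left
  proof (rule sum.cong[OF refl])
    fix i assume i: "i \<in> S"
    then have "q^2 * kv S = kv (S - {i})" using kv_insert[of i "S - {i}"] S by (auto simp: insert_absorb)
    then have h: "kv S * inverse (kv (S - {i})) = inverse q^2" using kv0[of S] q0 by (auto simp: field_simps)
    show "kv S * (\<gamma> i ^ t * (\<Prod>j\<in>S-{i}. fr j i) * (inverse (kv (S - {i})) * F (S - {i}))) =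
      inverse q^2 * (\<gamma> i ^ t * (\<Prod>j\<in>S-{i}. fr j i) * F (S - {i}))"
      unfolding h[symmetric] by (simp only: ac_simps)
  qed
  then show ?thesis by (simp add: KM del: act.simps(2))
next
  case (J0P t)
  have "q^2 * (jv S 0 * act (GP t) F S) + (-(inverse q^2) * act (GP t) (act (GJ 0) F) S + (- qint q 2) * act (GP t) F S) = 0"
    unfolding act.simps sum_distrib_left sum.distrib[symmetric]
  proof (intro sum.neutral ballI)
    fix i assume i: "i \<in> {..<k} - S"
    have "q^2 * jv S 0 - inverse q^2 * jv (insert i S) 0 - qint q 2 = 0" using jv0_insert i by simp
    then have "q^2 * jv S 0 - inverse q^2 * jv (insert i S) 0 = qint q 2" by simp
    then show "q\<^sup>2 * (jv S 0 * (\<gamma> i ^ t * (rr i * prod (fr i) ({..<k} - S - {i})) * F (insert i S))) +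
         (- (inverse q)\<^sup>2 * (\<gamma> i ^ t * (rr i * prod (fr i) ({..<k} - S - {i})) * (jv (insert i S) 0 * F (insert i S))) +
          - qint q 2 * (\<gamma> i ^ t * (rr i * prod (fr i) ({..<k} - S - {i})) * F (insert i S))) = 0"
      by (simp flip: \<open>_ = qint q 2\<close> add: algebra_simps)
  qed
  then show ?thesis by (simp add: J0P del: act.simps(1))
next
  case (J0M t)
  have "inverse q^2 * (jv S 0 * act (GM t) F S) + (-(q^2) * act (GM t) (act (GJ 0) F) S + (qint q 2) * act (GM t) F S) = 0"
    unfolding act.simps sum_distrib_left sum.distrib[symmetric]
  proof (intro sum.neutral ballI, goal_cases)
    case (1 i)
    then have i: "i \<in> S" .
    have "q^2 * jv (S - {i}) 0 - inverse q^2 * jv S 0 = qint q 2"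
      using jv0_insert[of i "S - {i}"] i S by (auto simp: insert_absorb)
    then show ?case
      by (simp flip: \<open>_ = qint q 2\<close> add: algebra_simps)
  qed
  then show ?thesis by (simp add: J0M del: act.simps(2))
next
  case (JP s t)
  have "jv S (Suc s) * act (GP t) F S + (- 1 * act (GP t) (act (GJ (Suc s)) F) S +
     (-(q^2) * (jv S s * act (GP (Suc t)) F S) + inverse q^2 * act (GP (Suc t)) (act (GJ s) F) S)) = 0"
    unfolding act.simps sum_distrib_left sum.distrib[symmetric]
  proof (intro sum.neutral ballI)
    fix i assume i: "i \<in> {..<k} - S"
    let ?A = "rr i * prod (fr i) ({..<k} - S - {i})"
    have e: "jv S (Suc s) = jv (insert i S) (Suc s) - \<gamma> i * (inverse q^2 * jv (insert i S) s - q^2 * jv S s)"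
      using jv_insert[of i S s] i by (simp add: algebra_simps)
    show "jv S (Suc s) * (\<gamma> i ^ t * ?A * F (insert i S)) + (- 1 * (\<gamma> i ^ t * ?A * (jv (insert i S) (Suc s) * F (insert i S))) +
      (-(q^2) * (jv S s * (\<gamma> i ^ Suc t * ?A * F (insert i S))) +
       inverse q^2 * (\<gamma> i ^ Suc t * ?A * (jv (insert i S) s * F (insert i S))))) = 0"
      unfolding e by (simp add: algebra_simps)
  qed
  then show ?thesis by (simp add: JP del: act.simps(1))
next
  case (JM s t)
  have "jv S (Suc s) * act (GM t) F S + (- 1 * act (GM t) (act (GJ (Suc s)) F) S +
     (-(inverse q^2) * (jv S s * act (GM (Suc t)) F S) + q^2 * act (GM (Suc t)) (act (GJ s) F) S)) = 0"
    unfolding act.simps sum_distrib_left sum.distrib[symmetric]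
  proof (intro sum.neutral ballI)
    fix i assume i: "i \<in> S"
    let ?A = "\<Prod>j\<in>S - {i}. fr j i"
    have e: "jv S (Suc s) = jv (S - {i}) (Suc s) + \<gamma> i * (inverse q^2 * jv S s - q^2 * jv (S - {i}) s)"
      using jv_insert[of i "S - {i}" s] i S by (auto simp: algebra_simps insert_absorb)
    show "jv S (Suc s) * (\<gamma> i ^ t * ?A * F (S - {i})) + (- 1 * (\<gamma> i ^ t * ?A * (jv (S - {i}) (Suc s) * F (S - {i}))) +
      (-(inverse q^2) * (jv S s * (\<gamma> i ^ Suc t * ?A * F (S - {i}))) +
       q^2 * (\<gamma> i ^ Suc t * ?A * (jv (S - {i}) s * F (S - {i}))))) = 0"
      unfolding e by (simp add: algebra_simps)
  qed
  then show ?thesis by (simp add: JM del: act.simps(2))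
next
  case (PM t s)
  have "act (GP t) (act (GM s) F) S - act (GM s) (act (GP t) F) S =
    kv S * (jv S (s + t) - Q * jv S (Suc (s + t))) * F S"
    unfolding act_GP_GM[OF S] cross_sum[OF S] ..
  then show ?thesis by (simp add: PM algebra_simps del: act.simps(1,2))
qed (use kv0 in \<open>simp_all\<close>)

lemma expect_defrel:
  assumes "defrel q Q r"
  shows "word_sum (\<lambda>w. expect (a @ w @ b)) r = 0"
proof -
  have "word_sum (\<lambda>w. expect (a @ w @ b)) r = run a (\<lambda>S. word_sum (\<lambda>w. run w (run b vac) S) r) {}"
    unfolding expect_def by (simp add: word_sum_run)
  also have "\<dots> = run a (\<lambda>S. 0) {}"
    by (rule run_cong) (use run_defrel[OF assms] in auto)
  finally show ?thesis by (simp add: run_zero)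
qed

lemma psi_empty: "psi {} = hw_series q Q \<beta> \<gamma> k"
  unfolding psi_def hw_series_def th_def by simp

lemma kv_empty: "kv {} = \<beta> * q ^ k"
  by (simp add: kv_def th_def)

text \<open>\<open>vac\<close> is the indicator of the empty set. \<open>GP\<close> kills it since
  it evaluates at nonempty sets, and \<open>GM\<close> gives an empty sum when the result is read
  off at the empty set.\<close>

lemma expect_vacuum:
  "vacuum_functional q Q (\<beta> * q ^ k) (\<lambda>t. fps_nth (hw_series q Q \<beta> \<gamma> k) t / (q - inverse q)) expect"
proof -
  have P: "act (GP t) vac = (\<lambda>S. 0)" for t
    by (rule ext) (auto simp: vac_def intro!: sum.neutral)
  have K: "act GK vac = (\<lambda>S. kv {} * vac S + 0)"
    by (rule ext) (simp add: vac_def)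
  have J: "act (GJ t) vac = (\<lambda>S. jv {} t * vac S + 0)" for t
    by (rule ext) (simp add: vac_def)
  have "expect (a @ [GP t]) = 0" for a t
    unfolding expect_def run_simps P run_zero ..
  moreover have "expect (a @ [GK]) = \<beta> * q ^ k * expect a" for a
    unfolding expect_def run_simps K run_linear run_zero kv_empty by simp
  moreover have "expect (a @ [GJ t]) = fps_nth (hw_series q Q \<beta> \<gamma> k) t / (q - inverse q) * expect a"
    if "t > 0" for a t
    unfolding expect_def run_simps J run_linear run_zero
    using that by (simp add: jv_def lattice_eigenvalue_def psi_empty)
  moreover have "expect [] = 1" by (simp add: expect_def vac_def)
  moreover have "expect (GM t # b) = 0" for t b by (simp add: expect_def)
  ultimately show ?thesis
    unfolding vacuum_functional_def hw_functional_def by (simp add: expect_defrel)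
qed

text \<open>There are 2^k subsets, so more than 2^k of the functions \<open>run (w i) vac\<close>
  are dependent on them; values outside the power set do not influence the expectation, by
  \<open>run_cong\<close>.\<close>

lemma expect_dependence:
  assumes "finite I" "2 ^ k < card I"
  shows "\<exists>c. (\<exists>i\<in>I. c i \<noteq> 0) \<and> (\<forall>b. (\<Sum>i\<in>I. c i * expect (b @ w i)) = 0)"
proof -
  have "finite (Pow {..<k})" "card (Pow {..<k}) < card I" using assms by (simp_all add: card_Pow)
  from linear_dependence[OF this(1) assms(1) this(2), of "\<lambda>i. run (w i) vac"] obtain c
    where c: "\<exists>i\<in>I. c i \<noteq> 0" "\<And>S. S \<subseteq> {..<k} \<Longrightarrow> (\<Sum>i\<in>I. c i * run (w i) vac S) = 0" by auto
  have "(\<Sum>i\<in>I. c i * expect (b @ w i)) = 0" for b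
  proof -
    have "(\<Sum>i\<in>I. c i * expect (b @ w i)) = run b (\<lambda>S. \<Sum>i\<in>I. c i * run (w i) vac S) {}"
      unfolding expect_def run_simps run_sum ..
    also have "\<dots> = run b (\<lambda>S. 0) {}" by (rule run_cong) (use c(2) in auto)
    finally show ?thesis by (simp add: run_zero)
  qed
  then show ?thesis using c(1) by blast
qed

lemma fr_sum:
  assumes "A \<subseteq> {..<k}"
  shows "(\<Sum>i\<in>A. \<Prod>j\<in>A-{i}. fr i j) = qint q (card A)" "(\<Sum>i\<in>A. \<Prod>j\<in>A-{i}. fr j i) = qint q (card A)"
proof -
  have A: "finite A" "inj_on \<gamma> A" "\<And>i. i \<in> A \<Longrightarrow> \<gamma> i \<noteq> 0"
    using assms inj g0 by (auto intro: finite_subset inj_on_subset)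
  have q: "q \<noteq> inverse q" "inverse q \<noteq> inverse (inverse q)" "inverse q \<noteq> 0" using qq q0 by auto
  show "(\<Sum>i\<in>A. \<Prod>j\<in>A-{i}. fr i j) = qint q (card A)"
    unfolding fr_def by (rule symmetrisation_identity[OF A q0 q(1)])
  have "fr j i = (inverse q * \<gamma> i - \<gamma> j / inverse q) / (\<gamma> i - \<gamma> j)" for i j
    using minus_divide_divide[of "q * \<gamma> j - \<gamma> i / q" "\<gamma> j - \<gamma> i"]
    unfolding fr_def by (simp add: divide_inverse mult.commute)
  then show "(\<Sum>i\<in>A. \<Prod>j\<in>A-{i}. fr j i) = qint q (card A)"
    using symmetrisation_identity[OF A q(3) q(2)] by (simp add: qint_inverse)
qed

text \<open>Each lowering sums products of \<open>fr\<close> over the choice of the removed element,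
  and this symmetrisation is the quantum integer of \<open>card S\<close>; iteration gives the
  quantum factorial.\<close>

lemma run_GM_power:
  "S \<subseteq> {..<k} \<Longrightarrow> run (replicate r (GM 0)) vac S = (if card S = r then qfac q r else 0)"
proof (induction r arbitrary: S)
  case 0
  then have "finite S" by (auto intro: finite_subset)
  then show ?case by (simp add: vac_def qfac_def)
next
  case (Suc r)
  have fin: "finite S" using Suc.prems by (auto intro: finite_subset)
  have "run (replicate r (GM 0)) vac (S - {i}) = (if card S = Suc r then qfac q r else 0)" if "i \<in> S" for i
  proof -
    have "S - {i} \<subseteq> {..<k}" using Suc.prems by blast
    from Suc.IH[OF this] show ?thesis using card_Suc_Diff1[OF fin that] by auto
  qed
  then have "run (replicate (Suc r) (GM 0)) vac S =
     (\<Sum>i\<in>S. (\<Prod>j\<in>S-{i}. fr j i)) * (if card S = Suc r then qfac q r else 0)"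
    by (simp add: sum_distrib_right)
  then show ?case unfolding fr_sum(2)[OF Suc.prems] by (auto simp: qfac_def)
qed

text \<open>The operators move the point of evaluation from \<open>S\<close> up to the full set.
  Each missing element contributes its factor \<open>rr i\<close> once, and the sum over the orders
  of insertion is a quantum factorial.\<close>

lemma run_GP_power:
  "S \<subseteq> {..<k} \<Longrightarrow> card S + r = k \<Longrightarrow>
    run (replicate r (GP 0)) G S = qfac q r * (\<Prod>i\<in>{..<k}-S. rr i) * G {..<k}"
proof (induction r arbitrary: S)
  case 0
  then have "S = {..<k}" by (intro card_subset_eq) auto
  then show ?case by (simp add: qfac_def)
next
  case (Suc r)
  let ?T = "{..<k} - S"
  have fin: "finite S" using Suc.prems by (auto intro: finite_subset)
  have T: "card ?T = Suc r" using Suc.prems fin by (simp add: card_Diff_subset)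
  have "rr i * (\<Prod>j\<in>?T-{i}. fr i j) * run (replicate r (GP 0)) G (insert i S) =
    (\<Prod>j\<in>?T-{i}. fr i j) * (qfac q r * (\<Prod>i\<in>?T. rr i) * G {..<k})" if i: "i \<in> ?T" for i
  proof -
    have e: "{..<k} - insert i S = ?T - {i}" by auto
    have "(\<Prod>i\<in>?T. rr i) = rr i * (\<Prod>i\<in>?T-{i}. rr i)" using i by (intro prod.remove) auto
    moreover have "run (replicate r (GP 0)) G (insert i S) = qfac q r * (\<Prod>i\<in>?T-{i}. rr i) * G {..<k}"
      using Suc.IH[of "insert i S"] Suc.prems i fin unfolding e by auto
    ultimately show ?thesis by simp
  qed
  note step = this
  have "run (replicate (Suc r) (GP 0)) G S =
     (\<Sum>i\<in>?T. rr i * (\<Prod>j\<in>?T-{i}. fr i j) * run (replicate r (GP 0)) G (insert i S))"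
    by simp
  also have "\<dots> = (\<Sum>i\<in>?T. (\<Prod>j\<in>?T-{i}. fr i j) * (qfac q r * (\<Prod>i\<in>?T. rr i) * G {..<k}))"
    by (rule sum.cong[OF refl]) (rule step)
  also have "\<dots> = (\<Sum>i\<in>?T. (\<Prod>j\<in>?T-{i}. fr i j)) * (qfac q r * (\<Prod>i\<in>?T. rr i) * G {..<k})"
    by (rule sum_distrib_right[symmetric])
  finally show ?case unfolding fr_sum(1)[OF Diff_subset] T by (simp add: qfac_def)
qed

lemma expect_power:
  "expect (replicate k (GP 0) @ replicate k (GM 0)) = (qfac q k)^2 * (\<Prod>i<k. inverse \<beta> - \<beta> * Q * \<gamma> i)"
  unfolding expect_def run_simps
  using run_GP_power[of "{}" k] run_GM_power[of "{..<k}" k]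
  by (simp add: rr_def power2_eq_square)

end

section \<open>Repeated and zero roots by limits\<close>

lemma convergent_subsequence_family:
  fixes c :: "nat \<Rightarrow> 'i \<Rightarrow> complex"
  assumes "finite I" "\<And>n i. i \<in> I \<Longrightarrow> cmod (c n i) \<le> 1"
  shows "\<exists>(r :: nat \<Rightarrow> nat) l. strict_mono r \<and> (\<forall>i\<in>I. (\<lambda>n. c (r n) i) \<longlonglongrightarrow> l i)"
  using assms
proof (induction I rule: finite_induct)
  case empty
  show ?case by (intro exI[of _ id]) (simp add: strict_mono_def)
next
  case (insert j I)
  then obtain r :: "nat \<Rightarrow> nat" and l where r: "strict_mono r" "\<forall>i\<in>I. (\<lambda>n. c (r n) i) \<longlonglongrightarrow> l i" by auto
  have "\<forall>n. cmod (c (r n) j) \<le> 1" using insert.prems by simp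
  from Bolzano_Weierstrass_complex_disc[OF this] obtain f :: "nat \<Rightarrow> nat" and z
    where f: "strict_mono f" "\<forall>e>0. \<exists>N. \<forall>n\<ge>N. cmod (c (r (f n)) j - z) < e" by blast
  have z: "(\<lambda>n. c (r (f n)) j) \<longlonglongrightarrow> z"
    unfolding LIMSEQ_def dist_norm using f(2) by simp
  have "(\<lambda>n. c (r (f n)) i) \<longlonglongrightarrow> l i" if "i \<in> I" for i
    using LIMSEQ_subseq_LIMSEQ[OF bspec[OF r(2) that] f(1)] by (simp add: o_def)
  then have "\<forall>i\<in>insert j I. (\<lambda>n. c ((r \<circ> f) n) i) \<longlonglongrightarrow> (l(j := z)) i"
    using z insert.hyps(2) by auto
  then show ?case using strict_mono_o[OF r(1) f(1)] by blast
qed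

lemma perturb_distinct_nonzero:
  fixes \<gamma> :: "nat \<Rightarrow> complex"
  obtains g where "\<And>n. inj_on (g n) {..<k}" "\<And>n i. i < k \<Longrightarrow> g n i \<noteq> 0" "\<And>i. (\<lambda>n. g n i) \<longlonglongrightarrow> \<gamma> i"
proof -
  \<comment> \<open>The multiples i + 1 are distinct and nonzero, so the shift separates equal
    values and moves zero values away from 0; other coincidences disappear for large
    \<open>n\<close>.\<close>
  define h where "h n i = \<gamma> i + of_nat (Suc i) * inverse (of_nat (Suc n))" for n i
  have lim: "(\<lambda>n. h n i) \<longlonglongrightarrow> \<gamma> i" for i
  proof -
    have "(\<lambda>n. \<gamma> i + of_nat (Suc i) * inverse (of_nat (Suc n))) \<longlonglongrightarrow> \<gamma> i + of_nat (Suc i) * 0"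
      by (intro tendsto_intros lim_inverse_n[THEN LIMSEQ_Suc])
    then show ?thesis by (simp add: h_def)
  qed
  have 1: "\<forall>\<^sub>F n in sequentially. h n i \<noteq> 0" for i
  proof (cases "\<gamma> i = 0")
    case True
    then have "h n i \<noteq> 0" for n unfolding h_def by (simp del: of_nat_Suc)
    then show ?thesis by simp
  next
    case False
    from tendsto_imp_eventually_ne[OF lim this] show ?thesis .
  qed
  have 2: "\<forall>\<^sub>F n in sequentially. i \<noteq> j \<longrightarrow> h n i \<noteq> h n j" for i j
  proof (cases "\<gamma> i = \<gamma> j")
    case True
    then have "i \<noteq> j \<Longrightarrow> h n i \<noteq> h n j" for n unfolding h_def by (simp del: of_nat_Suc)
    then show ?thesis by simp
  next
    case False
    then have "\<gamma> i - \<gamma> j \<noteq> 0" by simp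
    from tendsto_imp_eventually_ne[OF tendsto_diff[OF lim lim] this] show ?thesis
      by (rule eventually_mono) auto
  qed
  have "\<forall>\<^sub>F n in sequentially. \<forall>i\<in>{..<k}. h n i \<noteq> 0 \<and> (\<forall>j\<in>{..<k}. i \<noteq> j \<longrightarrow> h n i \<noteq> h n j)"
    by (intro eventually_ball_finite eventually_conj ballI 1 2) auto
  then obtain N where N: "\<And>n. n \<ge> N \<Longrightarrow> \<forall>i\<in>{..<k}. h n i \<noteq> 0 \<and> (\<forall>j\<in>{..<k}. i \<noteq> j \<longrightarrow> h n i \<noteq> h n j)"
    unfolding eventually_sequentially by blast
  show thesis
  proof (rule that[of "\<lambda>n. h (n + N)"])
    show "inj_on (h (n + N)) {..<k}" for n using N[of "n + N"] by (auto simp: inj_on_def)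
    show "h (n + N) i \<noteq> 0" if "i < k" for n i using N[of "n + N"] that by simp
    show "(\<lambda>n. h (n + N) i) \<longlonglongrightarrow> \<gamma> i" for i using LIMSEQ_ignore_initial_segment[OF lim] .
  qed
qed

lemma tendsto_hw_series:
  assumes "\<And>i. (\<lambda>n. g n i) \<longlonglongrightarrow> \<gamma> i"
  shows "(\<lambda>n. fps_nth (hw_series q Q \<beta> (g n) k) t) \<longlonglongrightarrow> fps_nth (hw_series q Q \<beta> \<gamma> k) t"
proof -
  have mult: "(\<lambda>n. fps_nth (F n * G n) t) \<longlonglongrightarrow> fps_nth (f * h) t"
    if "\<And>t. (\<lambda>n. fps_nth (F n) t) \<longlonglongrightarrow> fps_nth f t" "\<And>t. (\<lambda>n. fps_nth (G n) t) \<longlonglongrightarrow> fps_nth h t"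
    for F G :: "nat \<Rightarrow> complex fps" and f h t
    unfolding fps_mult_nth by (intro tendsto_sum tendsto_mult that)
  have f: "(\<lambda>n. fps_nth (fac e (g n i)) t) \<longlonglongrightarrow> fps_nth (fac e (\<gamma> i)) t" for e i t
    unfolding fac_nth by (auto intro!: tendsto_intros assms)
  have "(\<lambda>n. fps_nth (\<Prod>i<k. fac (inverse q^2) (g n i)) t) \<longlonglongrightarrow> fps_nth (\<Prod>i<k. fac (inverse q^2) (\<gamma> i)) t" for t
  proof (induction k arbitrary: t)
    case (Suc k)
    show ?case unfolding prod.lessThan_Suc by (rule mult[OF Suc f])
  qed simp
  then show ?thesis unfolding hw_series_def by (intro mult) auto
qed

text \<open>A rank bound is a statement about dependence, and it survives the limit once the
  coefficients of the dependence are scaled to absolute sum 1: a subsequence of them converges, and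
  the limit is again nonzero.\<close>

lemma vacuum_functional_hw_series:
  assumes "q \<noteq> 0" "q - inverse q \<noteq> 0" "Q \<noteq> 0" "\<beta> \<noteq> 0"
  obtains \<omega> where
    "vacuum_functional q Q (\<beta> * q ^ k) (\<lambda>t. fps_nth (hw_series q Q \<beta> \<gamma> k) t / (q - inverse q)) \<omega>"
    "\<omega> (replicate k (GP 0) @ replicate k (GM 0)) = (qfac q k)^2 * (\<Prod>i<k. inverse \<beta> - \<beta> * Q * \<gamma> i)"
    "\<And>I w. finite I \<Longrightarrow> 2 ^ k < card I \<Longrightarrow>
       \<exists>c. (\<exists>i\<in>I. c i \<noteq> 0) \<and> (\<forall>b. (\<Sum>i\<in>I. c i * \<omega> (b @ w (i :: gen list))) = 0)"
proof -
  obtain g where g: "\<And>n. inj_on (g n) {..<k}" "\<And>n i. i < k \<Longrightarrow> g n i \<noteq> 0" "\<And>i. (\<lambda>n. g n i) \<longlonglongrightarrow> \<gamma> i"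
    by (rule perturb_distinct_nonzero[of k \<gamma>]) (rule that)
  have m: "subset_model q Q \<beta> (g n) k" for n
    using assms g(1,2) by unfold_locales auto
  define e where "e n = subset_model.expect q Q \<beta> (g n) k" for n
  have m0: "\<beta> * q ^ k \<noteq> 0" using assms by simp
  have vac: "vacuum_functional q Q (\<beta> * q ^ k) (\<lambda>t. fps_nth (hw_series q Q \<beta> (g n) k) t / (q - inverse q)) (e n)" for n
    unfolding e_def by (rule subset_model.expect_vacuum[OF m])
  have u: "(\<lambda>n. fps_nth (hw_series q Q \<beta> (g n) k) t / (q - inverse q)) \<longlonglongrightarrow>
      fps_nth (hw_series q Q \<beta> \<gamma> k) t / (q - inverse q)" for t
    by (intro tendsto_divide tendsto_hw_series g(3) tendsto_const assms(2))
  obtain \<omega> where \<omega>: "vacuum_functional q Q (\<beta> * q ^ k) (\<lambda>t. fps_nth (hw_series q Q \<beta> \<gamma> k) t / (q - inverse q)) \<omega>"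
    and lim: "\<And>w. (\<lambda>n. e n w) \<longlonglongrightarrow> \<omega> w"
    by (rule vacuum_functional_limit[OF assms(1,2) m0 vac u]) (rule that)
  have "(\<lambda>n. e n (replicate k (GP 0) @ replicate k (GM 0))) \<longlonglongrightarrow> (qfac q k)^2 * (\<Prod>i<k. inverse \<beta> - \<beta> * Q * \<gamma> i)"
    unfolding e_def subset_model.expect_power[OF m] by (intro tendsto_intros g(3))
  from LIMSEQ_unique[OF lim this]
  have pow: "\<omega> (replicate k (GP 0) @ replicate k (GM 0)) = (qfac q k)^2 * (\<Prod>i<k. inverse \<beta> - \<beta> * Q * \<gamma> i)" .
  have "\<exists>c. (\<exists>i\<in>I. c i \<noteq> 0) \<and> (\<forall>b. (\<Sum>i\<in>I. c i * \<omega> (b @ w i)) = 0)"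
    if I: "finite I" "2 ^ k < card I" for I and w :: "gen list \<Rightarrow> gen list"
  proof -
    have "\<exists>c. (\<exists>i\<in>I. c i \<noteq> 0) \<and> (\<forall>b. (\<Sum>i\<in>I. c i * e n (b @ w i)) = 0)" for n
      unfolding e_def by (rule subset_model.expect_dependence[OF m I])
    then obtain c where c: "\<And>n. \<exists>i\<in>I. c n i \<noteq> 0" "\<And>n b. (\<Sum>i\<in>I. c n i * e n (b @ w i)) = 0"
      by metis
    define s where "s n = (\<Sum>i\<in>I. cmod (c n i))" for n
    have s: "s n > 0" for n
    proof -
      obtain i where "i \<in> I" "c n i \<noteq> 0" using c(1) by blast
      then show ?thesis unfolding s_def by (intro sum_pos2[OF I(1)]) auto
    qed
    define d where "d n i = c n i / of_real (s n)" for n i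
    have d1: "(\<Sum>i\<in>I. cmod (d n i)) = 1" for n
      using s[of n] by (simp add: d_def norm_divide flip: sum_divide_distrib s_def)
    have dle: "cmod (d n i) \<le> 1" if "i \<in> I" for n i
      using member_le_sum[of i I "\<lambda>i. cmod (d n i)"] that I(1) d1[of n] by simp
    from convergent_subsequence_family[of I d, OF I(1) dle] obtain r :: "nat \<Rightarrow> nat" and l
      where r: "strict_mono r" "\<And>i. i \<in> I \<Longrightarrow> (\<lambda>n. d (r n) i) \<longlonglongrightarrow> l i" by blast
    have "(\<lambda>n. \<Sum>i\<in>I. cmod (d (r n) i)) \<longlonglongrightarrow> (\<Sum>i\<in>I. cmod (l i))"
      by (intro tendsto_sum tendsto_norm r(2))
    then have "(\<Sum>i\<in>I. cmod (l i)) = 1" unfolding d1 by (simp add: LIMSEQ_const_iff)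
    then have "\<exists>i\<in>I. l i \<noteq> 0"
      by (rule_tac ccontr) simp
    moreover have "(\<Sum>i\<in>I. l i * \<omega> (b @ w i)) = 0" for b
    proof -
      have "(\<lambda>n. \<Sum>i\<in>I. d (r n) i * e (r n) (b @ w i)) \<longlonglongrightarrow> (\<Sum>i\<in>I. l i * \<omega> (b @ w i))"
        using LIMSEQ_subseq_LIMSEQ[OF lim r(1)]
        by (intro tendsto_sum tendsto_mult r(2)) (simp_all add: o_def)
      moreover have "(\<Sum>i\<in>I. d n i * e n (b @ w i)) = (\<Sum>i\<in>I. c n i * e n (b @ w i)) / of_real (s n)" for n
        unfolding d_def by (simp add: sum_divide_distrib)
      ultimately show ?thesis unfolding c(2) by (simp add: LIMSEQ_const_iff)
    qed
    ultimately show ?thesis by blast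
  qed
  then show thesis using that[OF \<omega> pow] by blast
qed

section \<open>Modules from functionals of finite rank\<close>

text \<open>\<open>kproj q \<mu> R\<close> is right multiplication by \<open>\<Prod>r=1..R. K\<^sup>+ - \<mu> q\<^sup>-\<^sup>2\<^sup>r\<close>, which for large \<open>R\<close>
  projects, up to a scalar, to the highest weight space.\<close>

fun kproj :: "complex \<Rightarrow> complex \<Rightarrow> nat \<Rightarrow> (gen list \<Rightarrow> complex) \<Rightarrow> gen list \<Rightarrow> complex" where
  "kproj q \<mu> 0 f a = f a"
| "kproj q \<mu> (Suc R) f a = kproj q \<mu> R f (a @ [GK]) - \<mu> * (inverse q^2) ^ Suc R * kproj q \<mu> R f a"

text \<open>The scalar by which the product acts on weight \<mu> q^(-2s): zero for s = 1, ..., R,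
  and nonzero for s = 0 when \<mu> is nonzero and q is nonzero and not a root of unity.\<close>

definition kproj_eigenvalue :: "complex \<Rightarrow> complex \<Rightarrow> nat \<Rightarrow> nat \<Rightarrow> complex" where
  "kproj_eigenvalue q \<mu> R s = (\<Prod>r<R. \<mu> * (inverse q^2) ^ s - \<mu> * (inverse q^2) ^ Suc r)"

lemma kproj_add: "kproj q \<mu> R (\<lambda>a. f a + g a) = (\<lambda>a. kproj q \<mu> R f a + kproj q \<mu> R g a)"
  by (induction R) (auto simp: fun_eq_iff algebra_simps)

lemma kproj_scale: "kproj q \<mu> R (\<lambda>a. c * f a) = (\<lambda>a. c * kproj q \<mu> R f a)"
  by (induction R) (auto simp: fun_eq_iff algebra_simps)

lemma kproj_zero: "kproj q \<mu> R (\<lambda>a. 0) = (\<lambda>a. 0)"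
  by (induction R) (auto simp: fun_eq_iff)

lemma kproj_eigen:
  assumes "\<And>a. f (a @ [GK]) = \<mu> * (inverse q^2) ^ s * f a"
  shows "kproj q \<mu> R f = (\<lambda>a. kproj_eigenvalue q \<mu> R s * f a)"
proof (induction R)
  case (Suc R)
  show ?case
    by (rule ext) (simp add: Suc assms kproj_eigenvalue_def algebra_simps)
qed (simp add: kproj_eigenvalue_def fun_eq_iff)

lemma power_neq_one:
  assumes "q \<noteq> 0" "\<not> root_of_unity q" "n > 0"
  shows "(inverse q^2) ^ n \<noteq> 1"
proof
  assume "(inverse q^2) ^ n = 1"
  then have "q ^ (2 * n) = 1" using assms(1) by (simp add: power_inverse flip: power_mult)
  then show False using assms unfolding root_of_unity_def by (metis mult_pos_pos zero_less_numeral)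
qed

lemma inj_geometric:
  fixes c e :: complex
  assumes "c \<noteq> 0" "e \<noteq> 0" and e: "\<And>m. m > 0 \<Longrightarrow> e ^ m \<noteq> 1"
  shows "inj_on (\<lambda>r. c * e ^ r) A"
proof -
  have "False" if "r < s" and eq: "c * e ^ r = c * e ^ s" for r s :: nat
  proof -
    have "e ^ s = e ^ r * e ^ (s - r)" using that(1) by (simp flip: power_add)
    then have "e ^ (s - r) = 1" using eq assms(1,2) by simp
    then show False using e[of "s - r"] that(1) by simp
  qed
  then show ?thesis unfolding inj_on_def by (metis linorder_neqE_nat)
qed

lemma q_minus_inverse:
  assumes "q \<noteq> 0" "\<not> root_of_unity q"
  shows "q - inverse q \<noteq> 0"
proof
  assume "q - inverse q = 0"
  then have "q ^ 2 = 1" using assms(1) by (simp add: field_simps power2_eq_square)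
  then show False using assms(2) unfolding root_of_unity_def by (metis zero_less_numeral)
qed

lemma kproj_eigenvalue_0:
  assumes "q \<noteq> 0" "\<not> root_of_unity q" "\<mu> \<noteq> 0"
  shows "kproj_eigenvalue q \<mu> R 0 \<noteq> 0"
  using power_neq_one[OF assms(1,2)] assms(3)
  by (auto simp: kproj_eigenvalue_def simp del: power_Suc)

lemma kproj_eigenvalue_pos:
  assumes "0 < s" "s \<le> R"
  shows "kproj_eigenvalue q \<mu> R s = 0"
proof -
  obtain r where "s = Suc r" using assms(1) by (cases s) auto
  then show ?thesis unfolding kproj_eigenvalue_def using assms(2)
    by (intro prod_zero bexI[of _ r]) auto
qed

text \<open>\<open>R\<close> is now the ring of constants, so a single combination of monomials
  serves all members of the family. This allows all coordinates of a vector to be treated at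
  once.\<close>

lemma hw_word_comb:
  assumes "q \<noteq> 0" "q - inverse q \<noteq> 0" "\<mu> \<noteq> 0" and hw: "\<And>n. hw_functional q Q \<mu> u (\<omega> n)"
  obtains d where "monomial_comb (range (\<lambda>c n. c)) \<omega> d (\<lambda>n a. \<omega> n (a @ w))"
proof -
  interpret hw_family q Q \<omega> "\<lambda>n. \<mu>" "\<lambda>n. u" "range (\<lambda>c n. c)" "weight w"
    using assms by unfold_locales auto
  show thesis using that[OF mc_word[OF order_refl]] .
qed

text \<open>For large \<open>R\<close> the projection annihilates every monomial but the empty one,
  so it extracts a coefficient \<open>c\<close> common to all \<open>n\<close>. The second clause
  says that an image of a lowering operator projects to zero, and the third recovers
  \<open>c\<close> by evaluation at the empty word.\<close>

lemma kproj_comb: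
  assumes q: "q \<noteq> 0" "\<mu> \<noteq> 0" and hw: "\<And>n. hw_functional q Q \<mu> u (\<omega> n)"
    and "monomial_comb (range (\<lambda>c n. c)) \<omega> d f"
  shows "\<exists>c R0. (\<forall>R\<ge>R0. \<forall>n a. kproj q \<mu> R (f n) a = c * kproj_eigenvalue q \<mu> R 0 * \<omega> n a) \<and>
    (\<forall>R\<ge>R0. \<forall>n t a. kproj q \<mu> R (\<lambda>a. f n (a @ [GM t])) a = 0) \<and>
    (\<forall>n. (\<forall>t b. \<omega> n (GM t # b) = 0) \<longrightarrow> f n [] = c * \<omega> n [])"
  using assms(4)
proof (induction rule: monomial_comb.induct)
  case (zero d)
  show ?case by (intro exI[of _ 0]) (simp add: kproj_zero)
next
  case (monomial ts d)
  have K: "\<omega> n ((a @ [GK]) @ map GM ts) = \<mu> * (inverse q^2) ^ length ts * \<omega> n (a @ map GM ts)" for n a ts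
    using hw_functional_K_monomial[OF hw q, of n a ts] by simp
  have e: "kproj q \<mu> R (\<lambda>a. \<omega> n (a @ map GM ts)) = (\<lambda>a. kproj_eigenvalue q \<mu> R (length ts) * \<omega> n (a @ map GM ts))"
    for R n ts by (rule kproj_eigen) (rule K)
  \<comment> \<open>An additional lowering letter lengthens the monomial by one, hence the threshold
    \<open>Suc (length ts)\<close>.\<close>
  have M: "kproj q \<mu> R (\<lambda>a. \<omega> n ((a @ [GM t]) @ map GM ts)) a = 0" if "Suc (length ts) \<le> R" for R n t a
    using e[of R n "t # ts"] kproj_eigenvalue_pos[OF _ that] by simp
  show ?case
  proof (cases "ts = []")
    case True
    then show ?thesis using e[of _ _ "[]"] M
      by (intro exI[of _ 1] exI[of _ "Suc (length ts)"]) auto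
  next
    case False
    have "kproj q \<mu> R (\<lambda>a. \<omega> n (a @ map GM ts)) a = 0" if "Suc (length ts) \<le> R" for R n a
      unfolding e using kproj_eigenvalue_pos[of "length ts" R] False that by simp
    then show ?thesis using M False
      by (intro exI[of _ 0] exI[of _ "Suc (length ts)"]) (cases ts; auto)
  qed
next
  case (add d f g)
  from add.IH(1) obtain c R0 where f:
    "\<And>R n a. R \<ge> R0 \<Longrightarrow> kproj q \<mu> R (f n) a = c * kproj_eigenvalue q \<mu> R 0 * \<omega> n a"
    "\<And>R n t a. R \<ge> R0 \<Longrightarrow> kproj q \<mu> R (\<lambda>a. f n (a @ [GM t])) a = 0"
    "\<And>n. (\<forall>t b. \<omega> n (GM t # b) = 0) \<Longrightarrow> f n [] = c * \<omega> n []" by blast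
  from add.IH(2) obtain c' R0' where g:
    "\<And>R n a. R \<ge> R0' \<Longrightarrow> kproj q \<mu> R (g n) a = c' * kproj_eigenvalue q \<mu> R 0 * \<omega> n a"
    "\<And>R n t a. R \<ge> R0' \<Longrightarrow> kproj q \<mu> R (\<lambda>a. g n (a @ [GM t])) a = 0"
    "\<And>n. (\<forall>t b. \<omega> n (GM t # b) = 0) \<Longrightarrow> g n [] = c' * \<omega> n []" by blast
  show ?case
    by (intro exI[of _ "c + c'"] exI[of _ "max R0 R0'"])
      (simp add: kproj_add f g algebra_simps)
next
  case (scale r d f)
  then obtain e where r: "r = (\<lambda>n. e)" by auto
  from scale.IH obtain c R0 where f:
    "\<And>R n a. R \<ge> R0 \<Longrightarrow> kproj q \<mu> R (f n) a = c * kproj_eigenvalue q \<mu> R 0 * \<omega> n a"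
    "\<And>R n t a. R \<ge> R0 \<Longrightarrow> kproj q \<mu> R (\<lambda>a. f n (a @ [GM t])) a = 0"
    "\<And>n. (\<forall>t b. \<omega> n (GM t # b) = 0) \<Longrightarrow> f n [] = c * \<omega> n []" by blast
  show ?case unfolding r
    by (intro exI[of _ "e * c"] exI[of _ R0]) (simp add: kproj_scale f)
qed

lemma smult_mat_vec:
  fixes A :: "complex mat"
  assumes "A \<in> carrier_mat n m" "x \<in> carrier_vec m"
  shows "(c \<cdot>\<^sub>m A) *\<^sub>v x = c \<cdot>\<^sub>v (A *\<^sub>v x)"
  using assms by (intro eq_vecI) (auto simp: scalar_prod_def sum_distrib_left mult.assoc)

lemma mat_eq_by_action:
  fixes A B :: "complex mat"
  assumes "A \<in> carrier_mat n n" "B \<in> carrier_mat n n"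
    and "\<And>x. x \<in> carrier_vec n \<Longrightarrow> A *\<^sub>v x = B *\<^sub>v x"
  shows "A = B"
proof (rule eq_matI)
  fix i j assume ij: "i < dim_row B" "j < dim_col B"
  have "C $$ (i, j) = (C *\<^sub>v unit_vec n j) $ i" if "C \<in> carrier_mat n n" for C :: "complex mat"
    using that ij assms(2) by simp
  from this[OF assms(1)] this[OF assms(2)] assms(3)[of "unit_vec n j"]
  show "A $$ (i, j) = B $$ (i, j)" by simp
qed (use assms in auto)

text \<open>The left ideal of words annihilated by the vacuum functional has finite codimension here; the
  words \<open>ws\<close> represent a basis of the quotient, and a class is identified with the functional
  \<open>b \<mapsto> \<omega> (b @ w)\<close>.\<close>

locale finite_vacuum =
  fixes q Q \<mu> :: complex and u :: "nat \<Rightarrow> complex" and \<omega> :: "gen list \<Rightarrow> complex"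
    and ws :: "gen list list" and expn :: "gen list \<Rightarrow> nat \<Rightarrow> complex"
  assumes q0: "q \<noteq> 0" and nroot: "\<not> root_of_unity q" and m0: "\<mu> \<noteq> 0"
    and vac: "vacuum_functional q Q \<mu> u \<omega>"
    and expand: "\<And>v b. \<omega> (b @ v) = (\<Sum>j<length ws. expn v j * \<omega> (b @ ws ! j))"
    and indep: "\<And>x j. (\<And>b. (\<Sum>j<length ws. x j * \<omega> (b @ ws ! j)) = 0) \<Longrightarrow> j < length ws \<Longrightarrow> x j = 0"
begin

abbreviation "d \<equiv> length ws"

definition fnl :: "complex vec \<Rightarrow> gen list \<Rightarrow> complex" where
  "fnl x b = (\<Sum>j<d. x $ j * \<omega> (b @ ws ! j))"

definition coords :: "gen list \<Rightarrow> complex vec" where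
  "coords v = vec d (expn v)"

definition gm :: "gen \<Rightarrow> complex mat" where
  "gm g = mat d d (\<lambda>(i, j). expn (g # ws ! j) i)"

lemma hw: "hw_functional q Q \<mu> u \<omega>" and vac1: "\<omega> [] = 1" and vacM: "\<omega> (GM t # b) = 0"
  using vac unfolding vacuum_functional_def by auto

lemma qq: "q - inverse q \<noteq> 0" using q_minus_inverse[OF q0 nroot] .

lemma fnl_inj:
  assumes "x \<in> carrier_vec d" "y \<in> carrier_vec d" "\<And>b. fnl x b = fnl y b"
  shows "x = y"
proof (rule eq_vecI)
  fix j assume "j < dim_vec y"
  then have j: "j < d" using assms by simp
  have "(\<Sum>j<d. (x $ j - y $ j) * \<omega> (b @ ws ! j)) = 0" for b
    using assms(3)[of b] unfolding fnl_def by (simp add: left_diff_distrib sum_subtractf)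
  from indep[OF this j] show "x $ j = y $ j" by simp
qed (use assms in simp)

lemma fnl_coords: "fnl (coords v) b = \<omega> (b @ v)"
  unfolding fnl_def coords_def expand[of b v] by (intro sum.cong) auto

lemma coords_carrier [simp]: "coords v \<in> carrier_vec d" by (simp add: coords_def)

lemma gm_carrier [simp]: "gm g \<in> carrier_mat d d" by (simp add: gm_def)

lemma gm_mult_carrier [simp]: "x \<in> carrier_vec d \<Longrightarrow> gm g *\<^sub>v x \<in> carrier_vec d"
  using mult_mat_vec_carrier[OF gm_carrier] .

text \<open>Acting by \<open>g\<close> prepends \<open>g\<close> to the words of a class, which a
  test word \<open>b\<close> sees as the letter \<open>g\<close> at its own end.\<close>

lemma fnl_gm:
  assumes "x \<in> carrier_vec d"
  shows "fnl (gm g *\<^sub>v x) b = fnl x (b @ [g])"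
proof -
  have "fnl (gm g *\<^sub>v x) b = (\<Sum>i<d. (\<Sum>j<d. expn (g # ws ! j) i * x $ j) * \<omega> (b @ ws ! i))"
    unfolding fnl_def using assms
    by (intro sum.cong refl) (simp add: gm_def scalar_prod_def atLeast0LessThan)
  also have "\<dots> = (\<Sum>j<d. x $ j * (\<Sum>i<d. expn (g # ws ! j) i * \<omega> (b @ ws ! i)))"
    unfolding sum_distrib_left sum_distrib_right
    by (subst sum.swap) (simp add: ac_simps)
  also have "\<dots> = (\<Sum>j<d. x $ j * \<omega> (b @ g # ws ! j))"
    unfolding expand[symmetric] ..
  finally show ?thesis by (simp add: fnl_def)
qed

lemma fnl_add: "x \<in> carrier_vec d \<Longrightarrow> y \<in> carrier_vec d \<Longrightarrow> fnl (x + y) b = fnl x b + fnl y b"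
  by (simp add: fnl_def sum.distrib algebra_simps)

lemma fnl_diff: "x \<in> carrier_vec d \<Longrightarrow> y \<in> carrier_vec d \<Longrightarrow> fnl (x - y) b = fnl x b - fnl y b"
  by (simp add: fnl_def sum_subtractf algebra_simps)

lemma fnl_smult: "x \<in> carrier_vec d \<Longrightarrow> fnl (c \<cdot>\<^sub>v x) b = c * fnl x b"
  by (simp add: fnl_def sum_distrib_left mult.assoc)

lemma fnl_zero: "fnl (0\<^sub>v d) b = 0"
  by (simp add: fnl_def)

lemma fnl_defrel:
  assumes "defrel q Q r"
  shows "word_sum (\<lambda>w. fnl x (b @ w)) r = 0"
proof -
  have "word_sum (\<lambda>w. fnl x (b @ w)) r = (\<Sum>j<d. x $ j * word_sum (\<lambda>w. \<omega> (b @ w @ ws ! j)) r)"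
    unfolding fnl_def
  proof (induction r)
    case (Cons p r)
    then show ?case
      by (cases p) (simp add: sum.distrib sum_distrib_left algebra_simps)
  qed simp
  also have "\<dots> = 0" using hw_functional_relD[OF hw assms] by simp
  finally show ?thesis .
qed

text \<open>An analogue of the Gelfand-Naimark-Segal construction: words modulo the combinations
  that \<omega> annihilates behind every left context, acted on by left multiplication.\<close>

definition gns :: umod where
  "gns = \<lparr>dim = d, Xp = \<lambda>t. gm (GP t), Xm = \<lambda>t. gm (GM t), J = \<lambda>t. gm (GJ t), Kp = gm GK, Km = gm GL\<rparr>"

lemma gns_simps [simp]:
  "dim gns = d" "Xp gns t = gm (GP t)" "Xm gns t = gm (GM t)" "J gns t = gm (GJ t)" "Kp gns = gm GK"
  "Km gns = gm GL"
  by (simp_all add: gns_def)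

lemma mat_eqI:
  assumes "A \<in> carrier_mat d d" "B \<in> carrier_mat d d"
    and "\<And>x b. x \<in> carrier_vec d \<Longrightarrow> fnl (A *\<^sub>v x) b = fnl (B *\<^sub>v x) b"
  shows "A = B"
proof (rule mat_eq_by_action[OF assms(1,2)])
  fix x :: "complex vec" assume "x \<in> carrier_vec d"
  then show "A *\<^sub>v x = B *\<^sub>v x"
    using assms by (intro fnl_inj) (auto intro: mult_mat_vec_carrier)
qed

lemma fnl_mult:
  assumes "A \<in> carrier_mat d d" "B \<in> carrier_mat d d" "x \<in> carrier_vec d"
  shows "fnl ((A * B) *\<^sub>v x) b = fnl (A *\<^sub>v (B *\<^sub>v x)) b"
  using assms by (simp add: assoc_mult_mat_vec)

lemma fnl_minus_mat:
  assumes "A \<in> carrier_mat d d" "B \<in> carrier_mat d d" "x \<in> carrier_vec d"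
  shows "fnl ((A - B) *\<^sub>v x) b = fnl (A *\<^sub>v x) b - fnl (B *\<^sub>v x) b"
  using assms mult_mat_vec_carrier[OF assms(1,3)] mult_mat_vec_carrier[OF assms(2,3)]
  by (simp add: minus_mult_distrib_mat_vec fnl_diff)

lemma fnl_smult_mat:
  assumes "A \<in> carrier_mat d d" "x \<in> carrier_vec d"
  shows "fnl ((c \<cdot>\<^sub>m A) *\<^sub>v x) b = c * fnl (A *\<^sub>v x) b"
  using mult_mat_vec_carrier[OF assms] by (simp add: smult_mat_vec[OF assms] fnl_smult)

lemmas fnl_mat_simps = fnl_minus_mat fnl_smult_mat fnl_mult fnl_gm

text \<open>The functionals \<open>fnl\<close> separate vectors, so a matrix identity follows from
  the word relation tested on each of them.\<close>

lemma mat_eq_defrel: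
  assumes "A \<in> carrier_mat d d" "B \<in> carrier_mat d d" "defrel q Q r"
    and "\<And>x b. x \<in> carrier_vec d \<Longrightarrow>
      fnl (A *\<^sub>v x) b - fnl (B *\<^sub>v x) b = word_sum (\<lambda>w. fnl x (b @ w)) r"
  shows "A = B"
  using assms(4) fnl_defrel[OF assms(3)] by (intro mat_eqI[OF assms(1,2)]) simp

lemma square_carrier [simp]:
  "A \<in> carrier_mat d d \<Longrightarrow> B \<in> carrier_mat d d \<Longrightarrow> A * B \<in> carrier_mat d d"
  "B \<in> carrier_mat d d \<Longrightarrow> A - B \<in> carrier_mat d d"
  "A \<in> carrier_mat d d \<Longrightarrow> x \<in> carrier_vec d \<Longrightarrow> A *\<^sub>v x \<in> carrier_vec d"
  by (auto intro: mult_mat_vec_carrier)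

lemma gns_umod: "is_umod q Q gns"
proof -
  have KJ: "gm GK * gm (GJ t) = gm (GJ t) * gm GK" for t
    by (rule mat_eq_defrel[OF _ _ defrel.KJ[of q Q t]]) (simp_all add: fnl_mat_simps algebra_simps)
  have JJ: "gm (GJ s) * gm (GJ t) = gm (GJ t) * gm (GJ s)" for s t
    by (rule mat_eq_defrel[OF _ _ defrel.JJ[of q Q s t]]) (simp_all add: fnl_mat_simps algebra_simps)
  have KL: "gm GK * gm GL = 1\<^sub>m d"
    by (rule mat_eq_defrel[OF _ _ defrel.KL[of q Q]]) (simp_all add: fnl_mat_simps algebra_simps)
  have LK: "gm GL * gm GK = 1\<^sub>m d"
    by (rule mat_eq_defrel[OF _ _ defrel.LK[of q Q]]) (simp_all add: fnl_mat_simps algebra_simps)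
  have LL: "gm GL * gm GL = 1\<^sub>m d - (q - inverse q) \<cdot>\<^sub>m gm (GJ 0)"
    by (rule mat_eq_defrel[OF _ _ defrel.LL[of q Q]]) (simp_all add: fnl_mat_simps algebra_simps)
  have PP: "gm (GP (t+1)) * gm (GP s) - (q^2) \<cdot>\<^sub>m (gm (GP s) * gm (GP (t+1)))
            = (q^2) \<cdot>\<^sub>m (gm (GP t) * gm (GP (s+1))) - gm (GP (s+1)) * gm (GP t)" for s t
    by (rule mat_eq_defrel[OF _ _ defrel.PP[of q Q t s]]) (simp_all add: fnl_mat_simps algebra_simps)
  have MM: "gm (GM (t+1)) * gm (GM s) - (inverse q^2) \<cdot>\<^sub>m (gm (GM s) * gm (GM (t+1)))
            = (inverse q^2) \<cdot>\<^sub>m (gm (GM t) * gm (GM (s+1))) - gm (GM (s+1)) * gm (GM t)" for s t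
    by (rule mat_eq_defrel[OF _ _ defrel.MM[of q Q t s]]) (simp_all add: fnl_mat_simps algebra_simps)
  have KP: "gm GK * gm (GP t) * gm GL = (q^2) \<cdot>\<^sub>m gm (GP t)" for t
    by (rule mat_eq_defrel[OF _ _ defrel.KP[of q Q t]]) (simp_all add: fnl_mat_simps algebra_simps)
  have KM: "gm GK * gm (GM t) * gm GL = (inverse q^2) \<cdot>\<^sub>m gm (GM t)" for t
    by (rule mat_eq_defrel[OF _ _ defrel.KM[of q Q t]]) (simp_all add: fnl_mat_simps algebra_simps)
  have J0P: "(q^2) \<cdot>\<^sub>m (gm (GJ 0) * gm (GP t)) - (inverse q^2) \<cdot>\<^sub>m (gm (GP t) * gm (GJ 0))
            = qint q 2 \<cdot>\<^sub>m gm (GP t)" for t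
    by (rule mat_eq_defrel[OF _ _ defrel.J0P[of q Q t]]) (simp_all add: fnl_mat_simps algebra_simps)
  have J0M: "(inverse q^2) \<cdot>\<^sub>m (gm (GJ 0) * gm (GM t)) - (q^2) \<cdot>\<^sub>m (gm (GM t) * gm (GJ 0))
            = (- qint q 2) \<cdot>\<^sub>m gm (GM t)" for t
    by (rule mat_eq_defrel[OF _ _ defrel.J0M[of q Q t]]) (simp_all add: fnl_mat_simps algebra_simps)
  have JP: "comm (gm (GJ (s+1))) (gm (GP t))
            = (q^2) \<cdot>\<^sub>m (gm (GJ s) * gm (GP (t+1))) - (inverse q^2) \<cdot>\<^sub>m (gm (GP (t+1)) * gm (GJ s))" for s t
    unfolding comm_def
    by (rule mat_eq_defrel[OF _ _ defrel.JP[of q Q s t]]) (simp_all add: fnl_mat_simps algebra_simps)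
  have JM: "comm (gm (GJ (s+1))) (gm (GM t))
            = (inverse q^2) \<cdot>\<^sub>m (gm (GJ s) * gm (GM (t+1))) - (q^2) \<cdot>\<^sub>m (gm (GM (t+1)) * gm (GJ s))" for s t
    unfolding comm_def
    by (rule mat_eq_defrel[OF _ _ defrel.JM[of q Q s t]]) (simp_all add: fnl_mat_simps algebra_simps)
  have PM: "comm (gm (GP t)) (gm (GM s)) = gm GK * (gm (GJ (s+t)) - Q \<cdot>\<^sub>m gm (GJ (s+t+1)))" for s t
    unfolding comm_def
    by (rule mat_eq_defrel[OF _ _ defrel.PM[of q Q t s]]) (simp_all add: fnl_mat_simps algebra_simps)
  show ?thesis
    unfolding is_umod_def Let_def gns_simps
    using KJ JJ KL LK LL PP MM KP KM J0P J0M JP JM PM by simp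
qed

text \<open>The coefficient of \<open>kproj_comb\<close> is found by evaluation at the empty word,
  where \<omega> is normalised; the family has a single member.\<close>

lemma word_kproj:
  "\<exists>R0. \<forall>R\<ge>R0. \<forall>a. kproj q \<mu> R (\<lambda>b. \<omega> (b @ w)) a = \<omega> w * kproj_eigenvalue q \<mu> R 0 * \<omega> a"
proof -
  obtain e where "monomial_comb (range (\<lambda>c n. c)) (\<lambda>_ :: unit. \<omega>) e (\<lambda>n a. \<omega> (a @ w))"
    by (rule hw_word_comb[OF q0 qq m0, of Q u "\<lambda>_. \<omega>"]) (use hw in auto)
  from kproj_comb[OF q0 m0 _ this, of Q u] hw obtain c R0 where
    "\<forall>R\<ge>R0. \<forall>a. kproj q \<mu> R (\<lambda>b. \<omega> (b @ w)) a = c * kproj_eigenvalue q \<mu> R 0 * \<omega> a"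
    "\<omega> w = c * \<omega> []"
    using vacM by auto
  then show ?thesis using vac1 by auto
qed

lemma fnl_kproj:
  "\<exists>R0. \<forall>R\<ge>R0. \<forall>a. kproj q \<mu> R (fnl x) a = fnl x [] * kproj_eigenvalue q \<mu> R 0 * \<omega> a"
proof -
  \<comment> \<open>The sum over basis words is cut at \<open>m\<close>, so that the thresholds of
    its finitely many terms can be combined by maxima.\<close>
  have "\<exists>R0. \<forall>R\<ge>R0. \<forall>a. kproj q \<mu> R (\<lambda>b. \<Sum>j<m. x $ j * \<omega> (b @ ws ! j)) a =
      (\<Sum>j<m. x $ j * \<omega> ([] @ ws ! j)) * kproj_eigenvalue q \<mu> R 0 * \<omega> a" for m
  proof (induction m)
    case (Suc m)
    then obtain R0 where R0: "\<And>R a. R \<ge> R0 \<Longrightarrow> kproj q \<mu> R (\<lambda>b. \<Sum>j<m. x $ j * \<omega> (b @ ws ! j)) a =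
      (\<Sum>j<m. x $ j * \<omega> ([] @ ws ! j)) * kproj_eigenvalue q \<mu> R 0 * \<omega> a" by blast
    obtain R1 where R1: "\<And>R a. R \<ge> R1 \<Longrightarrow> kproj q \<mu> R (\<lambda>b. \<omega> (b @ ws ! m)) a =
      \<omega> (ws ! m) * kproj_eigenvalue q \<mu> R 0 * \<omega> a" using word_kproj[of "ws ! m"] by blast
    show ?case
      unfolding sum.lessThan_Suc
      by (intro exI[of _ "max R0 R1"]) (simp add: kproj_add kproj_scale R0 R1 algebra_simps)
  qed (simp add: kproj_zero)
  then show ?thesis unfolding fnl_def .
qed

lemma submodule_gm:
  assumes "submodule gns W" "v \<in> W"
  shows "gm g *\<^sub>v v \<in> W"
  using assms unfolding submodule_def by (cases g) auto

fun word_act :: "gen list \<Rightarrow> complex vec \<Rightarrow> complex vec" where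
  "word_act [] x = x"
| "word_act (g # w) x = gm g *\<^sub>v word_act w x"

lemma word_act_carrier [simp]: "x \<in> carrier_vec d \<Longrightarrow> word_act w x \<in> carrier_vec d"
  by (induction w) auto

lemma fnl_word_act: "x \<in> carrier_vec d \<Longrightarrow> fnl (word_act w x) b = fnl x (b @ w)"
  by (induction w arbitrary: b) (auto simp: fnl_gm)

lemma submodule_word_act: "submodule gns W \<Longrightarrow> v \<in> W \<Longrightarrow> word_act w v \<in> W"
  by (induction w) (auto intro: submodule_gm)

lemma word_act_coords: "word_act w (coords []) = coords w"
  by (rule fnl_inj) (auto simp: fnl_word_act fnl_coords)

fun pk :: "nat \<Rightarrow> complex vec \<Rightarrow> complex vec" where
  "pk 0 x = x"
| "pk (Suc R) x = gm GK *\<^sub>v pk R x + (- (\<mu> * (inverse q^2) ^ Suc R)) \<cdot>\<^sub>v pk R x"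

lemma pk_carrier [simp]: "x \<in> carrier_vec d \<Longrightarrow> pk R x \<in> carrier_vec d"
  by (induction R) auto

lemma fnl_pk: "x \<in> carrier_vec d \<Longrightarrow> fnl (pk R x) b = kproj q \<mu> R (fnl x) b"
  by (induction R arbitrary: b) (auto simp: fnl_gm fnl_add fnl_smult)

lemma submodule_pk: "submodule gns W \<Longrightarrow> v \<in> W \<Longrightarrow> pk R v \<in> W"
proof (induction R)
  case (Suc R)
  then have "pk R v \<in> W" by blast
  moreover from this have "gm GK *\<^sub>v pk R v \<in> W" using Suc.prems(1) submodule_gm by blast
  ultimately show ?case using Suc.prems(1) unfolding submodule_def by simp
qed simp

lemma gns_generated: "generated_by gns (coords [])"
  unfolding generated_by_def
proof (intro allI impI)
  fix W assume W: "submodule gns W \<and> coords [] \<in> W"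
  have cW: "coords w \<in> W" for w
    using submodule_word_act[of W "coords []" w] W by (simp add: word_act_coords)
  have add: "v + w \<in> W" if "v \<in> W" "w \<in> W" for v w using W that unfolding submodule_def by blast
  have smult: "a \<cdot>\<^sub>v v \<in> W" if "v \<in> W" for a v using W that unfolding submodule_def by blast
  have unit: "unit_vec d j \<in> W" if j: "j < d" for j
  proof -
    have "fnl (unit_vec d j) b = \<omega> (b @ ws ! j)" for b
    proof -
      have "fnl (unit_vec d j) b = (\<Sum>i<d. if i = j then \<omega> (b @ ws ! i) else 0)"
        unfolding fnl_def using j by (intro sum.cong) auto
      then show ?thesis using j by simp
    qed
    then have "unit_vec d j = coords (ws ! j)"
      by (intro fnl_inj) (auto simp: fnl_coords)
    then show ?thesis using cW by simp
  qed
  have "x \<in> W" if x: "x \<in> carrier_vec d" for x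
  proof -
    have "vec d (\<lambda>j. if j < m then x $ j else 0) \<in> W" if "m \<le> d" for m
      using that
    proof (induction m)
      case 0
      have "vec d (\<lambda>j. if j < 0 then x $ j else 0) = 0\<^sub>v d" by (rule eq_vecI) auto
      then show ?case using W unfolding submodule_def by simp
    next
      case (Suc m)
      have "vec d (\<lambda>j. if j < Suc m then x $ j else 0) =
          vec d (\<lambda>j. if j < m then x $ j else 0) + x $ m \<cdot>\<^sub>v unit_vec d m"
        using Suc.prems by (intro eq_vecI) (auto simp: less_Suc_eq)
      then show ?case using add smult unit Suc by simp
    qed
    from this[of d] have "vec d (\<lambda>j. if j < d then x $ j else 0) \<in> W" by simp
    moreover have "vec d (\<lambda>j. if j < d then x $ j else 0) = x" using x by (intro eq_vecI) auto
    ultimately show ?thesis by simp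
  qed
  then show "W = carrier_vec (dim gns)" using W unfolding submodule_def by auto
qed

text \<open>A nonzero \<open>x\<close> has a nonzero value \<open>fnl x b\<close>. Acting by the
  word \<open>b\<close> makes the component along the highest weight vector nonzero, and
  \<open>pk\<close> then cuts out a nonzero multiple of that vector, which generates
  everything.\<close>

lemma gns_simple: "simple_umod gns"
  unfolding simple_umod_def
proof (intro conjI allI impI)
  show "0 < dim gns"
  proof (rule ccontr)
    assume "\<not> 0 < dim gns"
    then have "\<omega> ([] @ []) = 0" using expand[of "[]" "[]"] by simp
    then show False using vac1 by simp
  qed
  fix W assume W: "submodule gns W"
  show "W = {0\<^sub>v (dim gns)} \<or> W = carrier_vec (dim gns)"
  proof (cases "W \<subseteq> {0\<^sub>v d}")
    case True
    then show ?thesis using W unfolding submodule_def by auto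
  next
    case False
    then obtain x where x: "x \<in> W" "x \<noteq> 0\<^sub>v d" by auto
    have sub: "W \<subseteq> carrier_vec d" and smult: "\<And>a v. v \<in> W \<Longrightarrow> a \<cdot>\<^sub>v v \<in> W"
      using W unfolding submodule_def by auto
    obtain b where b: "fnl x b \<noteq> 0"
      using fnl_inj[of x "0\<^sub>v d"] x sub fnl_zero by auto
    let ?y = "word_act b x"
    have y: "?y \<in> W" "?y \<in> carrier_vec d" using submodule_word_act[OF W x(1)] sub by auto
    have y0: "fnl ?y [] \<noteq> 0" using fnl_word_act[of x b "[]"] x sub b by auto
    obtain R where R: "\<And>a. kproj q \<mu> R (fnl ?y) a = fnl ?y [] * kproj_eigenvalue q \<mu> R 0 * \<omega> a"
      using fnl_kproj[of ?y] by blast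
    define c where "c = fnl ?y [] * kproj_eigenvalue q \<mu> R 0"
    have c: "c \<noteq> 0" using y0 kproj_eigenvalue_0[OF q0 nroot m0] by (simp add: c_def)
    have R': "kproj q \<mu> R (fnl ?y) a = c * \<omega> a" for a by (simp add: R c_def)
    have "inverse c \<cdot>\<^sub>v pk R ?y = coords []"
      by (rule fnl_inj) (use y c in \<open>auto simp: fnl_smult fnl_pk R' fnl_coords\<close>)
    then have "coords [] \<in> W" using smult[OF submodule_pk[OF W y(1)], of "inverse c" R] by simp
    then show ?thesis using gns_generated W unfolding generated_by_def by blast
  qed
qed

lemma gns_is_L: "is_L q Q gns (\<mu>, u)"
proof -
  have 1: "coords [] \<noteq> 0\<^sub>v d"
    using fnl_coords[of "[]" "[]"] fnl_zero[of "[]"] vac1 by auto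
  have P: "gm (GP t) *\<^sub>v coords [] = 0\<^sub>v d" for t
    by (rule fnl_inj) (auto simp: fnl_gm fnl_coords fnl_zero hw_functional_end(1)[OF hw q0 m0])
  have K: "gm GK *\<^sub>v coords [] = \<mu> \<cdot>\<^sub>v coords []"
    by (rule fnl_inj) (auto simp: fnl_gm fnl_coords fnl_smult hw_functional_end(2)[OF hw q0 m0])
  have J: "gm (GJ t) *\<^sub>v coords [] = u t \<cdot>\<^sub>v coords []" if "t > 0" for t
    by (rule fnl_inj) (use that in \<open>auto simp: fnl_gm fnl_coords fnl_smult hw_functional_end(3)[OF hw q0 m0]\<close>)
  have "hw_vector gns (\<mu>, u) (coords [])"
    unfolding hw_vector_def using 1 P K J by simp
  then show ?thesis
    unfolding is_L_def using gns_umod gns_simple gns_generated by blast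
qed

end

text \<open>The rank hypothesis bounds the size of an independent set of words; a largest such set
  expands every word and supplies the basis required by \<open>finite_vacuum\<close>.\<close>

theorem finite_rank_vacuum_is_L:
  assumes "q \<noteq> 0" "\<not> root_of_unity q" "\<mu> \<noteq> 0" and vac: "vacuum_functional q Q \<mu> u \<omega>"
    and rank: "\<And>I w. finite I \<Longrightarrow> N < card I \<Longrightarrow>
       \<exists>c. (\<exists>i\<in>I. c i \<noteq> 0) \<and> (\<forall>b. (\<Sum>i\<in>I. c i * \<omega> (b @ w (i :: gen list))) = 0)"
  shows "\<exists>M. is_L q Q M (\<mu>, u)"
proof -
  define ind where "ind W \<longleftrightarrow> finite W \<and>
    (\<forall>c. (\<forall>b. (\<Sum>w\<in>W. c w * \<omega> (b @ w)) = 0) \<longrightarrow> (\<forall>w\<in>W. c w = 0))" for W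
  have bound: "card W \<le> N" if "ind W" for W
  proof (rule ccontr)
    assume "\<not> card W \<le> N"
    then have "finite W" "N < card W" using that unfolding ind_def by auto
    from rank[OF this, of "\<lambda>w. w"] that show False unfolding ind_def by blast
  qed
  have fin: "finite (card ` {W. ind W})" by (rule finite_subset[of _ "{..N}"]) (use bound in auto)
  have "ind {}" by (simp add: ind_def)
  then have "card ` {W. ind W} \<noteq> {}" by blast
  from Max_in[OF fin this] obtain W where W: "ind W" "card W = Max (card ` {W. ind W})" by auto
  have max: "card V \<le> card W" if "ind V" for V
    unfolding W(2) using that by (intro Max_ge[OF fin]) auto
  have finW: "finite W" using W(1) unfolding ind_def by blast
  have "\<exists>a. \<forall>b. \<omega> (b @ v) = (\<Sum>w\<in>W. a w * \<omega> (b @ w))" for v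
  proof (cases "v \<in> W")
    case True
    have "\<omega> (b @ v) = (\<Sum>w\<in>W. (if w = v then 1 else 0) * \<omega> (b @ w))" for b
      using True finW by (simp add: if_distrib[of "\<lambda>x. x * _"] cong: if_cong)
    then show ?thesis by (intro exI[of _ "\<lambda>w. if w = v then 1 else 0"]) simp
  next
    case False
    then have "\<not> ind (insert v W)" using max[of "insert v W"] finW by auto
    then obtain c where c: "\<And>b. (\<Sum>w\<in>insert v W. c w * \<omega> (b @ w)) = 0" "\<exists>w\<in>insert v W. c w \<noteq> 0"
      using finW unfolding ind_def by auto
    have c1: "c v * \<omega> (b @ v) + (\<Sum>w\<in>W. c w * \<omega> (b @ w)) = 0" for b
      using c(1)[of b] False finW by simp
    have "c v \<noteq> 0"
    proof
      assume "c v = 0"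
      then have "\<forall>b. (\<Sum>w\<in>W. c w * \<omega> (b @ w)) = 0" using c1 by simp
      then have "\<forall>w\<in>W. c w = 0" using W(1) unfolding ind_def by blast
      then show False using c(2) \<open>c v = 0\<close> by blast
    qed
    then have "\<omega> (b @ v) = - (\<Sum>w\<in>W. c w * \<omega> (b @ w)) / c v" for b
      using c1[of b] by (simp add: field_simps eq_neg_iff_add_eq_0)
    then have "\<omega> (b @ v) = (\<Sum>w\<in>W. (- c w / c v) * \<omega> (b @ w))" for b
      by (simp add: sum_divide_distrib sum_negf)
    then show ?thesis by (intro exI[of _ "\<lambda>w. - c w / c v"]) simp
  qed
  then obtain a where a: "\<And>v b. \<omega> (b @ v) = (\<Sum>w\<in>W. a v w * \<omega> (b @ w))" by metis
  obtain ws where ws: "set ws = W" "distinct ws" using finite_distinct_list[OF finW] by blast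
  have bij: "bij_betw ((!) ws) {..<length ws} W"
    using bij_betw_nth[OF ws(2)] ws(1) by simp
  have reindex: "(\<Sum>w\<in>W. f w) = (\<Sum>j<length ws. f (ws ! j))" for f :: "gen list \<Rightarrow> complex"
    using sum.reindex_bij_betw[OF bij, of f] by simp
  interpret finite_vacuum q Q \<mu> u \<omega> ws "\<lambda>v j. a v (ws ! j)"
  proof (unfold_locales, goal_cases)
    case (5 v b)
    show ?case using a[of b v] unfolding reindex .
  next
    case (6 x j)
    \<comment> \<open>Coefficients indexed by positions in \<open>ws\<close> are transported to
      words, where the independence of \<open>W\<close> is stated.\<close>
    define c where "c w = x (the_inv_into {..<length ws} ((!) ws) w)" for w
    have c: "c (ws ! i) = x i" if "i < length ws" for i
      unfolding c_def using the_inv_into_f_f[OF bij_betw_imp_inj_on[OF bij], of i] that by simp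
    have "(\<Sum>w\<in>W. c w * \<omega> (b @ w)) = 0" for b
      using 6(1)[of b] unfolding reindex by (simp add: c)
    then have "\<forall>w\<in>W. c w = 0" using W(1) unfolding ind_def by blast
    moreover have "ws ! j \<in> W" using nth_mem[OF 6(2)] ws(1) by simp
    ultimately show ?case using c[OF 6(2)] by auto
  qed (rule assms(1-4))+
  show ?thesis using gns_is_L by blast
qed

section \<open>Highest weight vectors in finite dimensional modules\<close>

text \<open>Applying \<open>A\<close> to a vanishing combination and subtracting
  \<open>\<kappa> k\<close> times it eliminates the last vector; the remaining coefficients are
  multiplied by nonzero differences of eigenvalues.\<close>

lemma distinct_eigenvectors_bound:
  fixes A :: "complex mat"
  assumes A: "A \<in> carrier_mat n n"
    and x: "\<And>i. i < m \<Longrightarrow> x i \<in> carrier_vec n" "\<And>i. i < m \<Longrightarrow> x i \<noteq> 0\<^sub>v n"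
      "\<And>i. i < m \<Longrightarrow> A *\<^sub>v x i = \<kappa> i \<cdot>\<^sub>v x i"
    and inj: "inj_on \<kappa> {..<m}"
  shows "m \<le> n"
proof (rule ccontr)
  assume "\<not> m \<le> n"
  then have "finite {..<n}" "finite {..<m}" "card {..<n} < card {..<m}" by simp_all
  from linear_dependence[OF this, of "\<lambda>i j. x i $ j"] obtain c
    where c: "\<exists>i<m. c i \<noteq> 0" "\<And>j. j < n \<Longrightarrow> (\<Sum>i<m. c i * x i $ j) = 0" by auto
  have "\<forall>i<k. c i = 0" if "k \<le> m" "\<And>j. j < n \<Longrightarrow> (\<Sum>i<k. c i * x i $ j) = 0" for k c
    using that
  proof (induction k arbitrary: c)
    case (Suc k)
    have e: "(\<Sum>t<n. A $$ (j, t) * x i $ t) = \<kappa> i * x i $ j" if "j < n" "i < m" for i j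
    proof -
      have "(A *\<^sub>v x i) $ j = (\<Sum>t<n. A $$ (j, t) * x i $ t)"
        using that x(1)[of i] A by (simp add: scalar_prod_def atLeast0LessThan)
      then show ?thesis using that x(1)[of i] unfolding x(3)[OF that(2)] by simp
    qed
    have "(\<Sum>i<k. (c i * (\<kappa> i - \<kappa> k)) * x i $ j) = 0" if j: "j < n" for j
    proof -
      have "0 = (\<Sum>t<n. A $$ (j, t) * (\<Sum>i<Suc k. c i * x i $ t))" using Suc.prems(2) by simp
      also have "\<dots> = (\<Sum>i<Suc k. c i * (\<Sum>t<n. A $$ (j, t) * x i $ t))"
        unfolding sum_distrib_left by (subst sum.swap) (simp add: mult.left_commute)
      also have "\<dots> = (\<Sum>i<Suc k. c i * (\<kappa> i * x i $ j))"
        using e[OF j] Suc.prems(1) by (intro sum.cong) auto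
      finally have "(\<Sum>i<Suc k. c i * (\<kappa> i * x i $ j)) - \<kappa> k * (\<Sum>i<Suc k. c i * x i $ j) = 0"
        using Suc.prems(2)[OF j] by simp
      moreover have "(\<Sum>i<Suc k. c i * (\<kappa> i * x i $ j)) - \<kappa> k * (\<Sum>i<Suc k. c i * x i $ j) =
        (\<Sum>i<Suc k. (c i * (\<kappa> i - \<kappa> k)) * x i $ j)"
        unfolding sum_distrib_left sum_subtractf[symmetric] by (intro sum.cong) (auto simp: algebra_simps)
      ultimately show ?thesis by simp
    qed
    from Suc.IH[OF _ this] Suc.prems(1) have z: "\<forall>i<k. c i * (\<kappa> i - \<kappa> k) = 0" by simp
    have ck: "c i = 0" if "i < k" for i
    proof -
      have "\<kappa> i \<noteq> \<kappa> k" using inj_onD[OF inj, of i k] that Suc.prems(1) by auto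
      then show ?thesis using z that by auto
    qed
    have "c k * x k $ j = 0" if "j < n" for j using Suc.prems(2)[OF that] ck by simp
    moreover obtain j where "j < n" "x k $ j \<noteq> 0"
    proof (rule ccontr)
      assume "\<not> thesis"
      then have "x k = 0\<^sub>v n" using that x(1)[of k] Suc.prems(1) by (intro eq_vecI) auto
      then show False using x(2)[of k] Suc.prems(1) by simp
    qed
    ultimately have "c k = 0" by auto
    then show ?case using ck by (auto simp: less_Suc_eq)
  qed simp
  from this[of m c] c show False by blast
qed

section \<open>Joint eigenvectors of commuting matrices\<close>

lemma complex_poly_root:
  fixes p :: "complex poly"
  assumes "degree p > 0"
  obtains a r where "p = [:-a, 1:] * r"
proof -
  obtain a where "poly p a = 0" using alg_closed_imp_poly_has_root[OF assms] by blast
  then have "[:-a, 1:] dvd p" by (simp add: poly_eq_0_iff_dvd)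
  then show thesis using that unfolding dvd_def by blast
qed

text \<open>With \<open>s i\<close> a coordinate of A^i y, this says that p(A) y = r(A) (A - a) y
  for p = (x - a) r.\<close>

lemma sum_linear_factor:
  fixes r :: "complex poly"
  assumes "degree r \<le> m"
  shows "(\<Sum>i\<le>Suc m. coeff ([:-a, 1:] * r) i * s i) = (\<Sum>i\<le>m. coeff r i * (s (Suc i) - a * s i))"
proof -
  have c: "coeff ([:-a, 1:] * r) 0 = - a * coeff r 0"
    "coeff ([:-a, 1:] * r) (Suc i) = coeff r i - a * coeff r (Suc i)" for i by simp_all
  have z: "coeff r (Suc m) = 0" using assms by (intro coeff_eq_0) simp
  have "(\<Sum>i\<le>m. coeff r i * s i) = (\<Sum>i\<le>Suc m. coeff r i * s i)" using z by simp
  also have "\<dots> = coeff r 0 * s 0 + (\<Sum>i\<le>m. coeff r (Suc i) * s (Suc i))"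
    by (rule sum.atMost_Suc_shift)
  finally have e: "(\<Sum>i\<le>m. coeff r i * s i) = coeff r 0 * s 0 + (\<Sum>i\<le>m. coeff r (Suc i) * s (Suc i))" .
  have "(\<Sum>i\<le>Suc m. coeff ([:-a, 1:] * r) i * s i) =
      - a * coeff r 0 * s 0 + (\<Sum>i\<le>m. (coeff r i - a * coeff r (Suc i)) * s (Suc i))"
    unfolding sum.atMost_Suc_shift c ..
  also have "\<dots> = (\<Sum>i\<le>m. coeff r i * s (Suc i)) - a * (coeff r 0 * s 0 + (\<Sum>i\<le>m. coeff r (Suc i) * s (Suc i)))"
    by (simp add: left_diff_distrib sum_subtractf sum_distrib_left mult.assoc distrib_left)
  also have "\<dots> = (\<Sum>i\<le>m. coeff r i * (s (Suc i) - a * s i))"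
    unfolding e[symmetric] by (simp add: right_diff_distrib sum_subtractf sum_distrib_left mult.left_commute)
  finally show ?thesis .
qed

definition vec_subspace :: "nat \<Rightarrow> complex vec set \<Rightarrow> bool" where
  "vec_subspace n W \<longleftrightarrow> W \<subseteq> carrier_vec n \<and> 0\<^sub>v n \<in> W \<and> (\<forall>v\<in>W. \<forall>w\<in>W. v + w \<in> W) \<and> (\<forall>a. \<forall>v\<in>W. a \<cdot>\<^sub>v v \<in> W)"

lemma vec_subspaceD:
  assumes "vec_subspace n W"
  shows "W \<subseteq> carrier_vec n" "0\<^sub>v n \<in> W" "\<And>v w. v \<in> W \<Longrightarrow> w \<in> W \<Longrightarrow> v + w \<in> W" "\<And>a v. v \<in> W \<Longrightarrow> a \<cdot>\<^sub>v v \<in> W"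
  using assms unfolding vec_subspace_def by auto

text \<open>Split off a root \<open>a\<close> of \<open>p\<close> and pass to z = (A - a) y: either
  z vanishes and \<open>y\<close> is an eigenvector, or z is a nonzero vector of \<open>W\<close>
  annihilated by a polynomial of smaller degree.\<close>

lemma eigenvector_of_annihilator:
  fixes A :: "complex mat"
  assumes A: "A \<in> carrier_mat n n" and W: "vec_subspace n W" and inv: "\<And>x. x \<in> W \<Longrightarrow> A *\<^sub>v x \<in> W"
  shows "p \<noteq> 0 \<Longrightarrow> degree p \<le> m \<Longrightarrow> y \<in> W \<Longrightarrow> y \<noteq> 0\<^sub>v n \<Longrightarrow>
    (\<And>j. j < n \<Longrightarrow> (\<Sum>i\<le>m. coeff p i * (((*\<^sub>v) A ^^ i) y) $ j) = 0) \<Longrightarrow>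
    \<exists>x\<in>W. x \<noteq> 0\<^sub>v n \<and> (\<exists>k. A *\<^sub>v x = k \<cdot>\<^sub>v x)"
proof (induction m arbitrary: p y)
  case 0
  have "coeff p 0 \<noteq> 0" using 0 by (metis leading_coeff_neq_0 le_zero_eq)
  then have "y $ j = 0" if "j < n" for j using 0(5)[OF that] by simp
  moreover have "y \<in> carrier_vec n" using 0(3) vec_subspaceD(1)[OF W] by blast
  ultimately have "y = 0\<^sub>v n" by (intro eq_vecI) auto
  then show ?case using 0(4) by simp
next
  case (Suc m)
  have yc: "y \<in> carrier_vec n" using Suc.prems(3) vec_subspaceD(1)[OF W] by blast
  show ?case
  proof (cases "degree p = 0")
    case True
    have "coeff p 0 \<noteq> 0" using Suc.prems(1) True by (metis leading_coeff_neq_0)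
    moreover have "coeff p i = 0" if "i > 0" for i using True that by (intro coeff_eq_0) simp
    ultimately have "y $ j = 0" if "j < n" for j
      using Suc.prems(5)[OF that] unfolding sum.atMost_Suc_shift by simp
    then have "y = 0\<^sub>v n" using yc by (intro eq_vecI) auto
    then show ?thesis using Suc.prems(4) by simp
  next
    case False
    then obtain a r where r: "p = [:-a, 1:] * r" using complex_poly_root[of p] by auto
    have r0: "r \<noteq> 0" using Suc.prems(1) r by auto
    have "degree p = Suc (degree r)" unfolding r using r0 by (subst degree_mult_eq) auto
    then have dr: "degree r \<le> m" using Suc.prems(2) by simp
    define z where "z = A *\<^sub>v y + (-a) \<cdot>\<^sub>v y"
    have z: "z \<in> W" unfolding z_def using vec_subspaceD(3,4)[OF W] inv Suc.prems(3) by blast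
    have powc: "((*\<^sub>v) A ^^ i) x \<in> carrier_vec n" if "x \<in> carrier_vec n" for i x
    proof (induction i)
      case (Suc i)
      show ?case using mult_mat_vec_carrier[OF A Suc] by simp
    qed (use that in simp)
    have zp: "((*\<^sub>v) A ^^ i) z = ((*\<^sub>v) A ^^ Suc i) y + (-a) \<cdot>\<^sub>v ((*\<^sub>v) A ^^ i) y" for i
    proof (induction i)
      case (Suc i)
      have "((*\<^sub>v) A ^^ Suc i) z = A *\<^sub>v (((*\<^sub>v) A ^^ Suc i) y + (-a) \<cdot>\<^sub>v ((*\<^sub>v) A ^^ i) y)"
        using Suc by simp
      also have "\<dots> = A *\<^sub>v ((*\<^sub>v) A ^^ Suc i) y + A *\<^sub>v ((-a) \<cdot>\<^sub>v ((*\<^sub>v) A ^^ i) y)"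
        by (rule mult_add_distrib_mat_vec[OF A]) (use powc[OF yc, of i] powc[OF yc, of "Suc i"] in auto)
      also have "A *\<^sub>v ((-a) \<cdot>\<^sub>v ((*\<^sub>v) A ^^ i) y) = (-a) \<cdot>\<^sub>v (A *\<^sub>v ((*\<^sub>v) A ^^ i) y)"
        by (rule mult_mat_vec[OF A powc[OF yc]])
      finally show ?case by simp
    qed (simp add: z_def)
    show ?thesis
    proof (cases "z = 0\<^sub>v n")
      case True
      have "(A *\<^sub>v y) $ j = a * y $ j" if "j < n" for j
        using arg_cong[OF True, of "\<lambda>x. x $ j"] that A yc unfolding z_def by simp
      then have "A *\<^sub>v y = a \<cdot>\<^sub>v y" using A yc by (intro eq_vecI) auto
      then show ?thesis using Suc.prems(3,4) by blast
    next
      case False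
      have "(\<Sum>i\<le>m. coeff r i * (((*\<^sub>v) A ^^ i) z) $ j) = 0" if j: "j < n" for j
      proof -
        have "(((*\<^sub>v) A ^^ i) z) $ j = (((*\<^sub>v) A ^^ Suc i) y) $ j - a * (((*\<^sub>v) A ^^ i) y) $ j" for i
          unfolding zp using powc[OF yc, of i] powc[OF yc, of "Suc i"] j by auto
        then have "(\<Sum>i\<le>m. coeff r i * (((*\<^sub>v) A ^^ i) z) $ j) =
          (\<Sum>i\<le>Suc m. coeff ([:-a, 1:] * r) i * (((*\<^sub>v) A ^^ i) y) $ j)"
          by (simp only: sum_linear_factor[OF dr])
        then show ?thesis using Suc.prems(5)[OF j] unfolding r by simp
      qed
      from Suc.IH[OF r0 dr z False this] show ?thesis by blast
    qed
  qed
qed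

text \<open>The n + 1 vectors y, ..., A^n y are dependent, which supplies the annihilating
  polynomial.\<close>

lemma eigenvector_in_subspace:
  fixes A :: "complex mat"
  assumes A: "A \<in> carrier_mat n n" and W: "vec_subspace n W" and inv: "\<And>x. x \<in> W \<Longrightarrow> A *\<^sub>v x \<in> W"
    and y: "y \<in> W" "y \<noteq> 0\<^sub>v n"
  shows "\<exists>x\<in>W. x \<noteq> 0\<^sub>v n \<and> (\<exists>k. A *\<^sub>v x = k \<cdot>\<^sub>v x)"
proof -
  have "finite {..<n}" "finite {..n}" "card {..<n} < card {..n}" by simp_all
  from linear_dependence[OF this, of "\<lambda>i j. (((*\<^sub>v) A ^^ i) y) $ j"] obtain c
    where c: "\<exists>i\<le>n. c i \<noteq> 0" "\<And>j. j < n \<Longrightarrow> (\<Sum>i\<le>n. c i * (((*\<^sub>v) A ^^ i) y) $ j) = 0" by auto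
  define p where "p = (\<Sum>i\<le>n. monom (c i) i)"
  have cp: "coeff p i = (if i \<le> n then c i else 0)" for i
    unfolding p_def by (simp add: coeff_sum if_distrib cong: if_cong)
  have "p \<noteq> 0" using c(1) cp by (metis coeff_0)
  moreover have "degree p \<le> n" by (rule degree_le) (simp add: cp)
  moreover have "(\<Sum>i\<le>n. coeff p i * (((*\<^sub>v) A ^^ i) y) $ j) = 0" if "j < n" for j
    using c(2)[OF that] by (simp add: cp)
  ultimately show ?thesis using eigenvector_of_annihilator[OF A W inv _ _ y, of p n] by simp
qed

text \<open>Members are indexed, so that a repetition counts as a dependence; an upper bound on the
  possible \<open>m\<close> serves as a bound on the dimension of \<open>W\<close>.\<close>

definition indep_family :: "nat \<Rightarrow> complex vec set \<Rightarrow> nat \<Rightarrow> (nat \<Rightarrow> complex vec) \<Rightarrow> bool" where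
  "indep_family n W m x \<longleftrightarrow> (\<forall>i<m. x i \<in> W) \<and>
     (\<forall>c. (\<forall>j<n. (\<Sum>i<m. c i * x i $ j) = 0) \<longrightarrow> (\<forall>i<m. c i = 0))"

text \<open>The family may be infinite, so the induction is on the dimension of \<open>W\<close>. If
  \<open>y\<close> is not an eigenvector of \<open>A g\<close>, then some eigenspace of
  \<open>A g\<close> in \<open>W\<close> is nonzero, invariant because the matrices commute, and
  does not contain \<open>y\<close>. Any independent family in it extends by \<open>y\<close>, so
  its dimension is smaller.\<close>

lemma joint_eigenvector_aux:
  fixes A :: "'g \<Rightarrow> complex mat"
  assumes A: "\<And>g. A g \<in> carrier_mat n n"
    and comm: "\<And>g h x. x \<in> carrier_vec n \<Longrightarrow> A g *\<^sub>v (A h *\<^sub>v x) = A h *\<^sub>v (A g *\<^sub>v x)"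
  shows "vec_subspace n W \<Longrightarrow> (\<And>g x. x \<in> W \<Longrightarrow> A g *\<^sub>v x \<in> W) \<Longrightarrow> y \<in> W \<Longrightarrow> y \<noteq> 0\<^sub>v n \<Longrightarrow>
    (\<And>m x. indep_family n W m x \<Longrightarrow> m \<le> N) \<Longrightarrow>
    \<exists>x\<in>W. x \<noteq> 0\<^sub>v n \<and> (\<forall>g. \<exists>k. A g *\<^sub>v x = k \<cdot>\<^sub>v x)"
proof (induction N arbitrary: W y)
  case 0
  have yc: "y \<in> carrier_vec n" using 0 vec_subspaceD(1)[of n W] by blast
  obtain j where j: "j < n" "y $ j \<noteq> 0"
    using 0(4) yc by (metis eq_vecI index_zero_vec carrier_vecD)
  have "indep_family n W 1 (\<lambda>_. y)"
    unfolding indep_family_def using 0(3) j by auto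
  then show ?case using 0(5) by fastforce
next
  case (Suc N)
  note W = Suc.prems(1)
  have sub: "\<And>x. x \<in> W \<Longrightarrow> x \<in> carrier_vec n" using vec_subspaceD(1)[OF W] by blast
  show ?case
  proof (cases "\<forall>g. \<exists>k. A g *\<^sub>v y = k \<cdot>\<^sub>v y")
    case True
    then show ?thesis using Suc.prems(3,4) by blast
  next
    case False
    then obtain g where g: "\<And>k. A g *\<^sub>v y \<noteq> k \<cdot>\<^sub>v y" by blast
    obtain z k where z: "z \<in> W" "z \<noteq> 0\<^sub>v n" "A g *\<^sub>v z = k \<cdot>\<^sub>v z"
      using eigenvector_in_subspace[OF A W Suc.prems(2) Suc.prems(3,4), of g] by blast
    define E where "E = {x \<in> W. A g *\<^sub>v x = k \<cdot>\<^sub>v x}"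
    have E: "vec_subspace n E"
      unfolding vec_subspace_def
    proof (intro conjI ballI allI)
      show "E \<subseteq> carrier_vec n" using sub unfolding E_def by blast
      have "A g *\<^sub>v 0\<^sub>v n = k \<cdot>\<^sub>v 0\<^sub>v n" using A[of g] by (intro eq_vecI) auto
      then show "0\<^sub>v n \<in> E" unfolding E_def using vec_subspaceD(2)[OF W] by simp
      fix v w assume vw: "v \<in> E" "w \<in> E"
      then have c: "v \<in> carrier_vec n" "w \<in> carrier_vec n" using sub unfolding E_def by auto
      have "A g *\<^sub>v (v + w) = k \<cdot>\<^sub>v (v + w)"
        using vw unfolding mult_add_distrib_mat_vec[OF A c] E_def smult_add_distrib_vec[OF c] by simp
      then show "v + w \<in> E" using vw vec_subspaceD(3)[OF W] unfolding E_def by simp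
    next
      fix a v assume v: "v \<in> E"
      then have c: "v \<in> carrier_vec n" using sub unfolding E_def by auto
      have "A g *\<^sub>v (a \<cdot>\<^sub>v v) = k \<cdot>\<^sub>v (a \<cdot>\<^sub>v v)"
        using v unfolding mult_mat_vec[OF A c] E_def by (simp add: smult_smult_assoc mult.commute)
      then show "a \<cdot>\<^sub>v v \<in> E" using v vec_subspaceD(4)[OF W] unfolding E_def by simp
    qed
    have inv: "A h *\<^sub>v x \<in> E" if "x \<in> E" for h x
    proof -
      have x: "x \<in> W" "x \<in> carrier_vec n" "A g *\<^sub>v x = k \<cdot>\<^sub>v x" using that sub unfolding E_def by auto
      have "A g *\<^sub>v (A h *\<^sub>v x) = k \<cdot>\<^sub>v (A h *\<^sub>v x)"
        unfolding comm[OF x(2), of g h] x(3) by (rule mult_mat_vec[OF A x(2)])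
      then show ?thesis using Suc.prems(2)[OF x(1)] unfolding E_def by simp
    qed
    have zE: "z \<in> E" using z unfolding E_def by simp
    have yc: "y \<in> carrier_vec n" using sub Suc.prems(3) .
    have "\<exists>j<n. (A g *\<^sub>v y) $ j \<noteq> k * y $ j"
    proof (rule ccontr)
      assume "\<not> ?thesis"
      then have "A g *\<^sub>v y = k \<cdot>\<^sub>v y" using A[of g] yc by (intro eq_vecI) auto
      then show False using g by blast
    qed
    then obtain j where j: "j < n" "(A g *\<^sub>v y) $ j \<noteq> k * y $ j" by blast
    \<comment> \<open>A linear form that vanishes on the eigenspace \<open>E\<close> but not at
      \<open>y\<close>: row \<open>j\<close> of \<open>A g\<close> minus k times the
      identity.\<close>
    define l where "l t = A g $$ (j, t) - (if t = j then k else 0)" for t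
    have l: "(\<Sum>t<n. l t * x $ t) = (A g *\<^sub>v x) $ j - k * x $ j" if "x \<in> carrier_vec n" for x
    proof -
      have "(A g *\<^sub>v x) $ j = (\<Sum>t<n. A g $$ (j, t) * x $ t)"
        using that j A[of g] by (simp add: scalar_prod_def atLeast0LessThan)
      moreover have "(\<Sum>t<n. (if t = j then k else 0) * x $ t) = k * x $ j"
        using j(1) by (simp add: if_distrib[of "\<lambda>y. y * _"] cong: if_cong)
      ultimately show ?thesis unfolding l_def by (simp add: left_diff_distrib sum_subtractf)
    qed
    have bound: "m \<le> N" if m: "indep_family n E m x" for m x
    proof -
      let ?x = "x(m := y)"
      have "indep_family n W (Suc m) ?x"
        unfolding indep_family_def
      proof (intro conjI allI impI)
        fix i assume "i < Suc m"
        then show "?x i \<in> W" using m Suc.prems(3) unfolding indep_family_def E_def by (auto simp: less_Suc_eq)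
      next
        fix c i assume c: "\<forall>t<n. (\<Sum>i<Suc m. c i * ?x i $ t) = 0" and i: "i < Suc m"
        have c': "(\<Sum>i<m. c i * x i $ t) + c m * y $ t = 0" if "t < n" for t
          using c that by simp
        have xl: "(\<Sum>t<n. l t * x i $ t) = 0" if "i < m" for i
        proof -
          have "x i \<in> E" using m that unfolding indep_family_def by blast
          then have "x i \<in> carrier_vec n" "A g *\<^sub>v x i = k \<cdot>\<^sub>v x i" using sub unfolding E_def by auto
          then show ?thesis using l[of "x i"] j(1) by simp
        qed
        have "0 = (\<Sum>t<n. l t * ((\<Sum>i<m. c i * x i $ t) + c m * y $ t))" using c' by simp
        also have "\<dots> = (\<Sum>i<m. c i * (\<Sum>t<n. l t * x i $ t)) + c m * (\<Sum>t<n. l t * y $ t)"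
          unfolding distrib_left sum.distrib sum_distrib_left
          by (subst sum.swap) (simp add: mult.left_commute)
        also have "\<dots> = c m * ((A g *\<^sub>v y) $ j - k * y $ j)" using xl l[OF yc] by simp
        finally have cm: "c m = 0" using j(2) by simp
        then have "\<forall>t<n. (\<Sum>i<m. c i * x i $ t) = 0" using c' by simp
        then have "\<forall>i<m. c i = 0" using m unfolding indep_family_def by blast
        then show "c i = 0" using cm i by (auto simp: less_Suc_eq)
      qed
      then show ?thesis using Suc.prems(5) by fastforce
    qed
    have "\<exists>x\<in>E. x \<noteq> 0\<^sub>v n \<and> (\<forall>g. \<exists>k. A g *\<^sub>v x = k \<cdot>\<^sub>v x)"
    proof (rule Suc.IH[OF E _ zE z(2)])
      show "A h *\<^sub>v x \<in> E" if "x \<in> E" for h x using that by (rule inv)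
      show "m \<le> N" if "indep_family n E m x" for m x using that by (rule bound)
    qed
    then show ?thesis unfolding E_def by blast
  qed
qed

lemma joint_eigenvector:
  fixes A :: "'g \<Rightarrow> complex mat"
  assumes A: "\<And>g. A g \<in> carrier_mat n n"
    and comm: "\<And>g h x. x \<in> carrier_vec n \<Longrightarrow> A g *\<^sub>v (A h *\<^sub>v x) = A h *\<^sub>v (A g *\<^sub>v x)"
    and W: "vec_subspace n W" "\<And>g x. x \<in> W \<Longrightarrow> A g *\<^sub>v x \<in> W" "y \<in> W" "y \<noteq> 0\<^sub>v n"
  obtains x where "x \<in> W" "x \<noteq> 0\<^sub>v n" "\<And>g. \<exists>k. A g *\<^sub>v x = k \<cdot>\<^sub>v x"
proof -
  have bound: "m \<le> n" if "indep_family n W m x" for m x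
  proof (rule ccontr)
    assume "\<not> m \<le> n"
    then have "finite {..<n}" "finite {..<m}" "card {..<n} < card {..<m}" by simp_all
    from linear_dependence[OF this, of "\<lambda>i j. x i $ j"] that show False
      unfolding indep_family_def by auto
  qed
  have "\<exists>x\<in>W. x \<noteq> 0\<^sub>v n \<and> (\<forall>g. \<exists>k. A g *\<^sub>v x = k \<cdot>\<^sub>v x)"
  proof (rule joint_eigenvector_aux[where A = A and n = n, OF A _ W(1) _ W(3,4)])
    show "A g *\<^sub>v (A h *\<^sub>v x) = A h *\<^sub>v (A g *\<^sub>v x)" if "x \<in> carrier_vec n" for g h x
      using that by (rule comm)
    show "A g *\<^sub>v x \<in> W" if "x \<in> W" for g x using that by (rule W(2))
    show "m \<le> n" if "indep_family n W m x" for m x using that by (rule bound)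
  qed
  then show thesis using that by blast
qed

section \<open>Words acting on a matrix module\<close>

fun gmat :: "umod \<Rightarrow> gen \<Rightarrow> complex mat" where
  "gmat M (GP t) = Xp M t"
| "gmat M (GM t) = Xm M t"
| "gmat M (GJ t) = J M t"
| "gmat M GK = Kp M"
| "gmat M GL = Km M"

fun wact :: "umod \<Rightarrow> gen list \<Rightarrow> complex vec \<Rightarrow> complex vec" where
  "wact M [] x = x"
| "wact M (g # w) x = gmat M g *\<^sub>v wact M w x"

lemma wact_append: "wact M (a @ b) x = wact M a (wact M b x)"
  by (induction a) auto

fun kproj_vec :: "complex \<Rightarrow> complex \<Rightarrow> umod \<Rightarrow> nat \<Rightarrow> complex vec \<Rightarrow> complex vec" where
  "kproj_vec q \<mu> M 0 x = x"
| "kproj_vec q \<mu> M (Suc R) x = Kp M *\<^sub>v kproj_vec q \<mu> M R x + (- (\<mu> * (inverse q^2) ^ Suc R)) \<cdot>\<^sub>v kproj_vec q \<mu> M R x"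

inductive_set word_span :: "umod \<Rightarrow> complex vec \<Rightarrow> complex vec set" for M v where
  zero: "0\<^sub>v (dim M) \<in> word_span M v"
| word: "wact M w v \<in> word_span M v"
| add: "x \<in> word_span M v \<Longrightarrow> y \<in> word_span M v \<Longrightarrow> x + y \<in> word_span M v"
| smult: "x \<in> word_span M v \<Longrightarrow> c \<cdot>\<^sub>v x \<in> word_span M v"

locale umodule =
  fixes q Q :: complex and M :: umod
  assumes um: "is_umod q Q M" and q0: "q \<noteq> 0" and nroot: "\<not> root_of_unity q"
begin

abbreviation "n \<equiv> dim M"

lemma gmat_carrier [simp]: "gmat M g \<in> carrier_mat n n"
  using um unfolding is_umod_def Let_def by (cases g) auto

lemma carriers [simp]:
  "Xp M t \<in> carrier_mat n n" "Xm M t \<in> carrier_mat n n" "J M t \<in> carrier_mat n n"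
  "Kp M \<in> carrier_mat n n" "Km M \<in> carrier_mat n n"
  using gmat_carrier[of "GP t"] gmat_carrier[of "GM t"] gmat_carrier[of "GJ t"] gmat_carrier[of GK]
    gmat_carrier[of GL] by simp_all

lemma mult_carrier [simp]:
  "A \<in> carrier_mat n n \<Longrightarrow> x \<in> carrier_vec n \<Longrightarrow> (A :: complex mat) *\<^sub>v x \<in> carrier_vec n"
  by (rule mult_mat_vec_carrier)

lemma square_carrier [simp]:
  "A \<in> carrier_mat n n \<Longrightarrow> B \<in> carrier_mat n n \<Longrightarrow> (A :: complex mat) * B \<in> carrier_mat n n"
  "B \<in> carrier_mat n n \<Longrightarrow> (A :: complex mat) - B \<in> carrier_mat n n"
  by auto

lemma wact_carrier [simp]: "x \<in> carrier_vec n \<Longrightarrow> wact M w x \<in> carrier_vec n"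
  by (induction w) auto

lemma wact_add: "x \<in> carrier_vec n \<Longrightarrow> y \<in> carrier_vec n \<Longrightarrow> wact M w (x + y) = wact M w x + wact M w y"
  by (induction w) (auto simp: mult_add_distrib_mat_vec[OF gmat_carrier])

lemma wact_smult: "x \<in> carrier_vec n \<Longrightarrow> wact M w (c \<cdot>\<^sub>v x) = c \<cdot>\<^sub>v wact M w x"
  by (induction w) (auto simp: mult_mat_vec[OF gmat_carrier])

lemma smult_zero_vec': "0 \<cdot>\<^sub>v x = 0\<^sub>v n" if "x \<in> carrier_vec n" for x :: "complex vec"
  using that by (intro eq_vecI) auto

lemma wact_zero: "wact M w (0\<^sub>v n) = 0\<^sub>v n"
  using wact_smult[of "0\<^sub>v n" w 0] by (simp add: smult_zero_vec')

lemma index_mult: "A \<in> carrier_mat n n \<Longrightarrow> B \<in> carrier_mat n n \<Longrightarrow> x \<in> carrier_vec n \<Longrightarrow>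
    ((A * B) *\<^sub>v x) $ i = (A *\<^sub>v (B *\<^sub>v x)) $ i" for A B :: "complex mat"
  by (simp add: assoc_mult_mat_vec)

lemma index_minus: "A \<in> carrier_mat n n \<Longrightarrow> B \<in> carrier_mat n n \<Longrightarrow> x \<in> carrier_vec n \<Longrightarrow> i < n \<Longrightarrow>
    ((A - B) *\<^sub>v x) $ i = (A *\<^sub>v x) $ i - (B *\<^sub>v x) $ i" for A B :: "complex mat"
  by (simp add: minus_mult_distrib_mat_vec del: index_mult_mat_vec)

lemma index_smult: "A \<in> carrier_mat n n \<Longrightarrow> x \<in> carrier_vec n \<Longrightarrow> i < n \<Longrightarrow>
    ((c \<cdot>\<^sub>m A) *\<^sub>v x) $ i = c * (A *\<^sub>v x) $ i" for A :: "complex mat"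
  by (simp add: smult_mat_vec del: index_mult_mat_vec)

lemmas index_simps = index_minus index_smult index_mult

lemma wact_defrel:
  assumes "defrel q Q r" and x: "x \<in> carrier_vec n" and i: "i < n"
  shows "word_sum (\<lambda>w. wact M w x $ i) r = 0"
proof -
  have key: "(A *\<^sub>v x) $ i - (B *\<^sub>v x) $ i = 0" if "A = B" for A B :: "complex mat"
    using that by simp
  note u = um[unfolded is_umod_def Let_def]
  show ?thesis using assms(1)
  proof cases
    case (KJ t)
    have "Kp M * J M t = J M t * Kp M" using u by blast
    from key[OF this] show ?thesis using x i
      by (simp add: KJ index_simps algebra_simps del: index_mult_mat_vec assoc_mult_mat_vec)
  next
    case (JJ s t)
    have "J M s * J M t = J M t * J M s" using u by blast
    from key[OF this] show ?thesis using x i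
      by (simp add: JJ index_simps algebra_simps del: index_mult_mat_vec assoc_mult_mat_vec)
  next
    case KL
    have "Kp M * Km M = 1\<^sub>m n" using u by blast
    from key[OF this] show ?thesis using x i
      by (simp add: KL index_simps algebra_simps del: index_mult_mat_vec assoc_mult_mat_vec)
  next
    case LK
    have "Km M * Kp M = 1\<^sub>m n" using u by blast
    from key[OF this] show ?thesis using x i
      by (simp add: LK index_simps algebra_simps del: index_mult_mat_vec assoc_mult_mat_vec)
  next
    case LL
    have "Km M * Km M = 1\<^sub>m n - (q - inverse q) \<cdot>\<^sub>m J M 0" using u by blast
    from key[OF this] show ?thesis using x i
      by (simp add: LL index_simps algebra_simps del: index_mult_mat_vec assoc_mult_mat_vec)
  next
    case (PP t s)
    have "Xp M (t+1) * Xp M s - (q^2) \<cdot>\<^sub>m (Xp M s * Xp M (t+1))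
            = (q^2) \<cdot>\<^sub>m (Xp M t * Xp M (s+1)) - Xp M (s+1) * Xp M t" using u by blast
    from key[OF this] show ?thesis using x i
      by (simp add: PP index_simps algebra_simps del: index_mult_mat_vec assoc_mult_mat_vec)
  next
    case (MM t s)
    have "Xm M (t+1) * Xm M s - (inverse q^2) \<cdot>\<^sub>m (Xm M s * Xm M (t+1))
            = (inverse q^2) \<cdot>\<^sub>m (Xm M t * Xm M (s+1)) - Xm M (s+1) * Xm M t" using u by blast
    from key[OF this] show ?thesis using x i
      by (simp add: MM index_simps algebra_simps del: index_mult_mat_vec assoc_mult_mat_vec)
  next
    case (KP t)
    have "Kp M * Xp M t * Km M = (q^2) \<cdot>\<^sub>m Xp M t" using u by blast
    from key[OF this] show ?thesis using x i
      by (simp add: KP index_simps algebra_simps del: index_mult_mat_vec assoc_mult_mat_vec)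
  next
    case (KM t)
    have "Kp M * Xm M t * Km M = (inverse q^2) \<cdot>\<^sub>m Xm M t" using u by blast
    from key[OF this] show ?thesis using x i
      by (simp add: KM index_simps algebra_simps del: index_mult_mat_vec assoc_mult_mat_vec)
  next
    case (J0P t)
    have "(q^2) \<cdot>\<^sub>m (J M 0 * Xp M t) - (inverse q^2) \<cdot>\<^sub>m (Xp M t * J M 0)
            = qint q 2 \<cdot>\<^sub>m Xp M t" using u by blast
    from key[OF this] show ?thesis using x i
      by (simp add: J0P index_simps algebra_simps del: index_mult_mat_vec assoc_mult_mat_vec)
  next
    case (J0M t)
    have "(inverse q^2) \<cdot>\<^sub>m (J M 0 * Xm M t) - (q^2) \<cdot>\<^sub>m (Xm M t * J M 0)
            = (- qint q 2) \<cdot>\<^sub>m Xm M t" using u by blast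
    from key[OF this] show ?thesis using x i
      by (simp add: J0M index_simps algebra_simps del: index_mult_mat_vec assoc_mult_mat_vec)
  next
    case (JP s t)
    have "comm (J M (s+1)) (Xp M t)
            = (q^2) \<cdot>\<^sub>m (J M s * Xp M (t+1)) - (inverse q^2) \<cdot>\<^sub>m (Xp M (t+1) * J M s)" using u by blast
    from key[OF this[unfolded comm_def]] show ?thesis using x i
      by (simp add: JP index_simps algebra_simps del: index_mult_mat_vec assoc_mult_mat_vec)
  next
    case (JM s t)
    have "comm (J M (s+1)) (Xm M t)
            = (inverse q^2) \<cdot>\<^sub>m (J M s * Xm M (t+1)) - (q^2) \<cdot>\<^sub>m (Xm M (t+1) * J M s)" using u by blast
    from key[OF this[unfolded comm_def]] show ?thesis using x i
      by (simp add: JM index_simps algebra_simps del: index_mult_mat_vec assoc_mult_mat_vec)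
  next
    case (PM t s)
    have e: "comm (Xp M t) (Xm M s) = Kp M * (J M (s+t) - Q \<cdot>\<^sub>m J M (s+t+1))" using u by blast
    have "Kp M * (J M (s+t) - Q \<cdot>\<^sub>m J M (s+t+1)) = Kp M * J M (s+t) - Q \<cdot>\<^sub>m (Kp M * J M (s+t+1))"
      by (subst mult_minus_distrib_mat[of _ n n _ n]) (auto simp: mult_smult_distrib[of _ n n _ n])
    from key[OF trans[OF e[unfolded comm_def] this]] show ?thesis using x i
      by (simp add: PM index_simps algebra_simps del: index_mult_mat_vec assoc_mult_mat_vec)
  qed
qed

text \<open>Lets a left context be pulled out of a relation: a coordinate of its action is a fixed
  linear form in the vector it acts on.\<close>

lemma wact_linear_functional:
  assumes "i < n"
  obtains a where "\<And>x. x \<in> carrier_vec n \<Longrightarrow> wact M w x $ i = (\<Sum>j<n. a j * x $ j)"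
proof -
  have "\<exists>P\<in>carrier_mat n n. \<forall>x\<in>carrier_vec n. wact M w x = P *\<^sub>v x"
  proof (induction w)
    case Nil
    show ?case by (intro bexI[of _ "1\<^sub>m n"]) auto
  next
    case (Cons g w)
    then obtain P where P: "P \<in> carrier_mat n n" "\<forall>x\<in>carrier_vec n. wact M w x = P *\<^sub>v x" ..
    have "wact M (g # w) x = (gmat M g * P) *\<^sub>v x" if "x \<in> carrier_vec n" for x
      using assoc_mult_mat_vec[OF gmat_carrier P(1) that] bspec[OF P(2) that] by simp
    then show ?case using P(1) by (intro bexI[of _ "gmat M g * P"]) simp_all
  qed
  then obtain P where P: "P \<in> carrier_mat n n" "\<forall>x\<in>carrier_vec n. wact M w x = P *\<^sub>v x" ..
  have lf: "wact M w x $ i = (\<Sum>j<n. P $$ (i, j) * x $ j)" if "x \<in> carrier_vec n" for x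
    unfolding bspec[OF P(2) that] using P(1) that assms by (simp add: scalar_prod_def atLeast0LessThan)
  show thesis by (rule that) (rule lf)
qed

lemma wact_defrel_context:
  assumes "defrel q Q r" and x: "x \<in> carrier_vec n" and i: "i < n"
  shows "word_sum (\<lambda>w. wact M (a @ w @ b) x $ i) r = 0"
proof -
  obtain c where c: "\<And>x. x \<in> carrier_vec n \<Longrightarrow> wact M a x $ i = (\<Sum>j<n. c j * x $ j)"
    by (rule wact_linear_functional[OF i]) (rule that)
  have bx: "wact M b x \<in> carrier_vec n" using x by simp
  have e: "wact M (a @ w @ b) x $ i = (\<Sum>j<n. c j * wact M w (wact M b x) $ j)" for w
    unfolding wact_append using bx by (intro c) simp
  have "word_sum (\<lambda>w. wact M (a @ w @ b) x $ i) r = (\<Sum>j<n. c j * word_sum (\<lambda>w. wact M w (wact M b x) $ j) r)"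
    unfolding e
  proof (induction r)
    case (Cons p r)
    then show ?case by (cases p) (simp add: sum.distrib sum_distrib_left algebra_simps)
  qed simp
  then show ?thesis using wact_defrel[OF assms(1) bx] by simp
qed

lemma submodule_word_span:
  assumes v: "v \<in> carrier_vec n"
  shows "submodule M (word_span M v)"
proof -
  have sub: "x \<in> carrier_vec n" if "x \<in> word_span M v" for x
    using that v by induction auto
  have act: "gmat M g *\<^sub>v x \<in> word_span M v" if "x \<in> word_span M v" for g x
    using that
  proof induction
    case zero
    show ?case using wact_zero[of "[g]"] by (simp add: word_span.zero)
  next
    case (word w)
    show ?case using word_span.word[of M "g # w" v] by simp
  next
    case (add x y)
    then show ?case
      using sub mult_add_distrib_mat_vec[OF gmat_carrier, of x y g] by (simp add: word_span.add)
  next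
    case (smult x c)
    then show ?case
      using sub mult_mat_vec[OF gmat_carrier, of x g c] by (simp add: word_span.smult)
  qed
  show ?thesis
    unfolding submodule_def
  proof (intro conjI ballI allI subsetI)
    show "Xp M t *\<^sub>v x \<in> word_span M v" "Xm M t *\<^sub>v x \<in> word_span M v" "J M t *\<^sub>v x \<in> word_span M v"
      "Kp M *\<^sub>v x \<in> word_span M v" "Km M *\<^sub>v x \<in> word_span M v" if "x \<in> word_span M v" for x t
      using act[OF that, of "GP t"] act[OF that, of "GM t"] act[OF that, of "GJ t"]
        act[OF that, of GK] act[OF that, of GL] by simp_all
  qed (simp_all add: sub word_span.zero word_span.add word_span.smult)
qed

lemma word_span_eq:
  assumes "v \<in> carrier_vec n" "generated_by M v"
  shows "word_span M v = carrier_vec n"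
  using assms submodule_word_span[OF assms(1)] word_span.word[of M "[]" v]
  unfolding generated_by_def by simp

lemma kproj_vec_carrier [simp]: "x \<in> carrier_vec n \<Longrightarrow> kproj_vec q \<mu> M R x \<in> carrier_vec n"
  by (induction R) auto

lemma index_add: "x \<in> carrier_vec n \<Longrightarrow> y \<in> carrier_vec n \<Longrightarrow> i < n \<Longrightarrow> (x + y) $ i = x $ i + y $ i"
  and index_scale: "x \<in> carrier_vec n \<Longrightarrow> i < n \<Longrightarrow> (c \<cdot>\<^sub>v x) $ i = c * x $ i" for x y :: "complex vec"
  by auto

text \<open>Right multiplication of the test words by \<open>GK\<close> is the action of
  \<open>Kp M\<close> on the vector, so \<open>kproj\<close> on coordinates and
  \<open>kproj_vec\<close> on vectors are the same operation.\<close>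

lemma kproj_wact:
  assumes "x \<in> carrier_vec n" "i < n"
  shows "kproj q \<mu> R (\<lambda>a. wact M a x $ i) a = wact M a (kproj_vec q \<mu> M R x) $ i"
proof (induction R arbitrary: a)
  case (Suc R)
  have "wact M a (kproj_vec q \<mu> M (Suc R) x) = wact M a (Kp M *\<^sub>v kproj_vec q \<mu> M R x) +
    (- (\<mu> * (inverse q^2) ^ Suc R)) \<cdot>\<^sub>v wact M a (kproj_vec q \<mu> M R x)"
    using assms(1) by (simp add: wact_add wact_smult)
  then show ?case using assms by (simp add: Suc wact_append index_add index_scale)
qed simp

lemma kproj_vec_add:
  "x \<in> carrier_vec n \<Longrightarrow> y \<in> carrier_vec n \<Longrightarrow> kproj_vec q \<mu> M R (x + y) = kproj_vec q \<mu> M R x + kproj_vec q \<mu> M R y"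
proof (induction R)
  case (Suc R)
  show ?case
  proof (rule eq_vecI)
    fix i assume "i < dim_vec (kproj_vec q \<mu> M (Suc R) x + kproj_vec q \<mu> M (Suc R) y)"
    then have "i < n" using Suc.prems by (simp add: carrier_vecD[OF kproj_vec_carrier])
    then show "kproj_vec q \<mu> M (Suc R) (x + y) $ i = (kproj_vec q \<mu> M (Suc R) x + kproj_vec q \<mu> M (Suc R) y) $ i"
      using Suc
      by (simp add: index_add index_scale mult_add_distrib_mat_vec[OF carriers(4)] algebra_simps
          del: index_mult_mat_vec index_add_vec index_smult_vec)
  qed (use Suc.prems in \<open>simp add: carrier_vecD[OF kproj_vec_carrier]\<close>)
qed simp

lemma kproj_vec_smult:
  "x \<in> carrier_vec n \<Longrightarrow> kproj_vec q \<mu> M R (c \<cdot>\<^sub>v x) = c \<cdot>\<^sub>v kproj_vec q \<mu> M R x"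
proof (induction R)
  case (Suc R)
  show ?case
  proof (rule eq_vecI)
    fix i assume "i < dim_vec (c \<cdot>\<^sub>v kproj_vec q \<mu> M (Suc R) x)"
    then have "i < n" using Suc.prems by (simp add: carrier_vecD[OF kproj_vec_carrier])
    then show "kproj_vec q \<mu> M (Suc R) (c \<cdot>\<^sub>v x) $ i = (c \<cdot>\<^sub>v kproj_vec q \<mu> M (Suc R) x) $ i"
      using Suc
      by (simp add: index_add index_scale mult_mat_vec[OF carriers(4)] algebra_simps
          del: index_mult_mat_vec index_add_vec index_smult_vec)
  qed (use Suc.prems in \<open>simp add: carrier_vecD[OF kproj_vec_carrier]\<close>)
qed simp

lemma Kp_shift:
  assumes x: "x \<in> carrier_vec n" and k: "Kp M *\<^sub>v x = k \<cdot>\<^sub>v x"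
  shows "Kp M *\<^sub>v (Xp M t *\<^sub>v x) = (k * q^2) \<cdot>\<^sub>v (Xp M t *\<^sub>v x)"
    and "Kp M *\<^sub>v (Xm M t *\<^sub>v x) = (k * inverse q^2) \<cdot>\<^sub>v (Xm M t *\<^sub>v x)"
proof -
  note u = um[unfolded is_umod_def Let_def]
  have l: "Km M * Kp M = 1\<^sub>m n" using u by blast
  have shift: "Kp M *\<^sub>v (X *\<^sub>v x) = (k * e) \<cdot>\<^sub>v (X *\<^sub>v x)"
    if X: "X \<in> carrier_mat n n" and e: "Kp M * X * Km M = e \<cdot>\<^sub>m X" for X e
  proof -
    have "Kp M * X = Kp M * X * (Km M * Kp M)" using X by (simp add: l)
    also have "\<dots> = Kp M * X * Km M * Kp M"
      using X by (intro assoc_mult_mat[symmetric, of _ n n _ n _ n]) auto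
    finally have "Kp M * X = e \<cdot>\<^sub>m (X * Kp M)"
      unfolding e using X by (simp add: mult_smult_assoc_mat[of _ n n _ n])
    then have "(Kp M * X) *\<^sub>v x = (e \<cdot>\<^sub>m (X * Kp M)) *\<^sub>v x" by simp
    then have "Kp M *\<^sub>v (X *\<^sub>v x) = e \<cdot>\<^sub>v (X *\<^sub>v (Kp M *\<^sub>v x))"
      using X x by (simp add: smult_mat_vec[of _ n n] assoc_mult_mat_vec[of _ n n _ n])
    then show ?thesis
      unfolding k mult_mat_vec[OF X x] by (simp add: smult_smult_assoc mult.commute)
  qed
  have "Kp M * Xp M t * Km M = (q^2) \<cdot>\<^sub>m Xp M t" using u by blast
  from shift[OF carriers(1) this] show "Kp M *\<^sub>v (Xp M t *\<^sub>v x) = (k * q^2) \<cdot>\<^sub>v (Xp M t *\<^sub>v x)" .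
  have "Kp M * Xm M t * Km M = (inverse q^2) \<cdot>\<^sub>m Xm M t" using u by blast
  from shift[OF carriers(2) this] show "Kp M *\<^sub>v (Xm M t *\<^sub>v x) = (k * inverse q^2) \<cdot>\<^sub>v (Xm M t *\<^sub>v x)" .
qed

end

section \<open>Coefficient along the highest weight vector\<close>

locale hw_module = umodule +
  fixes \<mu> :: complex and u :: "nat \<Rightarrow> complex" and v :: "complex vec"
  assumes hwv: "hw_vector M (\<mu>, u) v" and gen: "generated_by M v" and m0: "\<mu> \<noteq> 0"
begin

lemma v: "v \<in> carrier_vec n" "v \<noteq> 0\<^sub>v n" "Xp M t *\<^sub>v v = 0\<^sub>v n" "Kp M *\<^sub>v v = \<mu> \<cdot>\<^sub>v v"
  "t > 0 \<Longrightarrow> J M t *\<^sub>v v = u t \<cdot>\<^sub>v v"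
  using hwv unfolding hw_vector_def by auto

lemma span: "word_span M v = carrier_vec n"
  by (rule word_span_eq[OF v(1) gen])

text \<open>Coordinates form a family over all natural numbers; outside the range the member is the
  zero functional, which satisfies the same equations.\<close>

definition entry :: "nat \<Rightarrow> gen list \<Rightarrow> complex" where
  "entry i a = (if i < n then wact M a v $ i else 0)"

lemma qq: "q - inverse q \<noteq> 0" by (rule q_minus_inverse[OF q0 nroot])

lemma entry_hw: "hw_functional q Q \<mu> u (entry i)"
proof (cases "i < n")
  case True
  have c: "wact M a v \<in> carrier_vec n" for a using v(1) by simp
  have "entry i (a @ [GP t]) = 0" for a t
    using True by (simp add: entry_def wact_append v(3) wact_zero)
  moreover have "entry i (a @ [GK]) = \<mu> * entry i a" for a
    using True index_scale[OF c] by (simp add: entry_def wact_append v(4) wact_smult[OF v(1)])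
  moreover have "entry i (a @ [GJ t]) = u t * entry i a" if "t > 0" for a t
    using True index_scale[OF c] by (simp add: entry_def wact_append v(5)[OF that] wact_smult[OF v(1)])
  moreover have "word_sum (\<lambda>w. entry i (a @ w @ b)) r = 0" if "defrel q Q r" for a b r
    using wact_defrel_context[OF that v(1) True, of a b] True by (simp add: entry_def)
  ultimately show ?thesis unfolding hw_functional_def by simp
next
  case False
  have "word_sum (\<lambda>w. 0) r = 0" for r :: "(complex \<times> gen list) list" by (induction r) auto
  then show ?thesis using False unfolding hw_functional_def by (simp add: entry_def)
qed

abbreviation "kp \<equiv> kproj_vec q \<mu> M"
abbreviation "ke R \<equiv> kproj_eigenvalue q \<mu> R 0"

lemma ke0: "ke R \<noteq> 0" by (rule kproj_eigenvalue_0[OF q0 nroot m0])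

text \<open>\<open>c\<close> is the component of \<open>x\<close> along \<open>v\<close>, read off
  from the projector instead of a weight decomposition. The projector is exact only once
  \<open>R\<close> exceeds the depth of the weights occurring in \<open>x\<close>, hence the
  threshold.\<close>

definition hw_coeff_is :: "complex vec \<Rightarrow> complex \<Rightarrow> bool" where
  "hw_coeff_is x c \<longleftrightarrow> (\<exists>R0. \<forall>R\<ge>R0. kp R x = (c * ke R) \<cdot>\<^sub>v v)"

lemma entry_kproj:
  assumes "i < n"
  shows "kproj q \<mu> R (\<lambda>a. entry i (a @ w)) a = wact M a (kp R (wact M w v)) $ i"
  using kproj_wact[of "wact M w v" i \<mu> R a] assms v(1) by (simp add: entry_def wact_append)

text \<open>Applying \<open>kproj_comb\<close> to all coordinate functionals at once gives one
  constant and one threshold, hence identities of vectors.\<close>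

lemma kproj_word:
  "\<exists>c R0. (\<forall>R\<ge>R0. kp R (wact M w v) = (c * ke R) \<cdot>\<^sub>v v) \<and> (\<forall>R\<ge>R0. \<forall>t. kp R (Xm M t *\<^sub>v wact M w v) = 0\<^sub>v n)"
proof -
  obtain e where "monomial_comb (range (\<lambda>c n. c)) entry e (\<lambda>n a. entry n (a @ w))"
    by (rule hw_word_comb[OF q0 qq m0 entry_hw]) (rule that)
  from kproj_comb[OF q0 m0 entry_hw this] obtain c R0 where
    1: "\<And>R i a. R \<ge> R0 \<Longrightarrow> kproj q \<mu> R (\<lambda>a. entry i (a @ w)) a = c * ke R * entry i a" and
    2: "\<And>R i t a. R \<ge> R0 \<Longrightarrow> kproj q \<mu> R (\<lambda>a. entry i ((a @ [GM t]) @ w)) a = 0"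
    by blast
  have "kp R (wact M w v) = (c * ke R) \<cdot>\<^sub>v v" if "R \<ge> R0" for R
  proof (rule eq_vecI)
    fix i assume "i < dim_vec ((c * ke R) \<cdot>\<^sub>v v)"
    then have i: "i < n" using v(1) by simp
    show "kp R (wact M w v) $ i = ((c * ke R) \<cdot>\<^sub>v v) $ i"
      using 1[OF that, of i "[]"] entry_kproj[OF i, of R w "[]"] i v(1)
      by (simp add: entry_def)
  qed (use v(1) kproj_vec_carrier[of "wact M w v" \<mu> R] in simp)
  moreover have "kp R (Xm M t *\<^sub>v wact M w v) = 0\<^sub>v n" if "R \<ge> R0" for R t
  proof (rule eq_vecI)
    fix i assume "i < dim_vec (0\<^sub>v n :: complex vec)"
    then have i: "i < n" by simp
    show "kp R (Xm M t *\<^sub>v wact M w v) $ i = 0\<^sub>v n $ i"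
      using 2[OF that, of i t "[]"] entry_kproj[OF i, of R "GM t # w" "[]"] i by simp
  qed (use v(1) kproj_vec_carrier[of "Xm M t *\<^sub>v wact M w v" \<mu> R] in simp)
  ultimately show ?thesis by blast
qed

lemma kp_zero: "kp R (0\<^sub>v n) = 0\<^sub>v n"
  using kproj_vec_smult[of "0\<^sub>v n" \<mu> R 0] kproj_vec_carrier[of "0\<^sub>v n" \<mu> R] by (simp add: smult_zero_vec')

lemma kproj_all:
  assumes "x \<in> carrier_vec n"
  shows "\<exists>c R0. (\<forall>R\<ge>R0. kp R x = (c * ke R) \<cdot>\<^sub>v v) \<and> (\<forall>R\<ge>R0. \<forall>t. kp R (Xm M t *\<^sub>v x) = 0\<^sub>v n)"
  using assms unfolding span[symmetric]
proof induction
  case zero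
  have "Xm M t *\<^sub>v 0\<^sub>v n = 0\<^sub>v n" for t using wact_zero[of "[GM t]"] by simp
  then show ?case
    using v(1) by (intro exI[of _ 0]) (simp add: kp_zero smult_zero_vec')
next
  case (word w)
  show ?case by (rule kproj_word)
next
  case (add x y)
  then have c: "x \<in> carrier_vec n" "y \<in> carrier_vec n" unfolding span by auto
  from add.IH(1) obtain a R0 where x: "\<And>R. R \<ge> R0 \<Longrightarrow> kp R x = (a * ke R) \<cdot>\<^sub>v v"
    "\<And>R t. R \<ge> R0 \<Longrightarrow> kp R (Xm M t *\<^sub>v x) = 0\<^sub>v n" by blast
  from add.IH(2) obtain b R1 where y: "\<And>R. R \<ge> R1 \<Longrightarrow> kp R y = (b * ke R) \<cdot>\<^sub>v v"
    "\<And>R t. R \<ge> R1 \<Longrightarrow> kp R (Xm M t *\<^sub>v y) = 0\<^sub>v n" by blast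
  show ?case
    using c by (intro exI[of _ "a + b"] exI[of _ "max R0 R1"])
      (simp add: kproj_vec_add mult_add_distrib_mat_vec[OF carriers(2)] x y distrib_right add_smult_distrib_vec)
next
  case (smult x b)
  then have c: "x \<in> carrier_vec n" unfolding span by auto
  from smult.IH obtain a R0 where x: "\<And>R. R \<ge> R0 \<Longrightarrow> kp R x = (a * ke R) \<cdot>\<^sub>v v"
    "\<And>R t. R \<ge> R0 \<Longrightarrow> kp R (Xm M t *\<^sub>v x) = 0\<^sub>v n" by blast
  have z: "b \<cdot>\<^sub>v 0\<^sub>v n = 0\<^sub>v n" by (intro eq_vecI) auto
  show ?case
    using c by (intro exI[of _ "b * a"] exI[of _ R0])
      (simp add: kproj_vec_smult mult_mat_vec[OF carriers(2)] x z smult_smult_assoc mult.assoc)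
qed

lemma hw_coeff_unique:
  assumes "hw_coeff_is x c" "hw_coeff_is x c'"
  shows "c = c'"
proof -
  obtain R0 R1 where R: "\<And>R. R \<ge> R0 \<Longrightarrow> kp R x = (c * ke R) \<cdot>\<^sub>v v" "\<And>R. R \<ge> R1 \<Longrightarrow> kp R x = (c' * ke R) \<cdot>\<^sub>v v"
    using assms unfolding hw_coeff_is_def by blast
  obtain i where i: "i < n" "v $ i \<noteq> 0"
  proof (rule ccontr)
    assume "\<not> thesis"
    then have "v = 0\<^sub>v n" using that v(1) by (intro eq_vecI) auto
    then show False using v(2) by simp
  qed
  have "((c * ke (max R0 R1)) \<cdot>\<^sub>v v) $ i = ((c' * ke (max R0 R1)) \<cdot>\<^sub>v v) $ i"
    using R[of "max R0 R1"] by simp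
  then show ?thesis using i v(1) ke0 by simp
qed

definition hw_coeff :: "complex vec \<Rightarrow> complex" where
  "hw_coeff x = (THE c. hw_coeff_is x c)"

lemma hw_coeff_eqI: "hw_coeff_is x c \<Longrightarrow> hw_coeff x = c"
  unfolding hw_coeff_def using hw_coeff_unique by blast

lemma hw_coeff_is: "x \<in> carrier_vec n \<Longrightarrow> hw_coeff_is x (hw_coeff x)"
  using kproj_all[of x] hw_coeff_eqI unfolding hw_coeff_is_def by metis

lemma hw_coeff_add:
  assumes "x \<in> carrier_vec n" "y \<in> carrier_vec n"
  shows "hw_coeff (x + y) = hw_coeff x + hw_coeff y"
proof (rule hw_coeff_eqI)
  obtain R0 R1 where R: "\<And>R. R \<ge> R0 \<Longrightarrow> kp R x = (hw_coeff x * ke R) \<cdot>\<^sub>v v"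
    "\<And>R. R \<ge> R1 \<Longrightarrow> kp R y = (hw_coeff y * ke R) \<cdot>\<^sub>v v"
    using assms[THEN hw_coeff_is] unfolding hw_coeff_is_def by blast
  then show "hw_coeff_is (x + y) (hw_coeff x + hw_coeff y)"
    unfolding hw_coeff_is_def
    by (intro exI[of _ "max R0 R1"]) (simp add: kproj_vec_add[OF assms] distrib_right add_smult_distrib_vec)
qed

lemma hw_coeff_smult:
  assumes "x \<in> carrier_vec n"
  shows "hw_coeff (c \<cdot>\<^sub>v x) = c * hw_coeff x"
proof (rule hw_coeff_eqI)
  obtain R0 where R: "\<And>R. R \<ge> R0 \<Longrightarrow> kp R x = (hw_coeff x * ke R) \<cdot>\<^sub>v v"
    using hw_coeff_is[OF assms] unfolding hw_coeff_is_def by blast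
  then show "hw_coeff_is (c \<cdot>\<^sub>v x) (c * hw_coeff x)"
    unfolding hw_coeff_is_def
    by (intro exI[of _ R0]) (simp add: kproj_vec_smult[OF assms] smult_smult_assoc mult.assoc)
qed

lemma hw_coeff_zero: "hw_coeff (0\<^sub>v n) = 0"
  using hw_coeff_smult[of "0\<^sub>v n" 0] by (simp add: smult_zero_vec')

lemma kp_eigen:
  assumes "x \<in> carrier_vec n" "Kp M *\<^sub>v x = k \<cdot>\<^sub>v x"
  shows "kp R x = (\<Prod>r<R. k - \<mu> * (inverse q^2) ^ Suc r) \<cdot>\<^sub>v x"
proof (induction R)
  case 0
  show ?case by simp
next
  case (Suc R)
  have "Kp M *\<^sub>v (c \<cdot>\<^sub>v x) = (c * k) \<cdot>\<^sub>v x" for c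
    using mult_mat_vec[OF carriers(4) assms(1), of c] assms(2) by (simp add: smult_smult_assoc)
  then show ?case
    unfolding kproj_vec.simps Suc prod.lessThan_Suc
    using assms(1) by (simp add: smult_smult_assoc add_smult_distrib_vec[symmetric] algebra_simps)
qed

lemma hw_coeff_v: "hw_coeff v = 1"
proof (rule hw_coeff_eqI)
  have "kp R v = (1 * ke R) \<cdot>\<^sub>v v" for R
    using kp_eigen[OF v(1,4), of R] by (simp add: kproj_eigenvalue_def)
  then show "hw_coeff_is v 1" unfolding hw_coeff_is_def by blast
qed

lemma hw_coeff_Xm:
  assumes "x \<in> carrier_vec n"
  shows "hw_coeff (Xm M t *\<^sub>v x) = 0"
proof (rule hw_coeff_eqI)
  obtain R0 where "\<And>R. R \<ge> R0 \<Longrightarrow> kp R (Xm M t *\<^sub>v x) = 0\<^sub>v n" using kproj_all[OF assms] by blast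
  then show "hw_coeff_is (Xm M t *\<^sub>v x) 0"
    unfolding hw_coeff_is_def using v(1) by (intro exI[of _ R0]) (simp add: smult_zero_vec')
qed

definition vacuum :: "gen list \<Rightarrow> complex" where
  "vacuum w = hw_coeff (wact M w v)"

text \<open>The component along \<open>v\<close> of a word applied to \<open>v\<close> satisfies the
  relations by linearity, and it vanishes on the image of every \<open>Xm M t\<close>, as the
  projector kills such vectors.\<close>

lemma vacuum_functional: "vacuum_functional q Q \<mu> u vacuum"
proof -
  have c: "wact M a v \<in> carrier_vec n" for a using v(1) by simp
  \<comment> \<open>\<open>vsum\<close> is the vector whose coordinates, and whose component along
    \<open>v\<close>, are the corresponding word sums.\<close>
  define vsum where "vsum a b r = foldr (\<lambda>(c, w) x. c \<cdot>\<^sub>v wact M (a @ w @ b) v + x) r (0\<^sub>v n)"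
    for a b and r :: "(complex \<times> gen list) list"
  have vs: "vsum a b [] = 0\<^sub>v n" "vsum a b ((e, w) # r) = e \<cdot>\<^sub>v wact M (a @ w @ b) v + vsum a b r"
    for a b e w r by (simp_all add: vsum_def)
  have vc: "vsum a b r \<in> carrier_vec n" for a b r
    by (induction r) (auto simp: vs c)
  have vf: "hw_coeff (vsum a b r) = word_sum (\<lambda>w. vacuum (a @ w @ b)) r" for a b r
    by (induction r) (auto simp: vs hw_coeff_zero hw_coeff_add hw_coeff_smult c vc vacuum_def)
  have vi: "vsum a b r $ i = word_sum (\<lambda>w. wact M (a @ w @ b) v $ i) r" if "i < n" for a b r i
    using that by (induction r) (auto simp: vs index_add index_scale c vc simp del: index_add_vec index_smult_vec)
  have "word_sum (\<lambda>w. vacuum (a @ w @ b)) r = 0" if "defrel q Q r" for a b r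
  proof -
    have "vsum a b r = 0\<^sub>v n"
      using vc[of a b r] vi wact_defrel_context[OF that v(1)] by (intro eq_vecI) auto
    then show ?thesis using vf[of a b r] hw_coeff_zero by simp
  qed
  moreover have "vacuum (a @ [GP t]) = 0" for a t
    by (simp add: vacuum_def wact_append v(3) wact_zero hw_coeff_zero)
  moreover have "vacuum (a @ [GK]) = \<mu> * vacuum a" for a
    by (simp add: vacuum_def wact_append v(4) wact_smult[OF v(1)] hw_coeff_smult[OF c])
  moreover have "vacuum (a @ [GJ t]) = u t * vacuum a" if "t > 0" for a t
    by (simp add: vacuum_def wact_append v(5)[OF that] wact_smult[OF v(1)] hw_coeff_smult[OF c])
  moreover have "vacuum [] = 1" by (simp add: vacuum_def hw_coeff_v)
  moreover have "vacuum (GM t # b) = 0" for t b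
    by (simp add: vacuum_def hw_coeff_Xm[OF c])
  ultimately show ?thesis
    unfolding vacuum_functional_def hw_functional_def by simp
qed

lemma lowering_eigen:
  "Kp M *\<^sub>v wact M (replicate r (GM 0)) v = (\<mu> * (inverse q^2) ^ r) \<cdot>\<^sub>v wact M (replicate r (GM 0)) v"
proof (induction r)
  case (Suc r)
  have "wact M (replicate r (GM 0)) v \<in> carrier_vec n" using v(1) by simp
  from Kp_shift(2)[OF this Suc] show ?case by (simp add: ac_simps)
qed (simp add: v(4))

lemma lowering_inj: "inj_on (\<lambda>r. \<mu> * (inverse q^2) ^ r) A"
  using m0 q0 power_neq_one[OF q0 nroot] by (intro inj_geometric) auto

text \<open>As long as they are nonzero, the successive images of \<open>v\<close> are eigenvectors
  of \<open>Kp M\<close> for distinct eigenvalues, so there are at most \<open>n\<close> of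
  them.\<close>

lemma lowering_nilpotent:
  assumes "n \<le> r"
  shows "wact M (replicate r (GM 0)) v = 0\<^sub>v n"
proof (rule ccontr)
  assume nz: "wact M (replicate r (GM 0)) v \<noteq> 0\<^sub>v n"
  have "wact M (replicate i (GM 0)) v \<noteq> 0\<^sub>v n" if "i \<le> r" for i
  proof
    assume z: "wact M (replicate i (GM 0)) v = 0\<^sub>v n"
    have "replicate r (GM 0) = replicate (r - i) (GM 0) @ replicate i (GM 0)"
      using that by (simp flip: replicate_add)
    then show False using nz z by (simp add: wact_append wact_zero)
  qed
  then have "Suc r \<le> n"
    by (intro distinct_eigenvectors_bound[OF carriers(4), of "Suc r" "\<lambda>i. wact M (replicate i (GM 0)) v"
          "\<lambda>r. \<mu> * (inverse q^2) ^ r"])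
      (auto simp: v(1) lowering_eigen lowering_inj)
  then show False using assms by simp
qed

lemma vacuum_lowering:
  assumes "n \<le> r"
  shows "vacuum (b @ replicate r (GM 0)) = 0"
  using lowering_nilpotent[OF assms] by (simp add: vacuum_def wact_append wact_zero hw_coeff_zero)

text \<open>The component of \<open>w\<close> along \<open>v\<close> cannot vanish: every vector is
  a combination of lowering monomials applied to \<open>w\<close>, and all of these, and with them
  \<open>v\<close>, would have component zero. So the projector sends \<open>w\<close> to a nonzero
  multiple of \<open>v\<close>; as \<open>w\<close> is an eigenvector of \<open>Kp M\<close>, the
  image is also a multiple of \<open>w\<close>, and the two vectors are proportional.\<close>

lemma hw_vector_unique:
  assumes "hw_vector M (\<mu>', u') w" "generated_by M w" "\<mu>' \<noteq> 0"
  shows "\<mu>' = \<mu> \<and> (\<forall>t>0. u' t = u t)"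
proof -
  interpret W: hw_module q Q M \<mu>' u' w
    using assms by unfold_locales
  have cf: "hw_coeff w \<noteq> 0"
  proof
    assume z: "hw_coeff w = 0"
    \<comment> \<open>The projector is built from the weight \<mu> of \<open>v\<close>, while the
      functionals \<open>W.entry\<close> come from \<open>w\<close> with its own weight \<mu>'.
      Vanishing is therefore checked on monomials directly and propagated through
      combinations.\<close>
    define vanish where "vanish f \<longleftrightarrow> (\<exists>R0. \<forall>R\<ge>R0. \<forall>i<n. kproj q \<mu> R (f i) [] = 0)"
      for f :: "nat \<Rightarrow> gen list \<Rightarrow> complex"
    have ent: "kproj q \<mu> R (\<lambda>a. W.entry i (a @ b)) [] = kp R (wact M b w) $ i" if "i < n" for R i b
      using kproj_wact[of "wact M b w" i \<mu> R "[]"] that W.v(1) by (simp add: W.entry_def wact_append)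
    have van: "vanish f" if "monomial_comb (range (\<lambda>c n. c)) W.entry d f" for d f
      using that
    proof (induction rule: monomial_comb.induct)
      case (zero d)
      show ?case unfolding vanish_def by (simp add: kproj_zero)
    next
      case (monomial ts d)
      have "hw_coeff (wact M (map GM ts) w) = 0"
        using z hw_coeff_Xm W.v(1) by (cases ts) auto
      then obtain R0 where "\<And>R. R \<ge> R0 \<Longrightarrow> kp R (wact M (map GM ts) w) = (0 * ke R) \<cdot>\<^sub>v v"
        using hw_coeff_is[of "wact M (map GM ts) w"] W.v(1) unfolding hw_coeff_is_def by auto
      then show ?case unfolding vanish_def using v(1) by (intro exI[of _ R0]) (simp add: ent)
    next
      case (add d f g)
      from add.IH obtain R0 R1 where "\<forall>R\<ge>R0. \<forall>i<n. kproj q \<mu> R (f i) [] = 0"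
        "\<forall>R\<ge>R1. \<forall>i<n. kproj q \<mu> R (g i) [] = 0" unfolding vanish_def by auto
      then show ?case unfolding vanish_def by (intro exI[of _ "max R0 R1"]) (simp add: kproj_add)
    next
      case (scale r d f)
      from scale(1) obtain e where r: "r = (\<lambda>n. e)" by auto
      from scale.IH obtain R0 where "\<forall>R\<ge>R0. \<forall>i<n. kproj q \<mu> R (f i) [] = 0" unfolding vanish_def by auto
      then show ?case unfolding vanish_def r by (intro exI[of _ R0]) (simp add: kproj_scale)
    qed
    have wz: "hw_coeff (wact M b w) = 0" for b
    proof (rule hw_coeff_eqI)
      obtain e where "monomial_comb (range (\<lambda>c n. c)) W.entry e (\<lambda>n a. W.entry n (a @ b))"
        by (rule hw_word_comb[OF q0 qq W.m0 W.entry_hw]) (rule that)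
      from van[OF this] obtain R0 where "\<forall>R\<ge>R0. \<forall>i<n. kproj q \<mu> R (\<lambda>a. W.entry i (a @ b)) [] = 0"
        unfolding vanish_def by blast
      then have R0: "kp R (wact M b w) $ i = 0" if "R \<ge> R0" "i < n" for R i
        using ent[OF that(2), of R b] that by simp
      have "kp R (wact M b w) = (0 * ke R) \<cdot>\<^sub>v v" if "R \<ge> R0" for R
        using R0[OF that] v(1) W.v(1) kproj_vec_carrier[of "wact M b w" \<mu> R] by (intro eq_vecI) auto
      then show "hw_coeff_is (wact M b w) 0" unfolding hw_coeff_is_def by blast
    qed
    have "hw_coeff x = 0" if "x \<in> word_span M w" for x
      using that
    proof induction
      case (add x y)
      then show ?case using hw_coeff_add[of x y] unfolding W.span by simp
    next
      case (smult x c)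
      then show ?case using hw_coeff_smult[of x c] unfolding W.span by simp
    qed (simp_all add: wz hw_coeff_zero)
    then have "hw_coeff v = 0" unfolding W.span using v(1) .
    then show False using hw_coeff_v by simp
  qed
  obtain R where R: "kp R w = (hw_coeff w * ke R) \<cdot>\<^sub>v v"
    using hw_coeff_is[OF W.v(1)] unfolding hw_coeff_is_def by blast
  define e where "e = hw_coeff w * ke R"
  define p where "p = (\<Prod>r<R. \<mu>' - \<mu> * (inverse q^2) ^ Suc r)"
  define d where "d = inverse e * p"
  have e0: "e \<noteq> 0" using cf ke0[of R] by (simp add: e_def)
  have ep: "e \<cdot>\<^sub>v v = p \<cdot>\<^sub>v w"
    unfolding e_def p_def R[symmetric] by (rule kp_eigen[OF W.v(1) W.v(4)])
  have "v = inverse e \<cdot>\<^sub>v (e \<cdot>\<^sub>v v)" using e0 by (simp add: smult_smult_assoc)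
  also have "\<dots> = d \<cdot>\<^sub>v w" unfolding ep d_def by (simp add: smult_smult_assoc)
  finally have vw: "v = d \<cdot>\<^sub>v w" .
  obtain i where i: "i < n" "v $ i \<noteq> 0"
  proof (rule ccontr)
    assume "\<not> thesis"
    then have "v = 0\<^sub>v n" using that v(1) by (intro eq_vecI) auto
    then show False using v(2) by simp
  qed
  have eig: "k' = k" if A: "A \<in> carrier_mat n n" and "A *\<^sub>v v = k \<cdot>\<^sub>v v" "A *\<^sub>v w = k' \<cdot>\<^sub>v w" for A k k'
  proof -
    have "A *\<^sub>v v = k' \<cdot>\<^sub>v v"
      unfolding vw mult_mat_vec[OF A W.v(1)] that(3) by (simp add: smult_smult_assoc mult.commute)
    then have "(k' \<cdot>\<^sub>v v) $ i = (k \<cdot>\<^sub>v v) $ i" using that(2) by simp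
    then show ?thesis using i v(1) by simp
  qed
  have "\<mu>' = \<mu>" by (rule eig[OF carriers(4) v(4) W.v(4)])
  moreover have "u' t = u t" if "t > 0" for t by (rule eig[OF carriers(3) v(5)[OF that] W.v(5)[OF that]])
  ultimately show ?thesis by blast
qed

end

section \<open>Existence of highest weight vectors\<close>

context umodule
begin

lemma Kp_eigenvalue_nonzero:
  assumes y: "y \<in> carrier_vec n" "y \<noteq> 0\<^sub>v n" "Kp M *\<^sub>v y = k \<cdot>\<^sub>v y"
  shows "k \<noteq> 0"
proof
  assume k: "k = 0"
  have "Km M * Kp M = 1\<^sub>m n" using um[unfolded is_umod_def Let_def] by blast
  then have "y = Km M *\<^sub>v (Kp M *\<^sub>v y)" using y(1) by (simp flip: assoc_mult_mat_vec[OF carriers(5,4) y(1)])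
  also have "\<dots> = 0\<^sub>v n" unfolding y(3) k using y(1) wact_zero[of "[GL]"] by (simp add: smult_zero_vec')
  finally show False using y(2) by simp
qed

lemma hw_vector_nonzero_eigenvalue: "hw_vector M (\<mu>, u) v \<Longrightarrow> \<mu> \<noteq> 0"
  using Kp_eigenvalue_nonzero[of v \<mu>] unfolding hw_vector_def by auto

text \<open>Raising multiplies the eigenvalue of \<open>Kp M\<close> by q^2. A nonzero product of
  raising operators on an eigenvector gives, through its suffixes, a chain of eigenvectors for
  distinct eigenvalues, so its length stays below \<open>n\<close>; a longest nonzero product is
  killed by every \<open>Xp M t\<close>.\<close>

lemma raising_killed:
  assumes "0 < n"
  obtains x where "x \<in> carrier_vec n" "x \<noteq> 0\<^sub>v n" "\<And>t. Xp M t *\<^sub>v x = 0\<^sub>v n"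
proof -
  have W: "vec_subspace n (carrier_vec n)" unfolding vec_subspace_def by auto
  have u: "unit_vec n 0 \<in> carrier_vec n" "unit_vec n 0 \<noteq> (0\<^sub>v n :: complex vec)"
    using assms by (auto simp: unit_vec_nonzero)
  obtain y k where y: "y \<in> carrier_vec n" "y \<noteq> 0\<^sub>v n" "Kp M *\<^sub>v y = k \<cdot>\<^sub>v y"
    using eigenvector_in_subspace[OF carriers(4) W _ u] by auto
  have k0: "k \<noteq> 0" by (rule Kp_eigenvalue_nonzero[OF y])
  have yc: "wact M w y \<in> carrier_vec n" for w using y(1) by simp
  have eig: "Kp M *\<^sub>v wact M (map GP ts) y = (k * (q^2) ^ length ts) \<cdot>\<^sub>v wact M (map GP ts) y" for ts
  proof (induction ts)
    case (Cons t ts)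
    from Kp_shift(1)[OF yc Cons, of t] show ?case by (simp add: ac_simps)
  qed (simp add: y(3))
  have "(q^2) ^ m \<noteq> 1" if "m > 0" for m
    using power_neq_one[OF q0 nroot that] by (simp add: power_inverse)
  then have inj: "inj_on (\<lambda>r. k * (q^2) ^ r) A" for A
    using k0 q0 by (intro inj_geometric) auto
  have bound: "length ts < n" if nz: "wact M (map GP ts) y \<noteq> 0\<^sub>v n" for ts
  proof -
    let ?x = "\<lambda>i. wact M (map GP (drop (length ts - i) ts)) y"
    have "?x i \<noteq> 0\<^sub>v n" for i
    proof
      assume z: "?x i = 0\<^sub>v n"
      have "map GP ts = map GP (take (length ts - i) ts) @ map GP (drop (length ts - i) ts)"
        by (simp flip: map_append)
      then show False using nz z by (metis wact_append wact_zero)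
    qed
    then have "Suc (length ts) \<le> n"
      by (intro distinct_eigenvectors_bound[OF carriers(4), of "Suc (length ts)" ?x "\<lambda>r. k * (q^2) ^ r"])
        (auto simp: yc eig inj)
    then show ?thesis by simp
  qed
  have "\<exists>ts. wact M (map GP ts) y \<noteq> 0\<^sub>v n \<and> (\<forall>ts'. wact M (map GP ts') y \<noteq> 0\<^sub>v n \<longrightarrow> length ts' \<le> length ts)"
    by (rule ex_has_greatest_nat[of "\<lambda>ts. wact M (map GP ts) y \<noteq> 0\<^sub>v n" "[]" length n])
      (use y(2) bound in \<open>auto intro: less_imp_le\<close>)
  then obtain ts where ts: "wact M (map GP ts) y \<noteq> 0\<^sub>v n"
    "\<And>ts'. wact M (map GP ts') y \<noteq> 0\<^sub>v n \<Longrightarrow> length ts' \<le> length ts" by blast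
  have "Xp M t *\<^sub>v wact M (map GP ts) y = 0\<^sub>v n" for t
    using ts(2)[of "t # ts"] by auto
  then show thesis using that[OF yc ts(1)] by blast
qed

text \<open>The common kernel of the raising operators is nonzero and stable under
  \<open>Kp M\<close> and the \<open>J M t\<close>; these commute, so they have a joint eigenvector
  in it.\<close>

lemma hw_vector_exists:
  assumes "0 < n"
  obtains \<mu> u v where "hw_vector M (\<mu>, u) v"
proof -
  note u = um[unfolded is_umod_def Let_def]
  define W where "W = {x \<in> carrier_vec n. \<forall>t. Xp M t *\<^sub>v x = 0\<^sub>v n}"
  have WI: "x \<in> W" if "x \<in> carrier_vec n" "\<And>t. Xp M t *\<^sub>v x = 0\<^sub>v n" for x using that unfolding W_def by blast
  have WD: "x \<in> carrier_vec n" "Xp M t *\<^sub>v x = 0\<^sub>v n" if "x \<in> W" for x t using that unfolding W_def by auto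
  have z: "a \<cdot>\<^sub>v 0\<^sub>v n = (0\<^sub>v n :: complex vec)" "0\<^sub>v n + 0\<^sub>v n = (0\<^sub>v n :: complex vec)" for a
    by (auto intro: eq_vecI)
  have W: "vec_subspace n W"
    unfolding vec_subspace_def
  proof (intro conjI ballI allI)
    show "W \<subseteq> carrier_vec n" unfolding W_def by blast
    show "0\<^sub>v n \<in> W" using wact_zero[of "[GP _]"] by (intro WI) auto
    show "x + y \<in> W" if "x \<in> W" "y \<in> W" for x y
      using WD[OF that(1)] WD[OF that(2)] by (intro WI) (auto simp: mult_add_distrib_mat_vec[OF carriers(1)] z)
    show "a \<cdot>\<^sub>v x \<in> W" if "x \<in> W" for a x
      using WD[OF that] by (intro WI) (auto simp: mult_mat_vec[OF carriers(1)] z)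
  qed
  have rel: "word_sum (\<lambda>w. wact M w x $ i) r = 0" if "defrel q Q r" "x \<in> carrier_vec n" "i < n" for r x i
    using that by (rule wact_defrel)
  \<comment> \<open>Induction on the index, since the relation moving \<open>J (s+1)\<close> past
    \<open>Xp\<close> involves \<open>J s\<close>; the base uses the relation special to
    \<open>J 0\<close>.\<close>
  have Jinv: "J M s *\<^sub>v x \<in> W" if x: "x \<in> W" for s x
  proof (induction s)
    case 0
    have "Xp M t *\<^sub>v (J M 0 *\<^sub>v x) = 0\<^sub>v n" for t
    proof (rule eq_vecI)
      fix i assume "i < dim_vec (0\<^sub>v n :: complex vec)"
      then have i: "i < n" by simp
      show "(Xp M t *\<^sub>v (J M 0 *\<^sub>v x)) $ i = 0\<^sub>v n $ i"
        using rel[OF J0P[of q Q t] WD(1)[OF x] i] WD(2)[OF x] wact_zero[of "[GJ 0]"] i q0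
        by (simp del: index_mult_mat_vec)
    qed (simp add: carrier_matD[OF carriers(1)])
    then show ?case using WD(1)[OF x] by (intro WI) auto
  next
    case (Suc s)
    have "Xp M t *\<^sub>v (J M (Suc s) *\<^sub>v x) = 0\<^sub>v n" for t
    proof (rule eq_vecI)
      fix i assume "i < dim_vec (0\<^sub>v n :: complex vec)"
      then have i: "i < n" by simp
      show "(Xp M t *\<^sub>v (J M (Suc s) *\<^sub>v x)) $ i = 0\<^sub>v n $ i"
        using rel[OF JP[of q Q s t] WD(1)[OF x] i] WD(2)[OF x] WD(2)[OF Suc] wact_zero[of "[GJ _]"] i
        by (simp del: index_mult_mat_vec)
    qed (simp add: carrier_matD[OF carriers(1)])
    then show ?case using WD(1)[OF x] by (intro WI) auto
  qed
  have Kinv: "Kp M *\<^sub>v x \<in> W" if x: "x \<in> W" for x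
  proof (rule WI)
    fix t
    show "Xp M t *\<^sub>v (Kp M *\<^sub>v x) = 0\<^sub>v n"
    proof (rule eq_vecI)
      fix i assume "i < dim_vec (0\<^sub>v n :: complex vec)"
      then have i: "i < n" by simp
      have "Kp M *\<^sub>v x \<in> carrier_vec n" using WD(1)[OF x] by simp
      from rel[OF KP[of q Q t] this i] rel[OF LK[of q Q] WD(1)[OF x]]
      have l: "Km M *\<^sub>v (Kp M *\<^sub>v x) = x"
        using WD(1)[OF x] by (intro eq_vecI) (auto simp: carrier_matD[OF carriers(5)] simp del: index_mult_mat_vec)
      show "(Xp M t *\<^sub>v (Kp M *\<^sub>v x)) $ i = 0\<^sub>v n $ i"
        using rel[OF KP[of q Q t] \<open>Kp M *\<^sub>v x \<in> carrier_vec n\<close> i] WD(2)[OF x] wact_zero[of "[GK]"] i q0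
        by (simp add: l del: index_mult_mat_vec)
    qed (simp add: carrier_matD[OF carriers(1)])
  qed (use WD(1)[OF x] in simp)
  \<comment> \<open>\<open>None\<close> stands for \<open>Kp M\<close> and \<open>Some t\<close> for
    \<open>J M t\<close>, to form a single commuting family.\<close>
  define A where "A g = (case g of None \<Rightarrow> Kp M | Some t \<Rightarrow> J M t)" for g :: "nat option"
  have A: "A g \<in> carrier_mat n n" for g by (cases g) (auto simp: A_def)
  have comm: "A g * A h = A h * A g" for g h
  proof -
    have 1: "Kp M * J M t = J M t * Kp M" for t using u by blast
    have 2: "J M s * J M t = J M t * J M s" for s t using u by blast
    show ?thesis unfolding A_def by (cases g; cases h) (auto simp: 1 2)
  qed
  obtain y where y: "y \<in> carrier_vec n" "y \<noteq> 0\<^sub>v n" "\<And>t. Xp M t *\<^sub>v y = 0\<^sub>v n"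
    by (rule raising_killed[OF assms]) (rule that)
  have yW: "y \<in> W" using y by (intro WI)
  obtain x where x: "x \<in> W" "x \<noteq> 0\<^sub>v n" "\<And>g. \<exists>k. A g *\<^sub>v x = k \<cdot>\<^sub>v x"
  proof (rule joint_eigenvector[OF A _ W _ yW y(2)])
    show "A g *\<^sub>v (A h *\<^sub>v x) = A h *\<^sub>v (A g *\<^sub>v x)" if "x \<in> carrier_vec n" for g h x
      unfolding assoc_mult_mat_vec[OF A A that, symmetric] comm[of g h] ..
    show "A g *\<^sub>v x \<in> W" if "x \<in> W" for g x
      using Kinv[OF that] Jinv[OF that] unfolding A_def by (cases g) auto
  qed (rule that)
  obtain \<mu> where \<mu>: "Kp M *\<^sub>v x = \<mu> \<cdot>\<^sub>v x" using x(3)[of None] unfolding A_def by auto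
  have "\<forall>t. \<exists>k. J M t *\<^sub>v x = k \<cdot>\<^sub>v x" using x(3)[of "Some _"] unfolding A_def by simp
  then obtain u where "\<And>t. J M t *\<^sub>v x = u t \<cdot>\<^sub>v x" by metis
  then have "hw_vector M (\<mu>, u) x"
    unfolding hw_vector_def using WD[OF x(1)] x(2) \<mu> by simp
  then show thesis by (rule that)
qed

end

section \<open>Highest weights as power series\<close>

lemma finite_partitions: "finite (partitions t k)"
proof (rule finite_subset)
  show "partitions t k \<subseteq> (\<Union>n\<in>{..k}. multisets_of_size {..t} n)"
  proof
    fix lam assume "lam \<in> partitions t k"
    then have lam: "sum_mset lam = t" "size lam \<le> k" by (auto simp: partitions_def)
    have "x \<le> t" if "x \<in># lam" for x
      using sum_mset.remove[OF that] lam(1) by simp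
    then show "lam \<in> (\<Union>n\<in>{..k}. multisets_of_size {..t} n)"
      using lam(2) unfolding multisets_of_size_def by auto
  qed
  show "finite (\<Union>n\<in>{..k}. multisets_of_size {..t} n)" by (auto intro: finite_multisets_of_size)
qed

definition compositions :: "nat \<Rightarrow> nat \<Rightarrow> (nat \<Rightarrow> nat) set" where
  "compositions k t = {\<alpha>. (\<forall>i\<ge>k. \<alpha> i = 0) \<and> (\<Sum>i<k. \<alpha> i) = t}"

text \<open>Connects two expansions: coefficients of a finite product of power series are summed
  over multisets, monomial symmetric polynomials over exponent vectors, which are the multiplicity
  functions.\<close>

lemma bij_count_compositions: "bij_betw count (multisets_of_size {..<k} t) (compositions k t)"
proof -
  have sz: "size X = (\<Sum>i<k. count X i)" if "set_mset X \<subseteq> {..<k}" for X :: "nat multiset"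
    unfolding size_multiset_overloaded_eq using that
    by (intro sum.mono_neutral_left) (auto simp: not_in_iff)
  have "count ` multisets_of_size {..<k} t = compositions k t"
  proof (intro equalityI subsetI)
    fix \<alpha> assume "\<alpha> \<in> count ` multisets_of_size {..<k} t"
    then obtain X where X: "\<alpha> = count X" "set_mset X \<subseteq> {..<k}" "size X = t"
      by (auto simp: multisets_of_size_def)
    then show "\<alpha> \<in> compositions k t"
      using sz[OF X(2)] unfolding compositions_def by (auto simp flip: not_in_iff)
  next
    fix \<alpha> assume \<alpha>: "\<alpha> \<in> compositions k t"
    have "{i. \<alpha> i > 0} \<subseteq> {..<k}"
    proof
      fix i assume "i \<in> {i. \<alpha> i > 0}"
      then show "i \<in> {..<k}" using \<alpha> by (cases "i < k") (simp_all add: compositions_def)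
    qed
    then have c: "count (Abs_multiset \<alpha>) = \<alpha>"
      by (intro count_Abs_multiset) (auto intro: finite_subset)
    have s: "set_mset (Abs_multiset \<alpha>) \<subseteq> {..<k}"
      using \<open>{i. \<alpha> i > 0} \<subseteq> {..<k}\<close> by (simp add: set_mset_def c)
    then have "Abs_multiset \<alpha> \<in> multisets_of_size {..<k} t"
      using sz[OF s] \<alpha> unfolding multisets_of_size_def by (simp add: c compositions_def)
    then show "\<alpha> \<in> count ` multisets_of_size {..<k} t" using c by (metis imageI)
  qed
  moreover have "inj_on count (multisets_of_size {..<k} t)"
    by (intro inj_onI) (simp add: count_inject)
  ultimately show ?thesis by (simp add: bij_betw_def)
qed

definition composition_type :: "nat \<Rightarrow> (nat \<Rightarrow> nat) \<Rightarrow> nat multiset" where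
  "composition_type k \<alpha> = image_mset \<alpha> (filter_mset (\<lambda>i. \<alpha> i \<noteq> 0) (mset [0..<k]))"

lemma size_composition_type: "size (composition_type k \<alpha>) = card {i. i < k \<and> \<alpha> i \<noteq> 0}"
proof -
  have "composition_type k \<alpha> = image_mset \<alpha> (mset_set {i \<in> {0..<k}. \<alpha> i \<noteq> 0})"
    unfolding composition_type_def mset_upt by simp
  then show ?thesis by (simp add: Collect_conj_eq[symmetric] atLeast0LessThan lessThan_def)
qed

lemma sum_composition_type: "sum_mset (composition_type k \<alpha>) = (\<Sum>i<k. \<alpha> i)"
proof -
  have "composition_type k \<alpha> = image_mset \<alpha> (mset_set {i \<in> {0..<k}. \<alpha> i \<noteq> 0})"
    unfolding composition_type_def mset_upt by simp
  then have "sum_mset (composition_type k \<alpha>) = (\<Sum>i\<in>{i \<in> {0..<k}. \<alpha> i \<noteq> 0}. \<alpha> i)"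
    by (simp add: sum_unfold_sum_mset)
  also have "\<dots> = (\<Sum>i<k. \<alpha> i)" by (intro sum.mono_neutral_left) auto
  finally show ?thesis .
qed

text \<open>Since 1 - q^-2 = q^-1 (q - q^-1), an exponent vector with l nonzero entries carries q^-l
  (q - q^-1)^l in the product. Grouping exponent vectors by the partition of their nonzero entries
  gives the monomial symmetric polynomials. The factor in front supplies the power missing from the
  exponent l - 1, and l is positive because t is.\<close>

lemma pq_eq_coeff:
  assumes q0: "q \<noteq> 0" and t: "t > 0"
  shows "(q - inverse q) * pq q t xs = fps_nth (\<Prod>i<length xs. fac (inverse q^2) (xs ! i)) t"
proof -
  let ?k = "length xs" and ?c = "q - inverse q"
  let ?m = "\<lambda>\<alpha>. size (composition_type ?k \<alpha>)"
  let ?x = "\<lambda>\<alpha>. \<Prod>i<?k. (xs ! i) ^ \<alpha> i"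
  have "pq q t xs = (\<Sum>lam\<in>partitions t ?k. \<Sum>\<alpha>\<in>{\<alpha> \<in> compositions ?k t. composition_type ?k \<alpha> = lam}.
      inverse q ^ ?m \<alpha> * ?c ^ (?m \<alpha> - 1) * ?x \<alpha>)"
    unfolding pq_def
  proof (rule sum.cong[OF refl])
    fix lam assume lam: "lam \<in> partitions t ?k"
    have "{\<alpha>. (\<forall>i\<ge>?k. \<alpha> i = 0) \<and> image_mset \<alpha> (filter_mset (\<lambda>i. \<alpha> i \<noteq> 0) (mset [0..<?k])) = lam} =
      {\<alpha> \<in> compositions ?k t. composition_type ?k \<alpha> = lam}"
    proof (intro equalityI subsetI)
      fix \<alpha> assume "\<alpha> \<in> {\<alpha>. (\<forall>i\<ge>?k. \<alpha> i = 0) \<and> image_mset \<alpha> (filter_mset (\<lambda>i. \<alpha> i \<noteq> 0) (mset [0..<?k])) = lam}"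
      then have \<alpha>: "\<forall>i\<ge>?k. \<alpha> i = 0" "composition_type ?k \<alpha> = lam" by (auto simp: composition_type_def)
      then show "\<alpha> \<in> {\<alpha> \<in> compositions ?k t. composition_type ?k \<alpha> = lam}"
        using sum_composition_type[of ?k \<alpha>] lam by (simp add: compositions_def partitions_def)
    next
      fix \<alpha> assume "\<alpha> \<in> {\<alpha> \<in> compositions ?k t. composition_type ?k \<alpha> = lam}"
      then show "\<alpha> \<in> {\<alpha>. (\<forall>i\<ge>?k. \<alpha> i = 0) \<and> image_mset \<alpha> (filter_mset (\<lambda>i. \<alpha> i \<noteq> 0) (mset [0..<?k])) = lam}"
        by (auto simp: composition_type_def compositions_def)
    qed
    then show "inverse q ^ size lam * ?c ^ (size lam - 1) * msym lam xs =
      (\<Sum>\<alpha>\<in>{\<alpha> \<in> compositions ?k t. composition_type ?k \<alpha> = lam}. inverse q ^ ?m \<alpha> * ?c ^ (?m \<alpha> - 1) * ?x \<alpha>)"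
      unfolding msym_def sum_distrib_left by simp
  qed
  also have "\<dots> = (\<Sum>\<alpha>\<in>compositions ?k t. inverse q ^ ?m \<alpha> * ?c ^ (?m \<alpha> - 1) * ?x \<alpha>)"
  proof (rule sum.group)
    show "finite (compositions ?k t)"
      using bij_betw_finite[OF bij_count_compositions, of ?k t] finite_multisets_of_size[of "{..<?k}" t] by simp
    show "finite (partitions t ?k)" by (rule finite_partitions)
    show "composition_type ?k ` compositions ?k t \<subseteq> partitions t ?k"
    proof
      fix lam assume "lam \<in> composition_type ?k ` compositions ?k t"
      then obtain \<alpha> where \<alpha>: "lam = composition_type ?k \<alpha>" "\<alpha> \<in> compositions ?k t" by blast
      have "card {i. i < ?k \<and> \<alpha> i \<noteq> 0} \<le> card {..<?k}" by (rule card_mono) auto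
      then show "lam \<in> partitions t ?k"
        using \<alpha> sum_composition_type[of ?k \<alpha>] size_composition_type[of ?k \<alpha>]
        by (auto simp: partitions_def compositions_def composition_type_def)
    qed
  qed
  finally have "?c * pq q t xs = (\<Sum>\<alpha>\<in>compositions ?k t. ?c * (inverse q ^ ?m \<alpha> * ?c ^ (?m \<alpha> - 1) * ?x \<alpha>))"
    by (simp add: sum_distrib_left)
  also have "\<dots> = (\<Sum>\<alpha>\<in>compositions ?k t. \<Prod>i<?k. fps_nth (fac (inverse q^2) (xs ! i)) (\<alpha> i))"
  proof (rule sum.cong[OF refl])
    fix \<alpha> assume \<alpha>: "\<alpha> \<in> compositions ?k t"
    have f: "fps_nth (fac (inverse q^2) x) a = (if a = 0 then 1 else inverse q * ?c) * x ^ a" for x a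
      using q0 by (simp add: fac_nth algebra_simps power2_eq_square)
    have "(\<Prod>i<?k. if \<alpha> i = 0 then 1 else inverse q * ?c) = (\<Prod>i\<in>{i. i < ?k \<and> \<alpha> i \<noteq> 0}. inverse q * ?c)"
      by (intro prod.mono_neutral_cong_right) auto
    then have p: "(\<Prod>i<?k. fps_nth (fac (inverse q^2) (xs ! i)) (\<alpha> i)) = (inverse q * ?c) ^ ?m \<alpha> * ?x \<alpha>"
      unfolding f prod.distrib size_composition_type by (simp add: power_mult_distrib)
    have "?m \<alpha> \<noteq> 0"
      using sum_composition_type[of ?k \<alpha>] \<alpha> t by (auto simp: compositions_def)
    then have "?c * ?c ^ (?m \<alpha> - 1) = ?c ^ ?m \<alpha>" by (cases "?m \<alpha>") auto
    then show "?c * (inverse q ^ ?m \<alpha> * ?c ^ (?m \<alpha> - 1) * ?x \<alpha>) =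
      (\<Prod>i<?k. fps_nth (fac (inverse q^2) (xs ! i)) (\<alpha> i))"
      unfolding p power_mult_distrib by (simp add: ac_simps)
  qed
  also have "\<dots> = (\<Sum>X\<in>multisets_of_size {..<?k} t. \<Prod>i<?k. fps_nth (fac (inverse q^2) (xs ! i)) (count X i))"
    by (rule sum.reindex_bij_betw[OF bij_count_compositions, symmetric])
  also have "\<dots> = fps_nth (\<Prod>i<?k. fac (inverse q^2) (xs ! i)) t"
    by (rule fps_prod_nth'[symmetric]) simp
  finally show ?thesis .
qed

text \<open>A convolution with the factor of \<beta>: the summand z = 0 gives the power of Q alone,
  z = t gives \<open>pq\<close>, and the rest is the sum in \<open>pQ\<close>.\<close>

lemma pQ_eq_coeff:
  assumes "q \<noteq> 0" "q - inverse q \<noteq> 0" "t > 0"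
  shows "pQ q Q b t xs = fps_nth (hw_series q Q b (\<lambda>i. xs ! i) (length xs)) t / (q - inverse q)"
proof -
  let ?P = "\<Prod>i<length xs. fac (inverse q^2) (xs ! i)" and ?c = "q - inverse q"
  have P: "fps_nth ?P z = ?c * pq q z xs" if "z > 0" for z using pq_eq_coeff[OF assms(1) that] by simp
  have P0: "fps_nth ?P 0 = 1" unfolding fps_prod_nth_0 by (simp add: fac_nth)
  have b: "1 - inverse b^2 = ?c * btilde q b" using assms(2) by (simp add: btilde_def)
  have s: "{0..t} = insert 0 (insert t {1..<t})" using assms(3) by auto
  have "fps_nth (hw_series q Q b (\<lambda>i. xs ! i) (length xs)) t =
     (\<Sum>z=0..t. fps_nth ?P z * fps_nth (fac (inverse b^2) (inverse Q)) (t - z))"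
    unfolding hw_series_def mult.commute[of "fac (inverse b^2) (inverse Q)"] fps_mult_nth ..
  also have "\<dots> = ?c * btilde q b * inverse Q ^ t + (?c * pq q t xs +
     (\<Sum>z\<in>{1..<t}. ?c * pq q z xs * (?c * btilde q b * inverse Q ^ (t - z))))"
    unfolding s using assms(3) by (simp add: P P0 fac_nth b)
  also have "\<dots> = ?c * pQ q Q b t xs"
    unfolding pQ_def by (simp add: sum_distrib_left algebra_simps)
  finally show ?thesis using assms(2) by simp
qed

text \<open>The series is symmetric in the roots; attaching it to a multiset absorbs the arbitrary
  ordering chosen by \<open>root_list\<close>.\<close>

definition hw_series_mset :: "complex \<Rightarrow> complex \<Rightarrow> complex \<Rightarrow> complex multiset \<Rightarrow> complex fps" where
  "hw_series_mset q Q \<beta> A = fac (inverse \<beta>^2) (inverse Q) * (\<Prod>x\<in>#A. fac (inverse q^2) x)"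

lemma hw_series_list: "hw_series q Q \<beta> (\<lambda>i. xs ! i) (length xs) = hw_series_mset q Q \<beta> (mset xs)"
proof -
  have "(\<Prod>x\<in>#mset xs. f x) = (\<Prod>i<length xs. f (xs ! i))" for f :: "complex \<Rightarrow> complex fps"
    using prod.list_conv_set_nth[of "map f xs"] by (simp add: atLeast0LessThan flip: prod_mset_prod_list mset_map)
  then show ?thesis by (simp add: hw_series_def hw_series_mset_def)
qed

lemma mset_root_list: "mset (root_list phi) = proots phi"
  unfolding root_list_def by (rule someI_ex) (rule ex_mset)

section \<open>Factorisation over the roots\<close>

lemma lead_coeff_linear_factors: "lead_coeff (\<Prod>x\<in>#A. [:-x, 1:]) = (1 :: complex)"
  by (induction A) (simp_all add: lead_coeff_mult del: mult_pCons_left)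

lemma linear_factorization:
  fixes p :: "complex poly"
  shows "degree p = k \<Longrightarrow> p \<noteq> 0 \<Longrightarrow> \<exists>l A. p = smult l (\<Prod>x\<in>#A. [:-x, 1:]) \<and> size A = k"
proof (induction k arbitrary: p)
  case 0
  obtain c where "p = [:c:]" by (rule degree_eq_zeroE[OF 0(1)])
  then have "p = smult c (\<Prod>x\<in>#{#}. [:-x, 1:]) \<and> size ({#} :: complex multiset) = 0" by simp
  then show ?case by blast
next
  case (Suc k)
  then have "degree p > 0" by simp
  then obtain a r where r: "p = [:-a, 1:] * r" by (rule complex_poly_root)
  have r0: "r \<noteq> 0" using Suc.prems r by auto
  have "degree p = Suc (degree r)" unfolding r using r0 by (subst degree_mult_eq) auto
  then have "degree r = k" using Suc.prems by simp
  from Suc.IH[OF this r0] obtain l A where A: "r = smult l (\<Prod>x\<in>#A. [:-x, 1:])" "size A = k"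
    by blast
  have "p = smult l (\<Prod>x\<in>#add_mset a A. [:-x, 1:]) \<and> size (add_mset a A) = Suc k"
    unfolding r A(1) using A(2) by simp
  then show ?case by blast
qed

lemma proots_linear_factors: "proots (\<Prod>x\<in>#A. [:-x, 1:]) = (A :: complex multiset)"
proof (induction A)
  case (add x A)
  have "(\<Prod>x\<in>#A. [:-x, 1:]) \<noteq> (0 :: complex poly)" by (auto simp: prod_mset_zero_iff)
  then show ?case using add by (simp add: proots_mult del: mult_pCons_left)
qed simp

lemma poly_roots_factorization:
  fixes p :: "complex poly"
  assumes "p \<noteq> 0"
  shows "smult (lead_coeff p) (\<Prod>x\<in>#proots p. [:-x, 1:]) = p" "size (proots p) = degree p"
proof -
  obtain l A where A: "smult l (\<Prod>x\<in>#A. [:-x, 1:]) = p" "size A = degree p"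
    using linear_factorization[OF refl assms] by metis
  have l: "lead_coeff p = l" unfolding A(1)[symmetric] lead_coeff_smult lead_coeff_linear_factors by simp
  then have "l \<noteq> 0" using assms by auto
  have e: "proots p = A" unfolding A(1)[symmetric] proots_smult[OF \<open>l \<noteq> 0\<close>] by (rule proots_linear_factors)
  show "smult (lead_coeff p) (\<Prod>x\<in>#proots p. [:-x, 1:]) = p" unfolding e l by (rule A(1))
  show "size (proots p) = degree p" unfolding e by (rule A(2))
qed

text \<open>Unifies the two branches of \<open>uQ\<close>: in degree 0 the product over the roots is
  empty.\<close>

lemma uQ_eq:
  assumes "q \<noteq> 0" "q - inverse q \<noteq> 0" "phi \<noteq> 0"
  shows "fst (uQ q Q phi) = lead_coeff phi * q ^ size (proots phi)"
    and "t > 0 \<Longrightarrow> snd (uQ q Q phi) t = fps_nth (hw_series_mset q Q (lead_coeff phi) (proots phi)) t / (q - inverse q)"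
proof -
  have s: "size (proots phi) = degree phi" by (rule poly_roots_factorization(2)[OF assms(3)])
  show "fst (uQ q Q phi) = lead_coeff phi * q ^ size (proots phi)"
    unfolding uQ_def s by simp
  assume t: "t > 0"
  show "snd (uQ q Q phi) t = fps_nth (hw_series_mset q Q (lead_coeff phi) (proots phi)) t / (q - inverse q)"
  proof (cases "degree phi = 0")
    case True
    then have "proots phi = {#}" using s by simp
    then show ?thesis using True t assms(2) by (simp add: uQ_def hw_series_mset_def fac_nth btilde_def)
  next
    case False
    then show ?thesis
      unfolding uQ_def
      using pQ_eq_coeff[OF assms(1,2) t, of Q "lead_coeff phi" "root_list phi"]
      by (simp add: hw_series_list mset_root_list)
  qed
qed

section \<open>The Drinfeld polynomial\<close>

definition linf :: "complex \<Rightarrow> complex fps" where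
  "linf g = 1 - fps_const g * fps_X"

lemma linf_nth: "fps_nth (f * linf g) 0 = fps_nth f 0"
  "fps_nth (f * linf g) (Suc m) = fps_nth f (Suc m) - g * fps_nth f m"
  by (simp_all add: linf_def right_diff_distrib mult.left_commute[of f])

lemma linf_nth_0: "fps_nth (linf g) 0 = 1"
  by (simp add: linf_def)

lemma linf_nonzero: "linf g \<noteq> 0"
  using linf_nth_0[of g] by (metis fps_zero_nth zero_neq_one)

lemma fac_linf: "fac e g * linf g = linf (e * g)"
  unfolding linf_def by (rule fac_mult)

definition dilate :: "complex \<Rightarrow> complex fps \<Rightarrow> complex fps" where
  "dilate e f = Abs_fps (\<lambda>n. e ^ n * fps_nth f n)"

lemma dilate_nth: "fps_nth (dilate e f) n = e ^ n * fps_nth f n"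
  by (simp add: dilate_def)

lemma dilate_mult: "dilate e (f * g) = dilate e f * dilate e g"
proof (rule fps_ext)
  fix n
  have "(\<Sum>i=0..n. e ^ n * (fps_nth f i * fps_nth g (n - i))) =
      (\<Sum>i=0..n. (e ^ i * fps_nth f i) * (e ^ (n - i) * fps_nth g (n - i)))"
  proof (rule sum.cong[OF refl])
    fix i assume "i \<in> {0..n}"
    then have "e ^ n = e ^ i * e ^ (n - i)" by (simp flip: power_add)
    then show "e ^ n * (fps_nth f i * fps_nth g (n - i)) = (e ^ i * fps_nth f i) * (e ^ (n - i) * fps_nth g (n - i))"
      by simp
  qed
  then show "fps_nth (dilate e (f * g)) n = fps_nth (dilate e f * dilate e g) n"
    by (simp add: dilate_nth fps_mult_nth sum_distrib_left)
qed

lemma dilate_linf: "dilate e (linf g) = linf (e * g)"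
proof (rule fps_ext)
  fix n
  have "fps_nth (linf h) n = (if n = 0 then 1 else if n = 1 then - h else 0)" for h
    by (cases n) (auto simp: linf_def)
  then show "fps_nth (dilate e (linf g)) n = fps_nth (linf (e * g)) n"
    by (simp add: dilate_nth)
qed

lemma dilate_one: "dilate e 1 = 1"
  by (rule fps_ext) (simp add: dilate_nth)

text \<open>\<open>P\<close> plays the part of the Drinfeld polynomial with reversed coefficients,
  so that its constant term is 1 and zero roots are invisible in it.\<close>

definition drinfeld_eq :: "complex \<Rightarrow> complex \<Rightarrow> complex fps \<Rightarrow> complex \<Rightarrow> complex fps \<Rightarrow> bool" where
  "drinfeld_eq q Q \<Psi> \<eta> P \<longleftrightarrow> fps_nth P 0 = 1 \<and> linf (inverse Q) * \<Psi> * P = linf \<eta> * dilate (inverse q^2) P"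

text \<open>Here \<open>e\<close> is q^-2 and \<open>F\<close> lists the coefficients of (1 - z/Q)
  \<Psi>. The recursion solves the equation for its top coefficient, whose factor e^n - 1 is nonzero
  for positive n when q is not a root of unity.\<close>

fun drinfeld_coeff :: "(nat \<Rightarrow> complex) \<Rightarrow> complex \<Rightarrow> complex \<Rightarrow> nat \<Rightarrow> complex" where
  "drinfeld_coeff F \<eta> e n = (if n = 0 then 1 else
     ((\<Sum>i<n. F (n - i) * drinfeld_coeff F \<eta> e i) + \<eta> * e ^ (n - 1) * drinfeld_coeff F \<eta> e (n - 1)) / (e ^ n - 1))"

declare drinfeld_coeff.simps [simp del]

lemma drinfeld_eq_nth:
  assumes "fps_nth \<Psi> 0 = 1"
  shows "drinfeld_eq q Q \<Psi> \<eta> P \<longleftrightarrow> fps_nth P 0 = 1 \<and>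
    (\<forall>m. ((inverse q^2) ^ Suc m - 1) * fps_nth P (Suc m) =
      (\<Sum>i<Suc m. fps_nth (linf (inverse Q) * \<Psi>) (Suc m - i) * fps_nth P i) + \<eta> * (inverse q^2) ^ m * fps_nth P m)"
proof -
  let ?e = "inverse q^2"
  have gen: "fps_nth (F * P) (Suc m) = fps_nth P (Suc m) + (\<Sum>i<Suc m. fps_nth F (Suc m - i) * fps_nth P i)"
    if "fps_nth F 0 = 1" for F :: "complex fps" and m
  proof -
    have "fps_nth (P * F) (Suc m) = (\<Sum>i<Suc (Suc m). fps_nth P i * fps_nth F (Suc m - i))"
      unfolding fps_mult_nth by (intro sum.cong) auto
    then show ?thesis using that by (simp add: mult.commute)
  qed
  have "fps_nth (linf (inverse Q) * \<Psi>) 0 = 1" using assms by (simp add: linf_nth_0)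
  note L = gen[OF this]
  have R: "fps_nth (linf \<eta> * dilate ?e P) (Suc m) = ?e ^ Suc m * fps_nth P (Suc m) - \<eta> * ?e ^ m * fps_nth P m" for m
    unfolding mult.commute[of "linf \<eta>"] linf_nth dilate_nth by simp
  have Z: "fps_nth (linf (inverse Q) * \<Psi> * P) 0 = fps_nth (linf \<eta> * dilate ?e P) 0"
    using assms by (simp add: linf_nth_0 dilate_nth)
  have "linf (inverse Q) * \<Psi> * P = linf \<eta> * dilate ?e P \<longleftrightarrow>
    (\<forall>m. fps_nth (linf (inverse Q) * \<Psi> * P) (Suc m) = fps_nth (linf \<eta> * dilate ?e P) (Suc m))"
    using Z by (metis fps_eq_iff not0_implies_Suc)
  also have "\<dots> \<longleftrightarrow> (\<forall>m. (?e ^ Suc m - 1) * fps_nth P (Suc m) =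
      (\<Sum>i<Suc m. fps_nth (linf (inverse Q) * \<Psi>) (Suc m - i) * fps_nth P i) + \<eta> * ?e ^ m * fps_nth P m)"
    unfolding L R by (intro all_cong1) (auto simp: algebra_simps)
  finally show ?thesis unfolding drinfeld_eq_def by blast
qed

lemma drinfeld_eq_exists:
  assumes q0: "q \<noteq> 0" and nroot: "\<not> root_of_unity q" and "fps_nth \<Psi> 0 = 1"
  shows "\<exists>P. drinfeld_eq q Q \<Psi> \<eta> P"
proof -
  let ?e = "inverse q^2" and ?F = "fps_nth (linf (inverse Q) * \<Psi>)"
  let ?P = "Abs_fps (drinfeld_coeff ?F \<eta> ?e)"
  have "(?e ^ Suc m - 1) * fps_nth ?P (Suc m) =
      (\<Sum>i<Suc m. ?F (Suc m - i) * fps_nth ?P i) + \<eta> * ?e ^ m * fps_nth ?P m" for m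
  proof -
    have "?e ^ Suc m - 1 \<noteq> 0" using power_neq_one[OF q0 nroot, of "Suc m"] by simp
    moreover have "drinfeld_coeff ?F \<eta> ?e (Suc m) = ((\<Sum>i<Suc m. ?F (Suc m - i) * drinfeld_coeff ?F \<eta> ?e i) +
        \<eta> * ?e ^ m * drinfeld_coeff ?F \<eta> ?e m) / (?e ^ Suc m - 1)"
      by (subst drinfeld_coeff.simps) simp
    moreover have "a * x = s" if "a \<noteq> 0" "x = s / a" for a x s :: complex using that by simp
    ultimately show ?thesis unfolding fps_nth_Abs_fps by blast
  qed
  moreover have "fps_nth ?P 0 = 1" by (simp add: drinfeld_coeff.simps)
  ultimately show ?thesis unfolding drinfeld_eq_nth[OF assms(3)] by blast
qed

lemma drinfeld_eq_unique:
  assumes q0: "q \<noteq> 0" and nroot: "\<not> root_of_unity q"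
    and \<Psi>0: "fps_nth \<Psi> 0 = 1" and P: "drinfeld_eq q Q \<Psi> \<eta> P" "drinfeld_eq q Q \<Psi> \<eta> P'"
  shows "P = P'"
proof (rule fps_ext)
  fix n
  show "fps_nth P n = fps_nth P' n"
  proof (induction n rule: less_induct)
    case (less n)
    show ?case
    proof (cases n)
      case 0
      then show ?thesis using P unfolding drinfeld_eq_def by simp
    next
      case (Suc m)
      have "((inverse q^2) ^ Suc m - 1) * fps_nth P (Suc m) = ((inverse q^2) ^ Suc m - 1) * fps_nth P' (Suc m)"
        using P less unfolding drinfeld_eq_nth[OF \<Psi>0] Suc by simp
      then show ?thesis using power_neq_one[OF q0 nroot, of "Suc m"] Suc by simp
    qed
  qed
qed

text \<open>The dilation carries 1 - q^2 \<eta> z to 1 - \<eta> z. So the dilated new factor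
  supplies the old prefactor, and the undilated one becomes the new prefactor.\<close>

lemma drinfeld_eq_step:
  assumes q0: "q \<noteq> 0" and P: "drinfeld_eq q Q \<Psi> \<eta> P"
  shows "drinfeld_eq q Q \<Psi> (q^2 * \<eta>) (P * linf (q^2 * \<eta>))"
proof -
  have d: "dilate (inverse q^2) (linf (q^2 * \<eta>)) = linf \<eta>"
    unfolding dilate_linf using q0 by (simp flip: mult.assoc power_mult_distrib)
  have "linf (inverse Q) * \<Psi> * (P * linf (q^2 * \<eta>)) = linf (inverse Q) * \<Psi> * P * linf (q^2 * \<eta>)" by (simp only: mult.assoc)
  also have "\<dots> = linf \<eta> * dilate (inverse q^2) P * linf (q^2 * \<eta>)"
    using P unfolding drinfeld_eq_def by simp
  also have "\<dots> = linf (q^2 * \<eta>) * dilate (inverse q^2) (P * linf (q^2 * \<eta>))"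
    unfolding dilate_mult d by (simp only: ac_simps)
  finally have "linf (inverse Q) * \<Psi> * (P * linf (q^2 * \<eta>)) =
    linf (q^2 * \<eta>) * dilate (inverse q^2) (P * linf (q^2 * \<eta>))" .
  moreover have "fps_nth (P * linf (q^2 * \<eta>)) 0 = 1"
    using P unfolding drinfeld_eq_def linf_nth by blast
  ultimately show ?thesis unfolding drinfeld_eq_def by blast
qed

definition linear_prod :: "complex multiset \<Rightarrow> complex fps" where
  "linear_prod A = (\<Prod>x\<in>#A. linf x)"

lemma linear_prod_0: "fps_nth (linear_prod A) 0 = 1"
  by (induction A) (simp_all add: linear_prod_def linf_nth_0)

lemma hw_series_mset_0: "fps_nth (hw_series_mset q Q \<beta> A) 0 = 1"
proof -
  have "fps_nth (\<Prod>x\<in>#A. fac (inverse q^2) x) 0 = 1"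
    by (induction A) (simp_all add: fac_nth)
  then show ?thesis by (simp add: hw_series_mset_def fac_nth)
qed

text \<open>Multiplying each factor (1 - q^-2 x z)/(1 - x z) by 1 - x z leaves the dilated linear
  factor; the factor of \<beta> supplies 1 - \<eta> z.\<close>

lemma drinfeld_eq_hw_series:
  "drinfeld_eq q Q (hw_series_mset q Q \<beta> A) (inverse \<beta>^2 * inverse Q) (linear_prod A)"
proof -
  have 1: "(\<Prod>x\<in>#A. fac (inverse q^2) x) * linear_prod A = dilate (inverse q^2) (linear_prod A)"
  proof (induction A)
    case (add x A)
    have "(\<Prod>x\<in>#add_mset x A. fac (inverse q^2) x) * linear_prod (add_mset x A) =
      (fac (inverse q^2) x * linf x) * ((\<Prod>x\<in>#A. fac (inverse q^2) x) * linear_prod A)"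
      by (simp add: linear_prod_def ac_simps)
    then show ?case unfolding add fac_linf by (simp add: linear_prod_def dilate_mult dilate_linf)
  qed (simp add: linear_prod_def dilate_one)
  have "linf (inverse Q) * hw_series_mset q Q \<beta> A * linear_prod A =
    (fac (inverse \<beta>^2) (inverse Q) * linf (inverse Q)) * ((\<Prod>x\<in>#A. fac (inverse q^2) x) * linear_prod A)"
    unfolding hw_series_mset_def by (simp only: ac_simps)
  then show ?thesis unfolding 1 fac_linf drinfeld_eq_def by (simp add: linear_prod_0)
qed

section \<open>Congruence modulo a power of the variable, and truncation\<close>

definition agree :: "nat \<Rightarrow> complex fps \<Rightarrow> complex fps \<Rightarrow> bool" where
  "agree k f g \<longleftrightarrow> (\<forall>i\<le>k. fps_nth f i = fps_nth g i)"

lemma agree_mult: "agree k f f' \<Longrightarrow> agree k g g' \<Longrightarrow> agree k (f * g) (f' * g')"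
  unfolding agree_def fps_mult_nth by (intro allI impI sum.cong) auto

lemma agree_dilate: "agree k f f' \<Longrightarrow> agree k (dilate e f) (dilate e f')"
  unfolding agree_def dilate_nth by simp

lemma agree_cancel:
  assumes "agree k (f * h) (g * h)" "fps_nth h 0 = 1"
  shows "agree k f g"
proof -
  have h: "h * inverse h = 1" using assms(2) by (intro inverse_mult_eq_1') simp
  have "agree k (f * h * inverse h) (g * h * inverse h)"
    by (rule agree_mult[OF assms(1)]) (simp add: agree_def)
  then show ?thesis unfolding mult.assoc h by simp
qed

text \<open>Modulo z^(k+1), \<Psi> is recovered from \<open>P\<close> by division, as
  \<open>P\<close> and 1 - z/Q have constant term 1.\<close>

lemma drinfeld_eq_agree:
  assumes P: "drinfeld_eq q Q \<Psi> \<eta> P" "drinfeld_eq q Q \<Psi>' \<eta> P'" and a: "agree k P P'"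
  shows "agree k \<Psi> \<Psi>'"
proof -
  have s: "agree k P' P" using a by (simp add: agree_def)
  have r: "agree k f f" for f by (simp add: agree_def)
  have t: "agree k f g \<Longrightarrow> agree k g h \<Longrightarrow> agree k f h" for f g h by (simp add: agree_def)
  have "agree k (linf \<eta> * dilate (inverse q^2) P) (linf \<eta> * dilate (inverse q^2) P')"
    by (intro agree_mult agree_dilate a r)
  then have "agree k (linf (inverse Q) * \<Psi> * P) (linf (inverse Q) * \<Psi>' * P')" using P unfolding drinfeld_eq_def by simp
  moreover have "agree k (linf (inverse Q) * \<Psi>' * P') (linf (inverse Q) * \<Psi>' * P)" by (intro agree_mult s r)
  ultimately have "agree k (linf (inverse Q) * \<Psi> * P) (linf (inverse Q) * \<Psi>' * P)" by (rule t)
  moreover have "fps_nth P 0 = 1" using P(1) unfolding drinfeld_eq_def by blast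
  ultimately have "agree k (linf (inverse Q) * \<Psi>) (linf (inverse Q) * \<Psi>')" by (rule agree_cancel)
  then have "agree k (\<Psi> * linf (inverse Q)) (\<Psi>' * linf (inverse Q))" by (simp only: mult.commute)
  then show ?thesis by (rule agree_cancel) (rule linf_nth_0)
qed

lemma linear_prod_poly: "linear_prod A = fps_of_poly (\<Prod>x\<in>#A. [:1, -x:])"
proof (induction A)
  case (add x A)
  have "fps_of_poly [:1, -x:] = linf x" by (simp add: linf_def fps_of_poly_pCons mult.commute flip: fps_const_neg)
  then show ?case using add by (simp add: linear_prod_def fps_of_poly_mult del: mult_pCons_left)
qed (simp add: linear_prod_def)

lemma poly_linear_prod: "poly (\<Prod>x\<in>#A. [:1, -x:]) y = (\<Prod>x\<in>#A. 1 - x * y)" for y :: complex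
  by (induction A) (auto simp: algebra_simps)

lemma reversed_linear_prod:
  fixes y :: complex
  assumes "y \<noteq> 0"
  shows "poly (\<Prod>x\<in>#A. [:-x, 1:]) y = y ^ size A * poly (\<Prod>x\<in>#A. [:1, -x:]) (inverse y)"
  using assms by (induction A) (auto simp: field_simps)

text \<open>The roots are those of the reversed polynomial, which is monic of degree exactly
  \<open>k\<close> because \<open>p 0\<close> is 1. If the truncation has smaller degree, the
  missing roots are zeros in \<open>A\<close>, so the size is always \<open>k\<close>.\<close>

lemma truncation_roots:
  assumes "p 0 = (1 :: complex)"
  obtains A where "size A = k" "(\<Prod>x\<in>#A. [:1, -x:]) = (\<Sum>i\<le>k. monom (p i) i)"
proof -
  define m where "m = (\<Sum>i\<le>k. monom (p i) (k - i))"
  have c: "coeff m j = (if j \<le> k then p (k - j) else 0)" for j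
  proof -
    have "coeff m j = (\<Sum>i\<le>k. if i = k - j \<and> j \<le> k then p i else 0)"
      unfolding m_def coeff_sum coeff_monom by (intro sum.cong) auto
    then show ?thesis by simp
  qed
  have "m \<noteq> 0" using c[of k] assms by auto
  moreover have "degree m = k"
    by (intro antisym degree_le le_degree) (auto simp: c assms)
  ultimately obtain l A where A: "m = smult l (\<Prod>x\<in>#A. [:-x, 1:])" "size A = k"
    using linear_factorization[of m k] by blast
  have "lead_coeff m = 1" using \<open>degree m = k\<close> c[of k] assms by simp
  then have l: "l = 1" unfolding A(1) lead_coeff_smult lead_coeff_linear_factors by simp
  have "poly (\<Prod>x\<in>#A. [:1, -x:]) y = poly (\<Sum>i\<le>k. monom (p i) i) y" for y
  proof (cases "y = 0")
    case True
    have "poly (\<Sum>i\<le>k. monom (p i) i) 0 = (\<Sum>i\<le>k. if i = 0 then p 0 else 0)"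
      unfolding poly_sum poly_monom by (intro sum.cong) auto
    then show ?thesis using True assms unfolding poly_linear_prod by simp
  next
    case False
    have "poly m (inverse y) = (\<Sum>i\<le>k. p i * inverse y ^ (k - i))"
      unfolding m_def poly_sum poly_monom ..
    then have "y ^ k * poly m (inverse y) = (\<Sum>i\<le>k. p i * (y ^ k * inverse y ^ (k - i)))"
      by (simp add: sum_distrib_left mult.left_commute)
    also have "\<dots> = (\<Sum>i\<le>k. p i * y ^ i)"
    proof (rule sum.cong[OF refl])
      fix i assume "i \<in> {..k}"
      then have "y ^ k = y ^ i * y ^ (k - i)" by (simp flip: power_add)
      then show "p i * (y ^ k * inverse y ^ (k - i)) = p i * y ^ i"
        using False by (simp add: power_inverse)
    qed
    also have "\<dots> = poly (\<Sum>i\<le>k. monom (p i) i) y"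
      unfolding poly_sum poly_monom ..
    finally have "poly (\<Sum>i\<le>k. monom (p i) i) y = y ^ k * poly m (inverse y)" by simp
    also have "\<dots> = y ^ k * (inverse y ^ k * poly (\<Prod>x\<in>#A. [:1, -x:]) y)"
      using reversed_linear_prod[of "inverse y" A] False A l by simp
    finally show ?thesis using False by (simp add: power_inverse)
  qed
  then have "(\<Prod>x\<in>#A. [:1, -x:]) = (\<Sum>i\<le>k. monom (p i) i)"
    unfolding poly_eq_poly_eq_iff[symmetric] by (rule ext)
  then show thesis by (rule that[OF A(2)])
qed

lemma qfac_nonzero:
  assumes "q \<noteq> 0" "\<not> root_of_unity q"
  shows "qfac q m \<noteq> 0"
proof -
  have "qint q (Suc l) \<noteq> 0" for l
  proof
    assume "qint q (Suc l) = 0"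
    then have "q ^ Suc l = inverse q ^ Suc l"
      using q_minus_inverse[OF assms] by (simp add: qint_def del: power_Suc)
    then have "inverse q ^ Suc l * inverse q ^ Suc l = inverse q ^ Suc l * q ^ Suc l" by simp
    also have "\<dots> = 1" using assms(1) by (simp add: power_inverse del: power_Suc)
    finally have "(inverse q^2) ^ Suc l = 1"
      by (simp add: power2_eq_square power_mult_distrib del: power_Suc)
    then show False using power_neq_one[OF assms, of "Suc l"] by simp
  qed
  then show ?thesis unfolding qfac_def by simp
qed

lemma vacuum_functional_hw_series_mset:
  assumes "q \<noteq> 0" "q - inverse q \<noteq> 0" "Q \<noteq> 0" "\<beta> \<noteq> 0"
  obtains \<omega> where
    "vacuum_functional q Q (\<beta> * q ^ size A) (\<lambda>t. fps_nth (hw_series_mset q Q \<beta> A) t / (q - inverse q)) \<omega>"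
    "\<omega> (replicate (size A) (GP 0) @ replicate (size A) (GM 0)) =
      (qfac q (size A))^2 * (\<Prod>x\<in>#A. inverse \<beta> - \<beta> * Q * x)"
    "\<And>I w. finite I \<Longrightarrow> 2 ^ size A < card I \<Longrightarrow>
       \<exists>c. (\<exists>i\<in>I. c i \<noteq> 0) \<and> (\<forall>b. (\<Sum>i\<in>I. c i * \<omega> (b @ w (i :: gen list))) = 0)"
proof -
  obtain xs where xs: "mset xs = A" using ex_mset by blast
  have p: "(\<Prod>i<length xs. f (xs ! i)) = (\<Prod>x\<in>#A. f x)" for f :: "complex \<Rightarrow> complex"
    using prod.list_conv_set_nth[of "map f xs"] by (simp add: atLeast0LessThan flip: prod_mset_prod_list mset_map xs)
  have s: "length xs = size A" using xs by auto
  have h: "hw_series q Q \<beta> (\<lambda>i. xs ! i) (size A) = hw_series_mset q Q \<beta> A"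
    using hw_series_list[of q Q \<beta> xs] unfolding xs s .
  obtain \<omega> where \<omega>:
    "vacuum_functional q Q (\<beta> * q ^ length xs) (\<lambda>t. fps_nth (hw_series q Q \<beta> (\<lambda>i. xs ! i) (length xs)) t / (q - inverse q)) \<omega>"
    "\<omega> (replicate (length xs) (GP 0) @ replicate (length xs) (GM 0)) =
      (qfac q (length xs))^2 * (\<Prod>i<length xs. inverse \<beta> - \<beta> * Q * xs ! i)"
    "\<And>I w. finite I \<Longrightarrow> 2 ^ length xs < card I \<Longrightarrow>
       \<exists>c. (\<exists>i\<in>I. c i \<noteq> 0) \<and> (\<forall>b. (\<Sum>i\<in>I. c i * \<omega> (b @ w (i :: gen list))) = 0)"
    by (rule vacuum_functional_hw_series[OF assms, where k = "length xs" and \<gamma> = "\<lambda>i. xs ! i"]) (rule that)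
  show thesis
  proof (rule that)
    show "vacuum_functional q Q (\<beta> * q ^ size A) (\<lambda>t. fps_nth (hw_series_mset q Q \<beta> A) t / (q - inverse q)) \<omega>"
      using \<omega>(1) unfolding s h .
    show "\<omega> (replicate (size A) (GP 0) @ replicate (size A) (GM 0)) =
        (qfac q (size A))^2 * (\<Prod>x\<in>#A. inverse \<beta> - \<beta> * Q * x)"
      using \<omega>(2) p[of "\<lambda>x. inverse \<beta> - \<beta> * Q * x"] unfolding s by simp
    show "\<exists>c. (\<exists>i\<in>I. c i \<noteq> 0) \<and> (\<forall>b. (\<Sum>i\<in>I. c i * \<omega> (b @ w (i :: gen list))) = 0)"
      if "finite I" "2 ^ size A < card I" for I w
      by (rule \<omega>(3)) (use that s in simp_all)
  qed
qed

section \<open>From expectations to the Drinfeld polynomial\<close>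

context
  fixes q Q :: complex
  assumes q0: "q \<noteq> 0" and nroot: "\<not> root_of_unity q" and Q0: "Q \<noteq> 0"
begin

lemma c0: "q - inverse q \<noteq> 0" by (rule q_minus_inverse[OF q0 nroot])

text \<open>Prescribing \<mu> forces \<beta> once the number k of roots is fixed, and every further
  root multiplies \<eta> by q^2.\<close>

lemma beta_shift:
  assumes "\<mu> \<noteq> 0" "\<beta> = \<mu> * inverse q ^ k"
  shows "inverse \<beta>^2 * inverse Q = (q^2) ^ k * (inverse \<mu>^2 * inverse Q)" "\<beta> * q ^ k = \<mu>" "\<beta> \<noteq> 0"
  using assms q0
  by (auto simp: power_inverse power_mult_distrib field_simps simp flip: power_mult)

text \<open>The words \<open>X\<^sup>+\<^sub>0 ^ k X\<^sup>-\<^sub>0 ^ k\<close> only see \<open>u 1, \<dots>, u k\<close>, so their expectation may be computed in the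
  module attached to the roots of the truncation of \<open>P\<close> at degree \<open>k\<close>.\<close>

lemma power_expectation_zero:
  assumes m0: "\<mu> \<noteq> 0"
    and vac: "vacuum_functional q Q \<mu> u \<omega>"
    and \<Psi>: "\<Psi> = Abs_fps (\<lambda>t. if t = 0 then 1 else (q - inverse q) * u t)"
    and \<eta>: "\<eta> = (q^2) ^ Suc k * (inverse \<mu>^2 * inverse Q)"
    and P: "drinfeld_eq q Q \<Psi> \<eta> (P * linf \<eta>)"
    and z: "\<omega> (replicate (Suc k) (GP 0) @ replicate (Suc k) (GM 0)) = 0"
  shows "fps_nth P (Suc k) = 0"
proof -
  let ?K = "Suc k"
  define \<beta> where "\<beta> = \<mu> * inverse q ^ ?K"
  have \<beta>: "inverse \<beta>^2 * inverse Q = \<eta>" "\<beta> * q ^ ?K = \<mu>" "\<beta> \<noteq> 0"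
    using beta_shift[OF m0 \<beta>_def] \<eta> by simp_all
  have \<eta>0: "\<eta> \<noteq> 0" using \<beta>(1,3) Q0 by (metis inverse_nonzero_iff_nonzero mult_eq_0_iff power_eq_0_iff)
  let ?p = "fps_nth (P * linf \<eta>)"
  have p0: "?p 0 = 1" using P unfolding drinfeld_eq_def by blast
  obtain A where A: "size A = ?K" "(\<Prod>x\<in>#A. [:1, -x:]) = (\<Sum>i\<le>?K. monom (?p i) i)"
    by (rule truncation_roots[where p = ?p and k = ?K, OF p0]) (rule that)
  have "fps_nth (linear_prod A) i = ?p i" if "i \<le> ?K" for i
    unfolding linear_prod_poly A(2) using that by (simp add: coeff_sum del: sum.atMost_Suc)
  then have ag: "agree ?K (P * linf \<eta>) (linear_prod A)" unfolding agree_def by simp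
  have ag': "agree ?K \<Psi> (hw_series_mset q Q \<beta> A)"
    using drinfeld_eq_agree[OF P _ ag] drinfeld_eq_hw_series[of q Q \<beta> A] \<beta>(1) by simp
  obtain \<omega>' where \<omega>': "vacuum_functional q Q (\<beta> * q ^ size A) (\<lambda>t. fps_nth (hw_series_mset q Q \<beta> A) t / (q - inverse q)) \<omega>'"
    "\<omega>' (replicate (size A) (GP 0) @ replicate (size A) (GM 0)) =
      (qfac q (size A))^2 * (\<Prod>x\<in>#A. inverse \<beta> - \<beta> * Q * x)"
    by (rule vacuum_functional_hw_series_mset[OF q0 c0 Q0 \<beta>(3), of A]) (rule that)
  have w: "weight (replicate i (GP 0) @ replicate j (GM 0)) = i" for i j
  proof (induction i)
    case 0
    show ?case by (induction j) auto
  qed simp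
  have "\<omega> (replicate ?K (GP 0) @ replicate ?K (GM 0)) = \<omega>' (replicate ?K (GP 0) @ replicate ?K (GM 0))"
  proof (rule vacuum_functional_agree[OF q0 c0 m0 vac])
    show "vacuum_functional q Q \<mu> (\<lambda>t. fps_nth (hw_series_mset q Q \<beta> A) t / (q - inverse q)) \<omega>'"
      using \<omega>'(1) unfolding A(1) \<beta>(2) .
    fix t assume "0 < t" "t \<le> weight (replicate ?K (GP 0) @ replicate ?K (GM 0))"
    then have t: "0 < t" "t \<le> ?K" unfolding w by auto
    then have "fps_nth \<Psi> t = fps_nth (hw_series_mset q Q \<beta> A) t"
      using ag' unfolding agree_def by blast
    then show "u t = fps_nth (hw_series_mset q Q \<beta> A) t / (q - inverse q)"
      unfolding \<Psi> using t c0 by (simp add: field_simps)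
  qed
  then have "(qfac q ?K)^2 * (\<Prod>x\<in>#A. inverse \<beta> - \<beta> * Q * x) = 0"
    using z \<omega>'(2) unfolding A(1) by simp
  then have "(\<Prod>x\<in>#A. inverse \<beta> - \<beta> * Q * x) = 0" using qfac_nonzero[OF q0 nroot] by simp
  \<comment> \<open>The quantum factorial is nonzero, so one of the other factors vanishes; this
    makes \<eta> a root of the reversed truncation and 1/\<eta> a zero of the truncation
    itself.\<close>
  then obtain x where x: "x \<in># A" "inverse \<beta> - \<beta> * Q * x = 0" by (auto simp: prod_mset_zero_iff)
  then have "x = \<eta>" using \<beta>(3) Q0 unfolding \<beta>(1)[symmetric] by (simp add: field_simps power2_eq_square)
  then have "(\<Prod>x\<in>#A. 1 - x * inverse \<eta>) = 0" using x(1) \<eta>0 by (auto simp: prod_mset_zero_iff intro!: image_eqI[of _ _ \<eta>])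
  then have "poly (\<Prod>x\<in>#A. [:1, -x:]) (inverse \<eta>) = 0" unfolding poly_linear_prod .
  then have 0: "(\<Sum>i\<le>?K. ?p i * inverse \<eta> ^ i) = 0"
    unfolding A(2) poly_sum poly_monom .
  \<comment> \<open>Multiplication by 1 - \<eta> z makes consecutive terms cancel at z = 1/\<eta>,
    so the value of a truncation collapses to a single coefficient of \<open>P\<close>.\<close>
  have "(\<Sum>i\<le>m. ?p i * inverse \<eta> ^ i) = fps_nth P m * inverse \<eta> ^ m" for m
  proof (induction m)
    case (Suc m)
    have "\<eta> * inverse \<eta> ^ Suc m = inverse \<eta> ^ m" using \<eta>0 by simp
    then show ?case unfolding sum.atMost_Suc Suc linf_nth
      by (simp add: left_diff_distrib mult.assoc mult.left_commute[of \<eta>] del: power_Suc)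
  qed (simp add: linf_nth_0)
  then show ?thesis using 0 \<eta>0 by simp
qed

text \<open>\<open>P k\<close> solves the equation for \<eta> = q^(2k) \<mu>^-2 Q^-1. Nilpotency
  makes coefficient k + 1 of \<open>P k\<close> vanish for every k from \<open>K\<close> on, and the
  link between \<open>P k\<close> and \<open>P (k+1)\<close> spreads this to all higher
  coefficients. So \<open>P K\<close> is a polynomial of degree at most \<open>K\<close>, and its
  reversed roots, padded by zeros to \<open>K\<close> of them, reproduce \<Psi>.\<close>

lemma vacuum_drinfeld_polynomial:
  assumes m0: "\<mu> \<noteq> 0"
    and vac: "vacuum_functional q Q \<mu> u \<omega>"
    and low: "\<And>b r. K \<le> r \<Longrightarrow> \<omega> (b @ replicate r (GM 0)) = 0"
  shows "\<exists>A \<beta>. \<mu> = \<beta> * q ^ size A \<and> \<beta> \<noteq> 0 \<and>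
    (\<forall>t>0. u t = fps_nth (hw_series_mset q Q \<beta> A) t / (q - inverse q))"
proof -
  define \<Psi> where "\<Psi> = Abs_fps (\<lambda>t. if t = 0 then 1 else (q - inverse q) * u t)"
  have \<Psi>0: "fps_nth \<Psi> 0 = 1" by (simp add: \<Psi>_def)
  define \<theta> where "\<theta> k = (q^2) ^ k * (inverse \<mu>^2 * inverse Q)" for k :: nat
  have \<theta>S: "\<theta> (Suc k) = q^2 * \<theta> k" for k by (simp add: \<theta>_def mult.assoc)
  obtain P0 where P0: "drinfeld_eq q Q \<Psi> (\<theta> 0) P0" using drinfeld_eq_exists[OF q0 nroot \<Psi>0] by blast
  define P where "P = rec_nat P0 (\<lambda>k f. f * linf (\<theta> (Suc k)))"
  have PS: "P (Suc k) = P k * linf (\<theta> (Suc k))" for k by (simp add: P_def)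
  have P: "drinfeld_eq q Q \<Psi> (\<theta> k) (P k)" for k
  proof (induction k)
    case 0
    show ?case using P0 by (simp add: P_def)
  next
    case (Suc k)
    show ?case using drinfeld_eq_step[OF q0 Suc] unfolding PS \<theta>S .
  qed
  have base: "fps_nth (P k) (Suc k) = 0" if "K \<le> k" for k
  proof (rule power_expectation_zero[OF m0 vac \<Psi>_def \<theta>_def[of "Suc k"]])
    show "drinfeld_eq q Q \<Psi> (\<theta> (Suc k)) (P k * linf (\<theta> (Suc k)))" using P[of "Suc k"] unfolding PS .
    show "\<omega> (replicate (Suc k) (GP 0) @ replicate (Suc k) (GM 0)) = 0" by (rule low) (use that in simp)
  qed
  \<comment> \<open>Coefficient k + i + 2 of \<open>P (k+1)\<close> is that of \<open>P k\<close>
    minus a multiple of coefficient k + i + 1 of \<open>P k\<close>. The induction hypothesis at k +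
    1 and at k kills the first and the last of these, hence also the middle one.\<close>
  have van: "fps_nth (P k) (Suc (k + i)) = 0" if "K \<le> k" for k i
    using that
  proof (induction i arbitrary: k)
    case 0
    then show ?case using base by simp
  next
    case (Suc i)
    have "fps_nth (P (Suc k)) (Suc (Suc k + i)) = 0" using Suc.IH[of "Suc k"] Suc.prems by simp
    then show ?case using Suc.IH[OF Suc.prems] unfolding PS linf_nth by simp
  qed
  define \<beta> where "\<beta> = \<mu> * inverse q ^ K"
  have \<beta>: "inverse \<beta>^2 * inverse Q = \<theta> K" "\<beta> * q ^ K = \<mu>" "\<beta> \<noteq> 0"
    using beta_shift[OF m0 \<beta>_def] unfolding \<theta>_def by simp_all
  have p0: "fps_nth (P K) 0 = 1" using P unfolding drinfeld_eq_def by blast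
  obtain A where A: "size A = K" "(\<Prod>x\<in>#A. [:1, -x:]) = (\<Sum>i\<le>K. monom (fps_nth (P K) i) i)"
    by (rule truncation_roots[where p = "fps_nth (P K)" and k = K, OF p0]) (rule that)
  have "linear_prod A = P K"
  proof (rule fps_ext)
    fix i
    show "fps_nth (linear_prod A) i = fps_nth (P K) i"
    proof (cases "i \<le> K")
      case True
      then show ?thesis unfolding linear_prod_poly A(2) by (simp add: coeff_sum)
    next
      case False
      then obtain j where j: "i = Suc (K + j)" by (metis less_iff_Suc_add not_le)
      show ?thesis unfolding linear_prod_poly A(2) j using van[of K j] by (simp add: coeff_sum)
    qed
  qed
  then have D: "drinfeld_eq q Q (hw_series_mset q Q \<beta> A) (\<theta> K) (P K)"
    using drinfeld_eq_hw_series[of q Q \<beta> A] \<beta>(1) by simp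
  have "agree t (P K) (P K)" for t by (simp add: agree_def)
  then have "agree t \<Psi> (hw_series_mset q Q \<beta> A)" for t
    by (rule drinfeld_eq_agree[OF P D])
  then have e: "fps_nth \<Psi> t = fps_nth (hw_series_mset q Q \<beta> A) t" for t
    unfolding agree_def by blast
  have "u t = fps_nth (hw_series_mset q Q \<beta> A) t / (q - inverse q)" if "t > 0" for t
    using e[of t] that c0 unfolding \<Psi>_def by (simp add: field_simps)
  then show ?thesis using \<beta>(2,3) A(1) by (intro exI[of _ A] exI[of _ \<beta>]) simp
qed

section \<open>Cancelling excluded roots\<close>

lemma fac_absorb: "fac b g * fac e (b * g) = fac (e * b) g"
proof -
  have "(fac b g * fac e (b * g)) * linf g = fac e (b * g) * (fac b g * linf g)" by (simp only: ac_simps)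
  also have "\<dots> = fac (e * b) g * linf g" unfolding fac_linf by (simp add: mult.assoc)
  finally show ?thesis by (rule mult_right_cancel[OF linf_nonzero, THEN iffD1])
qed

text \<open>The numerator contributed by \<beta> is the denominator contributed by the root
  \<beta>^-2 Q^-1, so the two factors telescope into the factor of \<beta> q. One root is lost and
  \<beta> gains a factor q, which leaves \<mu> unchanged.\<close>

lemma hw_series_mset_reduce:
  assumes "\<beta> \<noteq> 0" "x = inverse \<beta>^2 * inverse Q"
  shows "hw_series_mset q Q \<beta> (add_mset x A) = hw_series_mset q Q (\<beta> * q) A"
proof -
  have "inverse q^2 * inverse \<beta>^2 = inverse (\<beta> * q)^2" by (simp add: power_mult_distrib mult.commute)
  then have "fac (inverse \<beta>^2) (inverse Q) * fac (inverse q^2) x = fac (inverse (\<beta> * q)^2) (inverse Q)"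
    unfolding assms(2) fac_absorb by simp
  then show ?thesis unfolding hw_series_mset_def by (simp flip: mult.assoc)
qed

lemma reduced_hw_series:
  assumes "\<beta> \<noteq> 0"
  shows "\<exists>B \<beta>'. \<beta>' \<noteq> 0 \<and> \<beta>' * q ^ size B = \<beta> * q ^ size A \<and>
    hw_series_mset q Q \<beta>' B = hw_series_mset q Q \<beta> A \<and> inverse \<beta>'^2 * inverse Q \<notin># B"
  using assms
proof (induction "size A" arbitrary: A \<beta>)
  case 0
  then show ?case by (intro exI[of _ A] exI[of _ \<beta>]) simp
next
  case (Suc k)
  show ?case
  proof (cases "inverse \<beta>^2 * inverse Q \<in># A")
    case True
    then obtain B where B: "A = add_mset (inverse \<beta>^2 * inverse Q) B" by (metis mset_add)
    have "k = size B" "\<beta> * q \<noteq> 0" using Suc(2) B Suc.prems q0 by auto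
    from Suc.hyps(1)[OF this] obtain C \<beta>' where C: "\<beta>' \<noteq> 0" "\<beta>' * q ^ size C = \<beta> * q * q ^ size B"
      "hw_series_mset q Q \<beta>' C = hw_series_mset q Q (\<beta> * q) B" "inverse \<beta>'^2 * inverse Q \<notin># C" by blast
    have "hw_series_mset q Q \<beta>' C = hw_series_mset q Q \<beta> A"
      unfolding C(3) B by (rule hw_series_mset_reduce[OF Suc.prems refl, symmetric])
    moreover have "\<beta>' * q ^ size C = \<beta> * q ^ size A" unfolding C(2) B by simp
    ultimately show ?thesis using C(1,4) by blast
  next
    case False
    then show ?thesis using Suc.prems by blast
  qed
qed

text \<open>If \<beta> = \<beta>' q^j, then j applications of \<open>drinfeld_eq_step\<close> carry
  the solution for \<open>A\<close> to the value of \<eta> belonging to \<beta>', where it must be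
  the solution for \<open>B\<close> by uniqueness. For positive j the last factor adjoined is 1 -
  \<beta>'^-2 Q^-1 z, so \<open>B\<close> would contain the excluded root.\<close>

lemma hw_series_mset_inj_aux:
  assumes b: "\<beta> \<noteq> 0" "\<beta>' \<noteq> 0" and m: "\<beta> * q ^ size A = \<beta>' * q ^ size B"
    and e: "hw_series_mset q Q \<beta> A = hw_series_mset q Q \<beta>' B" and le: "size A \<le> size B"
    and red: "inverse \<beta>'^2 * inverse Q \<notin># B"
  shows "\<beta> = \<beta>' \<and> size A = size B \<and> linear_prod A = linear_prod B"
proof -
  obtain j where j: "size B = size A + j" using le by (metis le_iff_add)
  have bb: "\<beta> = \<beta>' * q ^ j" using m q0 unfolding j by (simp add: power_add)
  define \<eta> where "\<eta> i = (q^2) ^ i * (inverse \<beta>^2 * inverse Q)" for i :: nat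
  have \<eta>S: "\<eta> (Suc i) = q^2 * \<eta> i" for i by (simp add: \<eta>_def mult.assoc)
  define P where "P = rec_nat (linear_prod A) (\<lambda>k f. f * linf (\<eta> (Suc k)))"
  have PS: "P (Suc i) = P i * linf (\<eta> (Suc i))" for i by (simp add: P_def)
  have P: "drinfeld_eq q Q (hw_series_mset q Q \<beta> A) (\<eta> i) (P i)" for i
  proof (induction i)
    case 0
    show ?case using drinfeld_eq_hw_series[of q Q \<beta> A] by (simp add: P_def \<eta>_def)
  next
    case (Suc i)
    show ?case using drinfeld_eq_step[OF q0 Suc] unfolding PS \<eta>S .
  qed
  have \<eta>j: "\<eta> j = inverse \<beta>'^2 * inverse Q"
    unfolding \<eta>_def bb using q0 by (simp add: power_mult_distrib power_inverse field_simps flip: power_mult)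
  have PB: "P j = linear_prod B"
    using drinfeld_eq_unique[OF q0 nroot hw_series_mset_0[of q Q \<beta> A] P[of j]]
      drinfeld_eq_hw_series[of q Q \<beta>' B] unfolding e \<eta>j by blast
  have "j = 0"
  proof (rule ccontr)
    assume "j \<noteq> 0"
    then obtain i where i: "j = Suc i" by (cases j) auto
    have poly: "\<exists>p. P i = fps_of_poly p" for i
    proof (induction i)
      case 0
      show ?case using linear_prod_poly[of A] by (auto simp: P_def)
    next
      case (Suc i)
      then obtain p where "P i = fps_of_poly p" by blast
      then have "P (Suc i) = fps_of_poly (p * [:1, -\<eta> (Suc i):])"
        unfolding PS fps_of_poly_mult
        by (simp add: linf_def fps_of_poly_pCons mult.commute flip: fps_const_neg)
      then show ?case by blast
    qed
    obtain p where p: "P i = fps_of_poly p" using poly by blast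
    have l: "linf (\<eta> j) = fps_of_poly [:1, -\<eta> j:]"
      by (simp add: linf_def fps_of_poly_pCons mult.commute flip: fps_const_neg)
    have "fps_of_poly (\<Prod>x\<in>#B. [:1, -x:]) = fps_of_poly (p * [:1, -\<eta> j:])"
      unfolding linear_prod_poly[symmetric] PB[symmetric] fps_of_poly_mult p[symmetric] l[symmetric]
      unfolding i PS ..
    then have pe: "(\<Prod>x\<in>#B. [:1, -x:]) = p * [:1, -\<eta> j:]" by (simp only: fps_of_poly_eq_iff)
    have \<eta>0: "\<eta> j \<noteq> 0" unfolding \<eta>j using b(2) Q0 by simp
    have "poly (\<Prod>x\<in>#B. [:1, -x:]) (inverse (\<eta> j)) = 0" unfolding pe poly_mult using \<eta>0 by simp
    then obtain x where "x \<in># B" "1 - x * inverse (\<eta> j) = 0"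
      unfolding poly_linear_prod by (auto simp: prod_mset_zero_iff)
    then have "\<eta> j \<in># B" using \<eta>0 by (auto simp: field_simps)
    then show False using red unfolding \<eta>j by simp
  qed
  then show ?thesis using bb PB j by (simp add: P_def)
qed

end

text \<open>Zero roots leave no trace in \<open>linear_prod\<close>; the equality of sizes accounts
  for them.\<close>

lemma monic_eq_of_linear_prod:
  assumes e: "linear_prod A = linear_prod B" and s: "size A = size B"
  shows "(\<Prod>x\<in>#A. [:-x, 1:]) = (\<Prod>x\<in>#B. [:-x, 1:])"
proof -
  have r: "(\<Prod>x\<in>#A. [:1, -x:]) = (\<Prod>x\<in>#B. [:1, -x:])"
    using e unfolding linear_prod_poly by (simp only: fps_of_poly_eq_iff)
  \<comment> \<open>Reversal is available only at nonzero arguments; the factor x makes both sides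
    agree at 0 as well and is cancelled at the end.\<close>
  have "poly ([:0, 1:] * (\<Prod>x\<in>#A. [:-x, 1:])) y = poly ([:0, 1:] * (\<Prod>x\<in>#B. [:-x, 1:])) y" for y
  proof (cases "y = 0")
    case False
    then show ?thesis
      using reversed_linear_prod[OF False, of A] reversed_linear_prod[OF False, of B] r s by simp
  qed simp
  then have "[:0, 1:] * (\<Prod>x\<in>#A. [:-x, 1:]) = [:0, 1:] * (\<Prod>x\<in>#B. [:-x, 1:])"
    unfolding poly_eq_poly_eq_iff[symmetric] by (rule ext)
  then show ?thesis by (simp only: mult_left_cancel pCons_eq_0_iff one_neq_zero simp_thms)
qed

section \<open>Classification\<close>

lemma is_L_cong:
  assumes "fst u = fst u'" "\<And>t. t > 0 \<Longrightarrow> snd u t = snd u' t"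
  shows "is_L q Q M u \<longleftrightarrow> is_L q Q M u'"
  using assms unfolding is_L_def hw_vector_def by auto

lemma simple_generated:
  assumes "simple_umod M" "v \<in> carrier_vec (dim M)" "v \<noteq> 0\<^sub>v (dim M)"
  shows "generated_by M v"
  using assms unfolding simple_umod_def generated_by_def by blast

lemma hw_vector_iso:
  assumes um: "is_umod q Q M" "is_umod q Q N" and iso: "iso_umod M N" and w: "hw_vector N u w"
    and q: "q \<noteq> 0" "\<not> root_of_unity q"
  shows "\<exists>v. hw_vector M u v"
proof -
  interpret M: umodule q Q M using um q by unfold_locales
  interpret N: umodule q Q N using um q by unfold_locales
  let ?n = "dim M"
  have d: "dim N = ?n" using iso unfolding iso_umod_def by simp
  obtain P Pi where PP: "P \<in> carrier_mat ?n ?n" "Pi \<in> carrier_mat ?n ?n" "P * Pi = 1\<^sub>m ?n" "Pi * P = 1\<^sub>m ?n"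
    and tw: "\<And>t. P * Xp M t = Xp N t * P" "\<And>t. P * J M t = J N t * P" "P * Kp M = Kp N * P"
    using iso unfolding iso_umod_def d by blast
  have w: "w \<in> carrier_vec ?n" "w \<noteq> 0\<^sub>v ?n" "\<And>t. Xp N t *\<^sub>v w = 0\<^sub>v ?n" "Kp N *\<^sub>v w = fst u \<cdot>\<^sub>v w"
    "\<And>t. t > 0 \<Longrightarrow> J N t *\<^sub>v w = snd u t \<cdot>\<^sub>v w"
    using w unfolding hw_vector_def d by auto
  have Pw: "Pi *\<^sub>v w \<in> carrier_vec ?n" using mult_mat_vec_carrier[OF PP(2) w(1)] .
  have PPi: "P *\<^sub>v (Pi *\<^sub>v w) = w"
    unfolding assoc_mult_mat_vec[OF PP(1,2) w(1), symmetric] PP(3) using w(1) by simp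
  have tr: "X *\<^sub>v (Pi *\<^sub>v w) = Pi *\<^sub>v (Y *\<^sub>v w)"
    if X: "X \<in> carrier_mat ?n ?n" and Y: "Y \<in> carrier_mat ?n ?n" and e: "P * X = Y * P" for X Y
  proof -
    have y: "X *\<^sub>v (Pi *\<^sub>v w) \<in> carrier_vec ?n" using mult_mat_vec_carrier[OF X Pw] .
    have "P *\<^sub>v (X *\<^sub>v (Pi *\<^sub>v w)) = Y *\<^sub>v (P *\<^sub>v (Pi *\<^sub>v w))"
      unfolding assoc_mult_mat_vec[OF PP(1) X Pw, symmetric] e assoc_mult_mat_vec[OF Y PP(1) Pw] ..
    then have "Pi *\<^sub>v (P *\<^sub>v (X *\<^sub>v (Pi *\<^sub>v w))) = Pi *\<^sub>v (Y *\<^sub>v w)" unfolding PPi by simp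
    moreover have "Pi *\<^sub>v (P *\<^sub>v (X *\<^sub>v (Pi *\<^sub>v w))) = X *\<^sub>v (Pi *\<^sub>v w)"
      unfolding assoc_mult_mat_vec[OF PP(2,1) y, symmetric] PP(4) using y by simp
    ultimately show ?thesis by simp
  qed
  have cN: "Xp N t \<in> carrier_mat ?n ?n" "J N t \<in> carrier_mat ?n ?n" "Kp N \<in> carrier_mat ?n ?n" for t
    using N.carriers unfolding d by simp_all
  have z: "Pi *\<^sub>v 0\<^sub>v ?n = 0\<^sub>v ?n" using PP(2) by (intro eq_vecI) auto
  have "Pi *\<^sub>v w \<noteq> 0\<^sub>v ?n"
  proof
    assume "Pi *\<^sub>v w = 0\<^sub>v ?n"
    then have "w = P *\<^sub>v 0\<^sub>v ?n" using PPi by simp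
    also have "\<dots> = 0\<^sub>v ?n" using PP(1) by (intro eq_vecI) auto
    finally show False using w(2) by simp
  qed
  moreover have "Xp M t *\<^sub>v (Pi *\<^sub>v w) = 0\<^sub>v ?n" for t
    unfolding tr[OF M.carriers(1) cN(1) tw(1)] w(3) by (rule z)
  moreover have "Kp M *\<^sub>v (Pi *\<^sub>v w) = fst u \<cdot>\<^sub>v (Pi *\<^sub>v w)"
    unfolding tr[OF M.carriers(4) cN(3) tw(3)] w(4) by (rule mult_mat_vec[OF PP(2) w(1)])
  moreover have "J M t *\<^sub>v (Pi *\<^sub>v w) = snd u t \<cdot>\<^sub>v (Pi *\<^sub>v w)" if "t > 0" for t
    unfolding tr[OF M.carriers(3) cN(2) tw(2)] w(5)[OF that] by (rule mult_mat_vec[OF PP(2) w(1)])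
  ultimately show ?thesis unfolding hw_vector_def using Pw by blast
qed

lemma polysQ_reduced:
  assumes "phi \<in> polysQ Q"
  shows "phi \<noteq> 0" "lead_coeff phi \<noteq> 0" "inverse (lead_coeff phi)^2 * inverse Q \<notin># proots phi"
  using assms unfolding polysQ_def by auto

context
  fixes q Q :: complex
  assumes q0: "q \<noteq> 0" and nroot: "\<not> root_of_unity q" and Q0: "Q \<noteq> 0"
begin

lemma is_L_exists:
  assumes "phi \<noteq> 0"
  shows "\<exists>M. is_L q Q M (uQ q Q phi)"
proof -
  let ?b = "lead_coeff phi" and ?A = "proots phi"
  have c0: "q - inverse q \<noteq> 0" by (rule q_minus_inverse[OF q0 nroot])
  have b: "?b \<noteq> 0" using assms by simp
  obtain \<omega> where \<omega>:
    "vacuum_functional q Q (?b * q ^ size ?A) (\<lambda>t. fps_nth (hw_series_mset q Q ?b ?A) t / (q - inverse q)) \<omega>"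
    "\<And>I w. finite I \<Longrightarrow> 2 ^ size ?A < card I \<Longrightarrow>
       \<exists>c. (\<exists>i\<in>I. c i \<noteq> 0) \<and> (\<forall>b. (\<Sum>i\<in>I. c i * \<omega> (b @ w (i :: gen list))) = 0)"
    by (rule vacuum_functional_hw_series_mset[OF q0 c0 Q0 b, of ?A]) (rule that)
  have m0: "?b * q ^ size ?A \<noteq> 0" using b q0 by simp
  from finite_rank_vacuum_is_L[OF q0 nroot m0 \<omega>]
  obtain M where "is_L q Q M (?b * q ^ size ?A, \<lambda>t. fps_nth (hw_series_mset q Q ?b ?A) t / (q - inverse q))" ..
  moreover have "is_L q Q M (uQ q Q phi) \<longleftrightarrow>
    is_L q Q M (?b * q ^ size ?A, \<lambda>t. fps_nth (hw_series_mset q Q ?b ?A) t / (q - inverse q))" for M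
    by (rule is_L_cong) (simp_all add: uQ_eq[OF q0 c0 assms])
  ultimately show ?thesis by blast
qed

lemma uQ_injective:
  assumes phi: "phi \<in> polysQ Q" and psi: "psi \<in> polysQ Q"
    and f: "fst (uQ q Q phi) = fst (uQ q Q psi)" and s: "\<And>t. t > 0 \<Longrightarrow> snd (uQ q Q phi) t = snd (uQ q Q psi) t"
  shows "phi = psi"
proof -
  have c0: "q - inverse q \<noteq> 0" by (rule q_minus_inverse[OF q0 nroot])
  note p = polysQ_reduced[OF phi] and r = polysQ_reduced[OF psi]
  have m: "lead_coeff phi * q ^ size (proots phi) = lead_coeff psi * q ^ size (proots psi)"
    using f unfolding uQ_eq(1)[OF q0 c0 p(1)] uQ_eq(1)[OF q0 c0 r(1)] .
  have e: "hw_series_mset q Q (lead_coeff phi) (proots phi) = hw_series_mset q Q (lead_coeff psi) (proots psi)"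
  proof (rule fps_ext)
    fix t
    show "fps_nth (hw_series_mset q Q (lead_coeff phi) (proots phi)) t =
        fps_nth (hw_series_mset q Q (lead_coeff psi) (proots psi)) t"
    proof (cases "t = 0")
      case True
      then show ?thesis by (simp only: hw_series_mset_0)
    next
      case False
      then have "t > 0" by simp
      from s[OF this] show ?thesis
        unfolding uQ_eq(2)[OF q0 c0 p(1) \<open>t > 0\<close>] uQ_eq(2)[OF q0 c0 r(1) \<open>t > 0\<close>] using c0 by simp
    qed
  qed
  have "lead_coeff phi = lead_coeff psi \<and> size (proots phi) = size (proots psi) \<and>
    linear_prod (proots phi) = linear_prod (proots psi)"
  proof (cases "size (proots phi) \<le> size (proots psi)")
    case True
    show ?thesis by (rule hw_series_mset_inj_aux[OF q0 nroot Q0 p(2) r(2) m e True r(3)])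
  next
    case False
    then have "size (proots psi) \<le> size (proots phi)" by simp
    from hw_series_mset_inj_aux[OF q0 nroot Q0 r(2) p(2) m[symmetric] e[symmetric] this p(3)]
    show ?thesis by simp
  qed
  then have "lead_coeff phi = lead_coeff psi"
    and "(\<Prod>x\<in>#proots phi. [:-x, 1:]) = (\<Prod>x\<in>#proots psi. [:-x, 1:])"
    using monic_eq_of_linear_prod[of "proots phi" "proots psi"] by blast+
  then have "smult (lead_coeff phi) (\<Prod>x\<in>#proots phi. [:-x, 1:]) = smult (lead_coeff psi) (\<Prod>x\<in>#proots psi. [:-x, 1:])"
    by simp
  then show ?thesis unfolding poly_roots_factorization(1)[OF p(1)] poly_roots_factorization(1)[OF r(1)] .
qed

text \<open>A highest weight vector of \<open>N\<close> is transported to \<open>M\<close>, where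
  all highest weight vectors have the same weight.\<close>

lemma is_L_iso_injective:
  assumes phi: "phi \<in> polysQ Q" and psi: "psi \<in> polysQ Q"
    and L: "is_L q Q M (uQ q Q phi)" "is_L q Q N (uQ q Q psi)" and iso: "iso_umod M N"
  shows "phi = psi"
proof -
  obtain v w' where M: "is_umod q Q M" "simple_umod M" "hw_vector M (uQ q Q phi) v" "generated_by M v"
    and N: "is_umod q Q N" "hw_vector N (uQ q Q psi) w'"
    using L unfolding is_L_def by blast
  obtain w where w: "hw_vector M (uQ q Q psi) w"
    using hw_vector_iso[OF M(1) N(1) iso N(2) q0 nroot] ..
  interpret U: umodule q Q M using M(1) q0 nroot by unfold_locales
  have v': "hw_vector M (fst (uQ q Q phi), snd (uQ q Q phi)) v" using M(3) by simp
  have w': "hw_vector M (fst (uQ q Q psi), snd (uQ q Q psi)) w" using w by simp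
  have gw: "generated_by M w"
    by (rule simple_generated[OF M(2)]) (use w in \<open>simp_all add: hw_vector_def\<close>)
  interpret hw_module q Q M "fst (uQ q Q phi)" "snd (uQ q Q phi)" v
    using v' M(4) U.hw_vector_nonzero_eigenvalue[OF v'] by unfold_locales
  show ?thesis
    using hw_vector_unique[OF w' gw U.hw_vector_nonzero_eigenvalue[OF w']] by (intro uQ_injective[OF phi psi]) simp_all
qed

text \<open>A highest weight vector exists and generates; nilpotency of \<open>Xm M 0\<close> on it
  yields some \<beta> and a multiset of roots, and the excluded root is removed before the
  polynomial is formed.\<close>

lemma simple_is_L:
  assumes M: "is_umod q Q M" "simple_umod M"
  shows "\<exists>phi\<in>polysQ Q. is_L q Q M (uQ q Q phi)"
proof -
  have c0: "q - inverse q \<noteq> 0" by (rule q_minus_inverse[OF q0 nroot])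
  interpret U: umodule q Q M using M(1) q0 nroot by unfold_locales
  have "0 < dim M" using M(2) unfolding simple_umod_def by simp
  then obtain \<mu> u v where v: "hw_vector M (\<mu>, u) v" by (rule U.hw_vector_exists)
  have g: "generated_by M v"
    by (rule simple_generated[OF M(2)]) (use v in \<open>simp_all add: hw_vector_def\<close>)
  have L: "is_L q Q M (\<mu>, u)"
    unfolding is_L_def by (intro conjI exI[of _ v] M v g)
  interpret hw_module q Q M \<mu> u v
    using v g U.hw_vector_nonzero_eigenvalue[OF v] by unfold_locales
  obtain A \<beta> where A: "\<mu> = \<beta> * q ^ size A" "\<beta> \<noteq> 0"
    "\<And>t. t > 0 \<Longrightarrow> u t = fps_nth (hw_series_mset q Q \<beta> A) t / (q - inverse q)"
    using vacuum_drinfeld_polynomial[OF q0 nroot Q0 m0 vacuum_functional vacuum_lowering] by blast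
  obtain B \<beta>' where B: "\<beta>' \<noteq> 0" "\<beta>' * q ^ size B = \<beta> * q ^ size A"
    "hw_series_mset q Q \<beta>' B = hw_series_mset q Q \<beta> A" "inverse \<beta>'^2 * inverse Q \<notin># B"
    using reduced_hw_series[OF q0 nroot Q0 A(2), of A] by blast
  define phi where "phi = smult \<beta>' (\<Prod>x\<in>#B. [:-x, 1:])"
  have l: "lead_coeff phi = \<beta>'" unfolding phi_def lead_coeff_smult lead_coeff_linear_factors by simp
  have r: "proots phi = B" unfolding phi_def proots_smult[OF B(1)] by (rule proots_linear_factors)
  have phi0: "phi \<noteq> 0" unfolding leading_coeff_0_iff[symmetric] l by (rule B(1))
  have "poly phi (inverse \<beta>'^2 * inverse Q) \<noteq> 0"
    using B(4) set_count_proots[OF phi0] unfolding r by blast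
  then have "phi \<in> polysQ Q"
    unfolding polysQ_def mem_Collect_eq l using phi0 by (rule conjI[rotated])
  moreover from L have "is_L q Q M (uQ q Q phi)"
    by (subst is_L_cong[of _ "(\<mu>, u)"]) (simp_all add: uQ_eq[OF q0 c0 phi0] l r A B)
  ultimately show ?thesis by blast
qed

end

text \<open>The map is expressed through the relation \<open>is_L\<close> on matrix modules, so
  existence of \<open>M\<close> carries finite dimensionality; the other two clauses are injectivity
  and surjectivity.\<close>

theorem mainTheorem6:
  fixes q Q :: complex
  assumes "q \<noteq> 0" and "\<not> root_of_unity q" and "Q \<noteq> 0"
  shows "(\<forall>phi\<in>polysQ Q. \<exists>M. is_L q Q M (uQ q Q phi))
       \<and> (\<forall>phi\<in>polysQ Q. \<forall>psi\<in>polysQ Q. \<forall>M N.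
            is_L q Q M (uQ q Q phi) \<and> is_L q Q N (uQ q Q psi) \<and> iso_umod M N \<longrightarrow> phi = psi)
       \<and> (\<forall>M. is_umod q Q M \<and> simple_umod M \<longrightarrow> (\<exists>phi\<in>polysQ Q. is_L q Q M (uQ q Q phi)))"
proof (intro conjI ballI allI impI)
  show "\<exists>M. is_L q Q M (uQ q Q phi)" if "phi \<in> polysQ Q" for phi
    by (rule is_L_exists[OF assms polysQ_reduced(1)[OF that]])
  show "phi = psi"
    if "phi \<in> polysQ Q" "psi \<in> polysQ Q" "is_L q Q M (uQ q Q phi) \<and> is_L q Q N (uQ q Q psi) \<and> iso_umod M N"
    for phi psi M N
    using is_L_iso_injective[OF assms that(1,2)] that(3) by blast
  show "\<exists>phi\<in>polysQ Q. is_L q Q M (uQ q Q phi)" if "is_umod q Q M \<and> simple_umod M" for M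
    using simple_is_L[OF assms] that by blast
qed

end
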